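(* Let $\mathfrak{A}$ be a unital AF algebra and fix any non-decreasing sequence of finite-dimensional C*-subalgebras $\mathcal{U}=(\mathfrak{A}_n)_{n\in\mathbb{N}}$ such that $\mathfrak{A}=\overline{\bigcup_{n\in\mathbb{N}}\mathfrak{A}_n}^{\|\cdot\|_{\mathfrak{A}}}$. Let $(\mathrm{Prim}(\mathfrak{A}),\mathsf{m}_{i(\mathcal{U})})$ denote $\mathrm{Prim}(\mathfrak{A})$ equipped with the relative topology induced by the metric topology of $\mathsf{m}_{i(\mathcal{U})}$ on $\mathrm{Ideal}(\mathfrak{A})$. (1) If the Jacobson topology on $\mathrm{Prim}(\mathfrak{A})$ is Hausdorff, then $(\mathrm{Prim}(\mathfrak{A}),\mathsf{m}_{i(\mathcal{U})})$ has the same topology as the Jacobson topology or the relative Fell topology on $\mathrm{Prim}(\mathfrak{A})$ (i.e. these three topologies coincide). (2) If $\mathfrak{A}$ is a unital commutative AF algebra, then $(\mathrm{Prim}(\mathfrak{A}),\mathsf{m}_{i(\mathcal{U})})$ is homeomorphic to the space $M_{\mathfrak{A}}$ of non-zero multiplicative linear functionals on $\mathfrak{A}$ with its weak-* topology, the homeomorphism being given by $\varphi\in M_{\mathfrak{A}}\longmapsto\ker\varphi\in\mathrm{Prim}(\mathfrak{A})$.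
   Context: $\mathbb{N}=\{0,1,2,\dots\}$. $\mathrm{Ideal}(\mathfrak{A})$ is the set of norm-closed two-sided ideals of $\mathfrak{A}$, including $\{0\}$ and $\mathfrak{A}$; $\mathrm{Prim}(\mathfrak{A})\subseteq\mathrm{Ideal}(\mathfrak{A})$ is the set of kernels of non-zero irreducible *-representations of $\mathfrak{A}$. The Jacobson topology on $\mathrm{Prim}(\mathfrak{A})$ is the topology whose closed sets are the sets $\{J\in\mathrm{Prim}(\mathfrak{A}): J\supseteq I\}$, $I\in\mathrm{Ideal}(\mathfrak{A})$. For a topological space $X$, let $\mathcal{C}l(X)$ be the set of its closed subsets; the Fell topology on $\mathcal{C}l(X)$ has as basis the sets $U(K,F)=\{Y\in\mathcal{C}l(X): Y\cap K=\emptyset \text{ and } Y\cap A\neq\emptyset \text{ for all } A\in F\}$, where $K\subseteq X$ is compact and $F$ is a finite family of non-empty open subsets of $X$. The Fell topology on $\mathrm{Ideal}(\mathfrak{A})$ is the initial topology induced by the bijection $I\in\mathrm{Ideal}(\mathfrak{A})\mapsto\{J\in\mathrm{Prim}(\mathfrak{A}):J\supseteq I\}\in\mathcal{C}l(\mathrm{Prim}(\mathfrak{A}))$, where $\mathrm{Prim}(\mathfrak{A})$ carries the Jacobson topology. The metric $\mathsf{m}_{i(\mathcal{U})}$ on $\mathrm{Ideal}(\mathfrak{A})$ is defined by $\mathsf{m}_{i(\mathcal{U})}(I,J)=0$ if $I\cap\mathfrak{A}_n=J\cap\mathfrak{A}_n$ for all $n\in\mathbb{N}$, and $\mathsf{m}_{i(\mathcal{U})}(I,J)=2^{-\min\{m\in\mathbb{N}: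 I\cap\mathfrak{A}_m\neq J\cap\mathfrak{A}_m\}}$ otherwise. *)

theory Defs
  imports "HOL-Analysis.Analysis" "HOL-Library.Function_Algebras"
begin

section \<open>C*-algebras\<close>

text \<open>A C*-algebra is a type of the class below. No unit is required; the algebra may be zero.\<close>

class cstar_algebra = real_normed_algebra + banach +
  fixes scaleC :: "complex \<Rightarrow> 'a \<Rightarrow> 'a"
    and star :: "'a \<Rightarrow> 'a"
  assumes scaleC_add_right: "scaleC c (x + y) = scaleC c x + scaleC c y"
    and scaleC_add_left: "scaleC (c + d) x = scaleC c x + scaleC d x"
    and scaleC_scaleC: "scaleC c (scaleC d x) = scaleC (c * d) x"
    and scaleR_scaleC: "scaleR r x = scaleC (of_real r) x"
    and mult_scaleC_left: "scaleC c x * y = scaleC c (x * y)"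
    and mult_scaleC_right: "x * scaleC c y = scaleC c (x * y)"
    and norm_scaleC: "norm (scaleC c x) = cmod c * norm x"
    and star_add: "star (x + y) = star x + star y"
    and star_scaleC: "star (scaleC c x) = scaleC (cnj c) (star x)"
    and star_mult: "star (x * y) = star y * star x"
    and star_star: "star (star x) = x"
    and cstar_identity: "norm (star x * x) = (norm x)\<^sup>2"

interpretation complex_vs: vector_space "scaleC :: complex \<Rightarrow> 'a \<Rightarrow> 'a::cstar_algebra"
proof
  show "scaleC 1 x = x" for x :: 'a
    using scaleR_scaleC[of 1 x] by simp
qed (simp_all add: scaleC_add_right scaleC_add_left scaleC_scaleC)

definition unital_algebra :: "'a::cstar_algebra itself \<Rightarrow> bool" where
  "unital_algebra _ \<longleftrightarrow> (\<exists>e::'a. \<forall>x. e * x = x \<and> x * e = x)"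

definition commutative_algebra :: "'a::cstar_algebra itself \<Rightarrow> bool" where
  "commutative_algebra _ \<longleftrightarrow> (\<forall>x y::'a. x * y = y * x)"

definition cstar_subalgebra :: "'a::cstar_algebra set \<Rightarrow> bool" where
  "cstar_subalgebra B \<longleftrightarrow> complex_vs.subspace B \<and> closed B \<and>
     (\<forall>x\<in>B. \<forall>y\<in>B. x * y \<in> B) \<and> (\<forall>x\<in>B. star x \<in> B)"

definition finite_dimensional :: "'a::cstar_algebra set \<Rightarrow> bool" where
  "finite_dimensional B \<longleftrightarrow> (\<exists>S. finite S \<and> B = complex_vs.span S)"

text \<open>A C*-algebra is AF iff it has a sequence with this property.\<close>

definition AF_sequence :: "(nat \<Rightarrow> 'a::cstar_algebra set) \<Rightarrow> bool" where
  "AF_sequence \<U> \<longleftrightarrow>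
     (\<forall>n. cstar_subalgebra (\<U> n) \<and> finite_dimensional (\<U> n)) \<and>
     (\<forall>n. \<U> n \<subseteq> \<U> (Suc n)) \<and>
     closure (\<Union>n. \<U> n) = UNIV"

definition closed_ideals :: "'a::cstar_algebra set set" where
  "closed_ideals = {I. complex_vs.subspace I \<and> closed I \<and>
     (\<forall>a\<in>I. \<forall>x. x * a \<in> I \<and> a * x \<in> I)}"


section \<open>Irreducible *-representations\<close>

text \<open>A Hilbert space is a linear subspace \<open>H\<close> of an ambient complex vector space, together with
  an inner product (linear in the first argument) that is complete on \<open>H\<close>; the values of \<open>ip\<close>
  outside \<open>H\<close> are irrelevant.\<close>

locale complex_inner_product_space = vector_space scale
  for scale :: "complex \<Rightarrow> 'h::ab_group_add \<Rightarrow> 'h" +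
  fixes H :: "'h set" and ip :: "'h \<Rightarrow> 'h \<Rightarrow> complex"
  assumes H_subspace: "subspace H"
    and ip_add_left: "\<lbrakk>x \<in> H; y \<in> H; z \<in> H\<rbrakk> \<Longrightarrow> ip (x + y) z = ip x z + ip y z"
    and ip_scale_left: "\<lbrakk>x \<in> H; y \<in> H\<rbrakk> \<Longrightarrow> ip (scale c x) y = c * ip x y"
    and ip_commute: "\<lbrakk>x \<in> H; y \<in> H\<rbrakk> \<Longrightarrow> ip x y = cnj (ip y x)"
    and ip_pos: "\<lbrakk>x \<in> H; x \<noteq> 0\<rbrakk> \<Longrightarrow> Re (ip x x) > 0"
begin

definition hnorm :: "'h \<Rightarrow> real" where
  "hnorm x = sqrt (Re (ip x x))"

definition hclosed :: "'h set \<Rightarrow> bool" where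
  "hclosed K \<longleftrightarrow>
     (\<forall>\<sigma>. \<forall>x\<in>H. (\<forall>n. \<sigma> n \<in> K) \<longrightarrow> (\<lambda>n. hnorm (\<sigma> n - x)) \<longlonglongrightarrow> 0 \<longrightarrow> x \<in> K)"

end

locale complex_hilbert_space = complex_inner_product_space +
  assumes H_complete:
    "\<lbrakk>\<And>n. \<sigma> n \<in> H; \<forall>e>0. \<exists>N. \<forall>m\<ge>N. \<forall>n\<ge>N. hnorm (\<sigma> m - \<sigma> n) < e\<rbrakk>
       \<Longrightarrow> \<exists>x\<in>H. (\<lambda>n. hnorm (\<sigma> n - x)) \<longlonglongrightarrow> 0"

locale star_representation = complex_hilbert_space scale H ip
  for scale :: "complex \<Rightarrow> 'h::ab_group_add \<Rightarrow> 'h" and H ip +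
  fixes \<pi> :: "'a::cstar_algebra \<Rightarrow> 'h \<Rightarrow> 'h"
  assumes rep_in: "x \<in> H \<Longrightarrow> \<pi> a x \<in> H"
    and rep_op_add: "\<lbrakk>x \<in> H; y \<in> H\<rbrakk> \<Longrightarrow> \<pi> a (x + y) = \<pi> a x + \<pi> a y"
    and rep_op_scale: "x \<in> H \<Longrightarrow> \<pi> a (scale c x) = scale c (\<pi> a x)"
    and rep_op_bounded: "\<exists>B. \<forall>x\<in>H. hnorm (\<pi> a x) \<le> B * hnorm x"
    and rep_add: "x \<in> H \<Longrightarrow> \<pi> (a + b) x = \<pi> a x + \<pi> b x"
    and rep_scaleC: "x \<in> H \<Longrightarrow> \<pi> (scaleC c a) x = scale c (\<pi> a x)"
    and rep_mult: "x \<in> H \<Longrightarrow> \<pi> (a * b) x = \<pi> a (\<pi> b x)"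
    and rep_star: "\<lbrakk>x \<in> H; y \<in> H\<rbrakk> \<Longrightarrow> ip (\<pi> (star a) x) y = ip x (\<pi> a y)"

locale irreducible_representation = star_representation scale H ip \<pi>
  for scale :: "complex \<Rightarrow> 'h::ab_group_add \<Rightarrow> 'h" and H ip
    and \<pi> :: "'a::cstar_algebra \<Rightarrow> 'h \<Rightarrow> 'h" +
  assumes rep_nonzero: "\<exists>a. \<exists>x\<in>H. \<pi> a x \<noteq> 0"
    and rep_irreducible:
      "\<lbrakk>subspace K; K \<subseteq> H; hclosed K; \<And>a x. x \<in> K \<Longrightarrow> \<pi> a x \<in> K\<rbrakk> \<Longrightarrow> K = {0} \<or> K = H"

definition rep_kernel :: "'h set \<Rightarrow> ('a \<Rightarrow> 'h \<Rightarrow> 'h::ab_group_add) \<Rightarrow> 'a set" where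
  "rep_kernel H \<pi> = {a. \<forall>x\<in>H. \<pi> a x = 0}"

text \<open>The Hilbert spaces in the definition of \<open>Prim\<close> range over subspaces, with arbitrary inner
  product, of the function space \<open>'a \<Rightarrow> complex\<close> with pointwise operations. This type
  contains a copy of every irreducible representation, so the choice is no restriction: see the
  theorem \<open>rep_kernel_in_Prim\<close> below.\<close>

definition fun_scale :: "complex \<Rightarrow> ('b \<Rightarrow> complex) \<Rightarrow> 'b \<Rightarrow> complex" where
  "fun_scale c f = (\<lambda>x. c * f x)"

definition Prim :: "'a::cstar_algebra set set" where
  "Prim = {rep_kernel H \<pi> | (H :: ('a \<Rightarrow> complex) set) ip \<pi>.
             irreducible_representation fun_scale H ip \<pi>}"

context complex_inner_product_space
begin

lemma H_zero: "0 \<in> H"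
  and H_add: "x \<in> H \<Longrightarrow> y \<in> H \<Longrightarrow> x + y \<in> H"
  and H_scale: "x \<in> H \<Longrightarrow> scale c x \<in> H"
  and H_diff: "x \<in> H \<Longrightarrow> y \<in> H \<Longrightarrow> x - y \<in> H"
  using H_subspace by (auto intro: subspace_0 subspace_add subspace_scale subspace_diff)

lemma ip_zero_left: "y \<in> H \<Longrightarrow> ip 0 y = 0"
  using ip_scale_left[of 0 y 0] H_zero by simp

lemma ip_zero_right: "y \<in> H \<Longrightarrow> ip y 0 = 0"
  by (subst ip_commute) (simp_all add: ip_zero_left H_zero)

lemma ip_diff_left:
  assumes "x \<in> H" "y \<in> H" "z \<in> H"
  shows "ip (x - y) z = ip x z - ip y z"
  using ip_add_left[of "x - y" y z] assms H_diff by simp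

lemma ip_diff_right:
  assumes "x \<in> H" "y \<in> H" "z \<in> H"
  shows "ip z (x - y) = ip z x - ip z y"
  unfolding ip_commute[OF assms(3) assms(1)] ip_commute[OF assms(3) assms(2)]
    ip_commute[OF assms(3) H_diff[OF assms(1,2)]] ip_diff_left[OF assms] by simp

lemma ip_scale_right:
  assumes "x \<in> H" "y \<in> H"
  shows "ip y (scale c x) = cnj c * ip y x"
  unfolding ip_commute[OF assms(2,1)] ip_commute[OF assms(2) H_scale[OF assms(1)]]
    ip_scale_left[OF assms] by simp

lemma ip_self: assumes "x \<in> H" shows "Im (ip x x) = 0" "Re (ip x x) \<ge> 0"
proof -
  show "Im (ip x x) = 0"
    using arg_cong[OF ip_commute[OF assms assms], of Im] by simp
  show "Re (ip x x) \<ge> 0"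
    using ip_pos[OF assms] ip_zero_left[OF H_zero] by (cases "x = 0") auto
qed

lemma hnorm_ge_0: "x \<in> H \<Longrightarrow> hnorm x \<ge> 0"
  by (simp add: hnorm_def ip_self)

lemma hnorm_sq: "x \<in> H \<Longrightarrow> (hnorm x)\<^sup>2 = Re (ip x x)"
  by (simp add: hnorm_def ip_self)

lemma hnorm_eq_0: "x \<in> H \<Longrightarrow> hnorm x = 0 \<longleftrightarrow> x = 0"
  using ip_pos[of x] ip_zero_left[OF H_zero] by (force simp: hnorm_def)

lemma ip_cauchy_schwarz:
  assumes x: "x \<in> H" and y: "y \<in> H"
  shows "cmod (ip x y) \<le> hnorm x * hnorm y"
proof (cases "y = 0")
  case True
  then show ?thesis using ip_zero_right x hnorm_ge_0[OF x] hnorm_ge_0[OF y] by simp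
next
  case False
  define r where "r = Re (ip y y)"
  have r: "r > 0" and yy: "ip y y = of_real r"
    using ip_pos[OF y False] ip_self[OF y] by (auto simp: r_def complex_eq_iff)
  define c where "c = ip x y / of_real r"
  have yx: "ip y x = cnj (ip x y)" using ip_commute[OF y x] .
  have cr: "cnj c * of_real r = cnj (ip x y)" using r by (simp add: c_def)
  have cz: "cnj c * ip x y = of_real ((cmod (ip x y))\<^sup>2 / r)"
    unfolding of_real_divide complex_norm_square by (simp add: c_def)
  have cy: "scale c y \<in> H" and xcy: "x - scale c y \<in> H" using x y H_scale H_diff by auto
  have "ip (x - scale c y) (x - scale c y)
      = ip x x - cnj c * ip x y - (c * cnj (ip x y) - c * (cnj c * of_real r))"
    unfolding ip_diff_left[OF x cy xcy] ip_diff_right[OF x cy x] ip_diff_right[OF x cy cy]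
      ip_scale_right[OF y x] ip_scale_left[OF y x] ip_scale_right[OF y cy] ip_scale_left[OF y y]
      yx yy
    by (simp add: algebra_simps)
  also have "\<dots> = ip x x - of_real ((cmod (ip x y))\<^sup>2 / r)"
    unfolding cr cz by simp
  finally have "Re (ip (x - scale c y) (x - scale c y)) = Re (ip x x) - (cmod (ip x y))\<^sup>2 / r"
    by simp
  then have "(cmod (ip x y))\<^sup>2 / r \<le> Re (ip x x)"
    using ip_self(2)[OF xcy] by linarith
  then have "(cmod (ip x y))\<^sup>2 \<le> Re (ip x x) * Re (ip y y)"
    using r by (simp add: pos_divide_le_eq flip: r_def)
  then have "(cmod (ip x y))\<^sup>2 \<le> (hnorm x * hnorm y)\<^sup>2"
    by (simp add: power_mult_distrib hnorm_sq x y)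
  then show ?thesis
    by (rule power2_le_imp_le) (simp add: hnorm_ge_0 x y)
qed

end

context star_representation
begin

lemma rep_op_zero: "\<pi> a 0 = 0"
  using rep_op_scale[of 0 a 0] H_zero by simp

lemma rep_op_diff: "x \<in> H \<Longrightarrow> y \<in> H \<Longrightarrow> \<pi> a (x - y) = \<pi> a x - \<pi> a y"
  using rep_op_add[of "x - y" y a] H_diff by (simp add: algebra_simps)

lemma hclosed_annihilator: "hclosed {x \<in> H. \<forall>a\<in>I. \<pi> a x = 0}"
  unfolding hclosed_def
proof (intro allI ballI impI)
  fix \<sigma> x
  assume x: "x \<in> H" and s: "\<forall>n. \<sigma> n \<in> {x \<in> H. \<forall>a\<in>I. \<pi> a x = 0}"
    and lim: "(\<lambda>n. hnorm (\<sigma> n - x)) \<longlonglongrightarrow> 0"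
  have "\<pi> a x = 0" if a: "a \<in> I" for a
  proof -
    obtain B where B: "\<And>y. y \<in> H \<Longrightarrow> hnorm (\<pi> a y) \<le> B * hnorm y"
      using rep_op_bounded by blast
    have "hnorm (0 - \<pi> a x) \<le> B * hnorm (\<sigma> n - x)" for n
      using B[of "\<sigma> n - x"] rep_op_diff[of "\<sigma> n" x a] s x a H_diff by simp
    moreover have "(\<lambda>n. B * hnorm (\<sigma> n - x)) \<longlonglongrightarrow> 0"
      using tendsto_mult_left[OF lim, of B] by simp
    ultimately have "hnorm (0 - \<pi> a x) \<le> 0"
      by (intro LIMSEQ_le_const) auto
    then show "\<pi> a x = 0"
      using hnorm_ge_0[of "0 - \<pi> a x"] hnorm_eq_0[of "0 - \<pi> a x"] rep_in[OF x] H_zero H_diff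
      by (metis eq_iff right_minus_eq)
  qed
  then show "x \<in> {x \<in> H. \<forall>a\<in>I. \<pi> a x = 0}" using x by simp
qed

lemma hclosed_orthogonal:
  assumes Y: "Y \<subseteq> H"
  shows "hclosed {x \<in> H. \<forall>y\<in>Y. ip x y = 0}"
  unfolding hclosed_def
proof (intro allI ballI impI)
  fix \<sigma> x
  assume x: "x \<in> H" and s: "\<forall>n. \<sigma> n \<in> {x \<in> H. \<forall>y\<in>Y. ip x y = 0}"
    and lim: "(\<lambda>n. hnorm (\<sigma> n - x)) \<longlonglongrightarrow> 0"
  have "ip x y = 0" if y: "y \<in> Y" for y
  proof -
    have yH: "y \<in> H" using y Y by blast
    have "cmod (ip x y) \<le> hnorm (\<sigma> n - x) * hnorm y" for n
      using ip_cauchy_schwarz[of "\<sigma> n - x" y] ip_diff_left[of "\<sigma> n" x y] s x y yH H_diff by simp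
    moreover have "(\<lambda>n. hnorm (\<sigma> n - x) * hnorm y) \<longlonglongrightarrow> 0"
      using tendsto_mult_right[OF lim, of "hnorm y"] by simp
    ultimately have "cmod (ip x y) \<le> 0"
      by (intro LIMSEQ_le_const) auto
    then show "ip x y = 0" by simp
  qed
  then show "x \<in> {x \<in> H. \<forall>y\<in>Y. ip x y = 0}" using x by simp
qed

end

context irreducible_representation
begin

lemma kernel_prime:
  assumes I: "I \<in> closed_ideals" and J: "J \<in> closed_ideals" and sub: "I \<inter> J \<subseteq> rep_kernel H \<pi>"
  shows "I \<subseteq> rep_kernel H \<pi> \<or> J \<subseteq> rep_kernel H \<pi>"
proof (rule disjCI)
  assume "\<not> J \<subseteq> rep_kernel H \<pi>"
  then obtain b z where b: "b \<in> J" "z \<in> H" "\<pi> b z \<noteq> 0"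
    by (auto simp: rep_kernel_def)
  define K where "K = {x \<in> H. \<forall>a\<in>J. \<pi> a x = 0}"
  have "subspace K"
    unfolding K_def
    by (rule subspaceI) (auto simp: rep_op_zero rep_op_add rep_op_scale H_zero H_add H_scale)
  moreover have "\<pi> a x \<in> K" if "x \<in> K" for a x
  proof -
    have "\<pi> c (\<pi> a x) = 0" if "c \<in> J" for c
    proof -
      have "c * a \<in> J" using J that by (simp add: closed_ideals_def)
      then show ?thesis using \<open>x \<in> K\<close> rep_mult[of x c a] by (simp add: K_def)
    qed
    then show ?thesis using that rep_in by (simp add: K_def)
  qed
  moreover have "K \<noteq> H" using b by (auto simp: K_def)
  ultimately have K: "K = {0}"
    using rep_irreducible[of K] hclosed_annihilator[of J] by (auto simp: K_def)
  show "I \<subseteq> rep_kernel H \<pi>"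
  proof
    fix a assume a: "a \<in> I"
    have "\<pi> a x \<in> K" if x: "x \<in> H" for x
    proof -
      have "\<pi> c (\<pi> a x) = 0" if c: "c \<in> J" for c
      proof -
        have "c * a \<in> I \<inter> J" using I J a c by (simp add: closed_ideals_def)
        then show ?thesis using sub x rep_mult[of x c a] by (auto simp: rep_kernel_def)
      qed
      then show ?thesis using x rep_in by (simp add: K_def)
    qed
    then show "a \<in> rep_kernel H \<pi>" using K by (auto simp: rep_kernel_def)
  qed
qed

end

lemma vector_space_fun_scale: "vector_space (fun_scale :: complex \<Rightarrow> ('b \<Rightarrow> complex) \<Rightarrow> _)"
  by unfold_locales (auto simp: fun_scale_def algebra_simps)

theorem (in irreducible_representation) rep_kernel_in_Prim: "rep_kernel H \<pi> \<in> Prim"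
proof -
  obtain a0 \<xi> where xi: "\<xi> \<in> H" "\<pi> a0 \<xi> \<noteq> 0" using rep_nonzero by blast
  define T where "T = (\<lambda>x a. ip x (\<pi> a \<xi>))"
  define S where "S = inv_into H T"
  define H' where "H' = T ` H"
  define ip' where "ip' = (\<lambda>f g. ip (S f) (S g))"
  define \<rho> where "\<rho> = (\<lambda>a f. T (\<pi> a (S f)))"
  have pxi: "\<pi> a \<xi> \<in> H" for a using xi rep_in by simp
  have T_add: "T (x + y) = T x + T y" if "x \<in> H" "y \<in> H" for x y
    using that pxi by (auto simp: T_def ip_add_left)
  have T_scale: "T (scale c x) = fun_scale c (T x)" if "x \<in> H" for x c
    using that pxi by (auto simp: T_def fun_scale_def ip_scale_left)
  have T_diff: "T (x - y) = T x - T y" if "x \<in> H" "y \<in> H" for x y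
    using that pxi by (auto simp: T_def ip_diff_left)
  have T_0: "T 0 = 0"
    using pxi by (auto simp: T_def ip_zero_left)
  define K where "K = {x \<in> H. \<forall>y\<in>range (\<lambda>a. \<pi> a \<xi>). ip x y = 0}"
  have K_alt: "x \<in> K \<longleftrightarrow> x \<in> H \<and> T x = 0" for x
    by (auto simp: K_def T_def fun_eq_iff)
  have "subspace K"
    by (rule subspaceI)
      (auto simp: K_alt T_0 T_add T_scale H_zero H_add H_scale fun_scale_def)
  moreover have "hclosed K"
    unfolding K_def using pxi by (intro hclosed_orthogonal) auto
  moreover have "\<pi> a x \<in> K" if "x \<in> K" for a x
  proof -
    have x: "x \<in> H" using that by (simp add: K_def)
    have "ip (\<pi> a x) (\<pi> b \<xi>) = 0" for b
    proof -
      have "ip (\<pi> a x) (\<pi> b \<xi>) = ip x (\<pi> (star a * b) \<xi>)"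
        using rep_star[OF x pxi[of b], of "star a"] by (simp only: star_star rep_mult[OF xi(1)])
      then show ?thesis using that by (simp add: K_def)
    qed
    then show ?thesis using rep_in[OF x] by (auto simp: K_def)
  qed
  moreover have "\<pi> a0 \<xi> \<notin> K"
    using ip_pos[OF pxi xi(2)] by (auto simp: K_def intro!: exI[of _ a0])
  then have "K \<noteq> H" using pxi by auto
  ultimately have K0: "K = {0}"
    using rep_irreducible[of K] by (auto simp: K_def)
  have inj: "inj_on T H"
  proof (rule inj_onI)
    fix x y assume "x \<in> H" "y \<in> H" "T x = T y"
    then have "x - y \<in> K" using T_diff H_diff by (simp add: K_alt)
    then show "x = y" using K0 by simp
  qed
  have ST: "S (T x) = x" if "x \<in> H" for x
    using inj that by (simp add: S_def)
  interpret F: vector_space "fun_scale :: complex \<Rightarrow> ('a \<Rightarrow> complex) \<Rightarrow> _"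
    by (rule vector_space_fun_scale)
  have T_eq0: "T x = 0 \<longleftrightarrow> x = 0" if "x \<in> H" for x
    using inj T_0 that H_zero by (metis inj_on_eq_iff)
  interpret P: complex_inner_product_space fun_scale H' ip'
  proof
    show "F.subspace H'"
    proof (rule F.subspaceI)
      show "0 \<in> H'"
        unfolding H'_def T_0[symmetric] using H_zero by (rule imageI)
      show "x + y \<in> H'" if "x \<in> H'" "y \<in> H'" for x y
        using that by (auto simp: H'_def H_add simp flip: T_add)
      show "fun_scale c x \<in> H'" if "x \<in> H'" for c x
        using that by (auto simp: H'_def H_scale simp flip: T_scale)
    qed
    show "ip' (x + y) z = ip' x z + ip' y z" if "x \<in> H'" "y \<in> H'" "z \<in> H'" for x y z
      using that by (auto simp: H'_def ip'_def ST ip_add_left H_add simp flip: T_add)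
    show "ip' (fun_scale c x) y = c * ip' x y" if "x \<in> H'" "y \<in> H'" for x y c
      using that by (auto simp: H'_def ip'_def ST ip_scale_left H_scale simp flip: T_scale)
    show "ip' x y = cnj (ip' y x)" if "x \<in> H'" "y \<in> H'" for x y
    proof -
      have "S x \<in> H" "S y \<in> H" using that by (auto simp: H'_def ST)
      then show ?thesis unfolding ip'_def by (rule ip_commute)
    qed
    show "Re (ip' x x) > 0" if x: "x \<in> H'" "x \<noteq> 0" for x
    proof -
      obtain h where h: "h \<in> H" "x = T h" using x by (auto simp: H'_def)
      then have "h \<noteq> 0" using x T_0 by auto
      then show ?thesis using h ip_pos by (simp add: ip'_def ST)
    qed
  qed
  have nrm: "P.hnorm (T x) = hnorm x" if "x \<in> H" for x
    unfolding P.hnorm_def hnorm_def using that by (simp add: ip'_def ST)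
  have nrmd: "P.hnorm (T x - T y) = hnorm (x - y)" if "x \<in> H" "y \<in> H" for x y
    using nrm[OF H_diff[OF that]] T_diff[OF that] by simp
  interpret Q: complex_hilbert_space fun_scale H' ip'
  proof
    fix \<sigma> :: "nat \<Rightarrow> 'a \<Rightarrow> complex"
    assume s: "\<And>n. \<sigma> n \<in> H'"
      and C: "\<forall>e>0. \<exists>N. \<forall>m\<ge>N. \<forall>n\<ge>N. P.hnorm (\<sigma> m - \<sigma> n) < e"
    have "\<exists>\<tau>. \<forall>n. \<tau> n \<in> H \<and> \<sigma> n = T (\<tau> n)"
      using s unfolding H'_def by (intro choice) auto
    then obtain \<tau> where t: "\<And>n. \<tau> n \<in> H" "\<And>n. \<sigma> n = T (\<tau> n)" by blast
    obtain x where x: "x \<in> H" "(\<lambda>n. hnorm (\<tau> n - x)) \<longlonglongrightarrow> 0"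
      using H_complete[of \<tau>] t C by (auto simp: nrmd)
    then show "\<exists>x\<in>H'. (\<lambda>n. P.hnorm (\<sigma> n - x)) \<longlonglongrightarrow> 0"
      by (intro bexI[of _ "T x"]) (auto simp: t nrmd H'_def)
  qed
  interpret R: star_representation fun_scale H' ip' \<rho>
  proof
    fix a b :: 'a and c :: complex and x y :: "'a \<Rightarrow> complex"
    show "\<rho> a x \<in> H'" if "x \<in> H'"
      using that rep_in by (auto simp: H'_def \<rho>_def ST)
    show "\<rho> a (x + y) = \<rho> a x + \<rho> a y" if "x \<in> H'" "y \<in> H'"
      using that by (auto simp: H'_def \<rho>_def ST H_add rep_op_add rep_in simp flip: T_add)
    show "\<rho> a (fun_scale c x) = fun_scale c (\<rho> a x)" if "x \<in> H'"
      using that by (auto simp: H'_def \<rho>_def ST H_scale rep_op_scale rep_in simp flip: T_scale)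
    show "\<exists>B. \<forall>x\<in>H'. P.hnorm (\<rho> a x) \<le> B * P.hnorm x"
      using rep_op_bounded[of a] by (auto simp: H'_def \<rho>_def ST nrm rep_in)
    show "\<rho> (a + b) x = \<rho> a x + \<rho> b x" if "x \<in> H'"
      using that by (auto simp: H'_def \<rho>_def ST rep_add rep_in simp flip: T_add)
    show "\<rho> (scaleC c a) x = fun_scale c (\<rho> a x)" if "x \<in> H'"
      using that by (auto simp: H'_def \<rho>_def ST rep_scaleC rep_in simp flip: T_scale)
    show "\<rho> (a * b) x = \<rho> a (\<rho> b x)" if "x \<in> H'"
      using that by (auto simp: H'_def \<rho>_def ST rep_mult rep_in)
    show "ip' (\<rho> (star a) x) y = ip' x (\<rho> a y)" if "x \<in> H'" "y \<in> H'"
      using that by (auto simp: H'_def \<rho>_def ip'_def ST rep_star rep_in)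
  qed
  interpret X: irreducible_representation fun_scale H' ip' \<rho>
  proof
    show "\<exists>a. \<exists>x\<in>H'. \<rho> a x \<noteq> 0"
    proof (intro exI bexI)
      show "\<rho> a0 (T \<xi>) \<noteq> 0" using xi pxi by (simp add: \<rho>_def ST T_eq0)
      show "T \<xi> \<in> H'" using xi by (simp add: H'_def)
    qed
    fix L assume L: "F.subspace L" "L \<subseteq> H'" "P.hclosed L"
      and inv: "\<And>a x. x \<in> L \<Longrightarrow> \<rho> a x \<in> L"
    define M where "M = {x \<in> H. T x \<in> L}"
    have LM: "L = T ` M" using L(2) by (auto simp: M_def H'_def)
    have "subspace M"
      using L(1) by (intro subspaceI)
        (auto simp: M_def T_0 T_add T_scale H_zero H_add H_scale
          F.subspace_0 F.subspace_add F.subspace_scale)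
    moreover have "hclosed M"
      unfolding hclosed_def
    proof (intro allI ballI impI)
      fix \<sigma> x assume x: "x \<in> H" and s: "\<forall>n. \<sigma> n \<in> M" and l: "(\<lambda>n. hnorm (\<sigma> n - x)) \<longlonglongrightarrow> 0"
      have "(\<lambda>n. P.hnorm (T (\<sigma> n) - T x)) \<longlonglongrightarrow> 0"
        using l s x by (simp add: M_def nrmd)
      then have "T x \<in> L"
        using L(3) s x unfolding P.hclosed_def by (auto simp: M_def H'_def)
      then show "x \<in> M" using x by (simp add: M_def)
    qed
    moreover have "\<pi> a x \<in> M" if "x \<in> M" for a x
      using inv[of "T x" a] that rep_in by (simp add: M_def \<rho>_def ST)
    ultimately have "M = {0} \<or> M = H"
      using rep_irreducible[of M] by (auto simp: M_def)
    then show "L = {0} \<or> L = H'"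
      using LM T_0 by (auto simp: H'_def)
  qed
  have "rep_kernel H \<pi> = rep_kernel H' \<rho>"
    by (auto simp: rep_kernel_def H'_def \<rho>_def ST T_eq0 rep_in)
  then show ?thesis
    unfolding Prim_def using X.irreducible_representation_axioms by blast
qed



subsection \<open>Primitive ideals are closed ideals\<close>

lemma norm_star_le: "norm (x :: 'a::cstar_algebra) \<le> norm (star x)"
proof (cases "x = 0")
  case False
  have "norm x * norm x \<le> norm (star x) * norm x"
    using cstar_identity[of x] norm_mult_ineq[of "star x" x] by (simp add: power2_eq_square)
  then show ?thesis using False by simp
qed simp

lemma norm_star: "norm (star (x :: 'a::cstar_algebra)) = norm x"
  using norm_star_le[of x] norm_star_le[of "star x"] by (simp add: star_star)

lemma star_diff: "star (x - y) = star x - star (y :: 'a::cstar_algebra)"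
  using star_add[of "x - y" y] by simp

lemma star_scaleR: "star (scaleR r x) = scaleR r (star (x :: 'a::cstar_algebra))"
  by (simp add: scaleR_scaleC star_scaleC)

lemma selfadjoint_root:
  fixes x :: "'a::cstar_algebra"
  assumes sx: "star x = x" and x: "norm x < 1"
  obtains y where "star y = y" "x = y + y - y * y"
proof -
  define r where "r = 1 - sqrt (1 - norm x)"
  have r: "0 \<le> r" "r < 1" using x by (auto simp: r_def)
  have "(sqrt (1 - norm x))\<^sup>2 = 1 - norm x" using x by simp
  then have "(1 - r)\<^sup>2 = 1 - norm x" by (simp only: r_def diff_diff_eq2 add_diff_cancel_left')
  then have rr: "(norm x + r * r) / 2 = r" by (simp add: power2_eq_square algebra_simps)
  define Y where "Y = {y :: 'a. star y = y} \<inter> cball 0 r"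
  define f where "f = (\<lambda>y. (1/2) *\<^sub>R (x + y * y))"
  have "closed {y :: 'a. star y = y}"
  proof (rule closed_Collect_eq)
    show "continuous_on UNIV (star :: 'a \<Rightarrow> 'a)"
      unfolding continuous_on_iff
      by (metis dist_norm norm_star star_diff)
  qed (rule continuous_on_id)
  then have "complete Y" unfolding Y_def by (simp add: complete_eq_closed closed_Int)
  moreover have "star (0 :: 'a) = 0" using star_diff[of 0 0] by simp
  then have "Y \<noteq> {}" using r by (auto simp: Y_def)
  moreover have "f ` Y \<subseteq> Y"
  proof
    fix z assume "z \<in> f ` Y"
    then obtain y where y: "y \<in> Y" "z = f y" by blast
    have "norm (y * y) \<le> r * r"
      using norm_mult_ineq[of y y] y r mult_mono[of "norm y" r "norm y" r] by (simp add: Y_def)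
    then have "norm z \<le> (norm x + r * r) / 2"
      using norm_triangle_ineq[of x "y * y"] y by (simp add: f_def)
    then show "z \<in> Y"
      using y sx rr by (simp add: Y_def f_def star_scaleR star_add star_mult)
  qed
  moreover have "dist (f y) (f z) \<le> r * dist y z" if "y \<in> Y" "z \<in> Y" for y z
  proof -
    have "f y - f z = (1/2) *\<^sub>R (y * (y - z) + (y - z) * z)"
      by (simp add: f_def algebra_simps)
    moreover have "norm (y * (y - z) + (y - z) * z) \<le> r * norm (y - z) + norm (y - z) * r"
      using that
      by (intro order_trans[OF norm_triangle_ineq] add_mono order_trans[OF norm_mult_ineq]
          mult_left_mono mult_right_mono) (auto simp: Y_def)
    ultimately show ?thesis by (simp add: dist_norm)
  qed
  ultimately obtain y where y: "y \<in> Y" "f y = y"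
    using Banach_fix[of Y r f] r by blast
  have "x + y * y = 2 *\<^sub>R f y" by (simp add: f_def)
  then have "x = y + y - y * y" using y(2) by (simp add: scaleR_2 algebra_simps)
  moreover have "star y = y" using y(1) by (simp add: Y_def)
  ultimately show ?thesis by (intro that)
qed

context star_representation
begin

lemma rep_zero: "x \<in> H \<Longrightarrow> \<pi> 0 x = 0"
  using rep_add[of x 0 0] by simp

lemma rep_diff: "x \<in> H \<Longrightarrow> \<pi> (a - b) x = \<pi> a x - \<pi> b x"
  using rep_add[of x "a - b" b] by (simp add: algebra_simps)

lemma rep_contractive_aux:
  assumes a: "norm a < 1" and x: "x \<in> H"
  shows "hnorm (\<pi> a x) \<le> hnorm x"
proof -
  have "norm (star a * a) < 1"
    using a by (simp add: cstar_identity power_less_one_iff)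
  moreover have "star (star a * a) = star a * a" by (simp add: star_mult star_star)
  ultimately obtain y where y: "star y = y" "star a * a = y + y - y * y"
    using selfadjoint_root by metis
  define v where "v = \<pi> y x"
  have v: "v \<in> H" using rep_in x by (simp add: v_def)
  have vx: "ip v x = ip x v" using rep_star[OF x x, of y] y by (simp add: v_def)
  have vv: "ip (\<pi> y v) x = ip v v" using rep_star[OF v x, of y] y by (simp add: v_def)
  have "ip (\<pi> a x) (\<pi> a x) = ip (\<pi> (star a * a) x) x"
    using rep_star[OF rep_in[OF x] x, of a a] x by (simp add: rep_mult)
  also have "\<dots> = ip v x + ip x v - ip v v"
    unfolding y(2) rep_diff[OF x] rep_add[OF x] rep_mult[OF x] v_def[symmetric]
    using x v rep_in[OF v] by (simp add: ip_diff_left ip_add_left vx vv H_add)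
  also have "\<dots> = ip x x - ip (x - v) (x - v)"
    using x v H_diff by (simp add: ip_diff_left ip_diff_right)
  finally have "(hnorm (\<pi> a x))\<^sup>2 \<le> (hnorm x)\<^sup>2"
    using ip_self[OF H_diff[OF x v]] x rep_in[OF x] by (simp add: hnorm_sq)
  then show ?thesis using hnorm_ge_0[OF x] by (rule power2_le_imp_le)
qed

lemma hnorm_scaleR: "x \<in> H \<Longrightarrow> hnorm (scale (of_real r) x) = \<bar>r\<bar> * hnorm x"
proof -
  assume x: "x \<in> H"
  have "ip (scale (of_real r) x) (scale (of_real r) x) = of_real (r\<^sup>2) * ip x x"
    using x by (simp add: ip_scale_left ip_scale_right H_scale power2_eq_square)
  then show ?thesis by (simp add: hnorm_def real_sqrt_mult)
qed

lemma rep_contractive: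
  assumes x: "x \<in> H"
  shows "hnorm (\<pi> a x) \<le> norm a * hnorm x"
proof (rule field_le_epsilon)
  have *: "hnorm (\<pi> a x) \<le> t * hnorm x" if t: "t > norm a" for t
  proof -
    have t0: "t > 0" using t norm_ge_zero[of a] by linarith
    have "norm (scaleC (of_real (1/t)) a) < 1"
      using t t0 by (simp add: norm_scaleC norm_divide field_simps)
    then have "hnorm (\<pi> (scaleC (of_real (1/t)) a) x) \<le> hnorm x"
      using rep_contractive_aux x by blast
    then have "\<bar>1/t\<bar> * hnorm (\<pi> a x) \<le> hnorm x"
      unfolding rep_scaleC[OF x] hnorm_scaleR[OF rep_in[OF x]] .
    then show ?thesis using t0 by (simp add: field_simps)
  qed
  fix e :: real assume e: "e > 0"
  define d where "d = e / (hnorm x + 1)"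
  have h: "hnorm x \<ge> 0" using x hnorm_ge_0 by simp
  have d: "d > 0" "d * hnorm x \<le> e" using e h by (auto simp: d_def field_simps)
  show "hnorm (\<pi> a x) \<le> norm a * hnorm x + e"
    using *[of "norm a + d"] d by (simp add: algebra_simps)
qed

lemma rep_kernel_closed_ideal: "rep_kernel H \<pi> \<in> closed_ideals"
proof -
  have "complex_vs.subspace (rep_kernel H \<pi>)"
    by (rule complex_vs.subspaceI) (auto simp: rep_kernel_def rep_zero rep_add rep_scaleC)
  moreover have "closed (rep_kernel H \<pi>)"
    unfolding closed_sequential_limits
  proof (intro allI impI)
    fix s a assume s: "(\<forall>n. s n \<in> rep_kernel H \<pi>) \<and> s \<longlonglongrightarrow> a"
    have "\<pi> a x = 0" if x: "x \<in> H" for x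
    proof -
      have "hnorm (\<pi> a x) \<le> norm (a - s n) * hnorm x" for n
        using rep_contractive[OF x, of "a - s n"] s x by (simp add: rep_diff rep_kernel_def)
      moreover have "(\<lambda>n. norm (a - s n) * hnorm x) \<longlonglongrightarrow> norm (a - a) * hnorm x"
        using s by (intro tendsto_intros) auto
      ultimately have "hnorm (\<pi> a x) \<le> 0"
        by (intro LIMSEQ_le_const[of "\<lambda>n. norm (a - s n) * hnorm x"]) auto
      then show ?thesis
        using hnorm_ge_0[OF rep_in[OF x], of a] hnorm_eq_0[OF rep_in[OF x], of a] by simp
    qed
    then show "a \<in> rep_kernel H \<pi>" by (simp add: rep_kernel_def)
  qed
  ultimately show ?thesis
    using rep_in by (auto simp: closed_ideals_def rep_kernel_def rep_mult rep_op_zero)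
qed

end

lemma Prim_closed_ideals: "Prim \<subseteq> closed_ideals"
  unfolding Prim_def
  using star_representation.rep_kernel_closed_ideal irreducible_representation.axioms(1) by blast

lemma Prim_proper: "J \<in> Prim \<Longrightarrow> J \<noteq> UNIV"
  unfolding Prim_def rep_kernel_def
  using irreducible_representation.rep_nonzero by fastforce


section \<open>The Jacobson and Fell topologies\<close>

definition prim_hull :: "'a::cstar_algebra set \<Rightarrow> 'a set set" where
  "prim_hull I = {J \<in> Prim. J \<supseteq> I}"

definition jacobson_topology :: "'a::cstar_algebra set topology" where
  "jacobson_topology = topology (\<lambda>V. \<exists>I\<in>closed_ideals. V = Prim - prim_hull I)"

definition fell_basic :: "'b topology \<Rightarrow> 'b set \<Rightarrow> 'b set set \<Rightarrow> 'b set set" where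
  "fell_basic X K F = {Y. closedin X Y \<and> Y \<inter> K = {} \<and> (\<forall>A\<in>F. Y \<inter> A \<noteq> {})}"

definition fell_topology :: "'b topology \<Rightarrow> 'b set topology" where
  "fell_topology X = topology (arbitrary union_of
     (\<lambda>B. \<exists>K F. compactin X K \<and> finite F \<and> (\<forall>A\<in>F. openin X A \<and> A \<noteq> {}) \<and>
            B = fell_basic X K F))"

definition fell_ideal_topology :: "'a::cstar_algebra set topology" where
  "fell_ideal_topology =
     pullback_topology closed_ideals prim_hull (fell_topology jacobson_topology)"

text \<open>\<open>topology\<close> is only meaningful for families of sets satisfying \<open>istopology\<close>; the two families
  used above do.\<close>

lemma closed_ideals_Inter: "\<I> \<subseteq> closed_ideals \<Longrightarrow> \<Inter>\<I> \<in> closed_ideals"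
  by (auto simp: closed_ideals_def complex_vs.subspace_def intro!: closed_Inter)

lemma zero_closed_ideal: "{0} \<in> closed_ideals"
  by (auto simp: closed_ideals_def)

lemma UNIV_closed_ideal: "UNIV \<in> closed_ideals"
  by (auto simp: closed_ideals_def)

lemma prim_hull_Int:
  assumes "I \<in> closed_ideals" "J \<in> closed_ideals"
  shows "prim_hull (I \<inter> J) = prim_hull I \<union> prim_hull J"
proof -
  have "I \<subseteq> P \<or> J \<subseteq> P" if "P \<in> Prim" "I \<inter> J \<subseteq> P" for P
    using that assms irreducible_representation.kernel_prime unfolding Prim_def by blast
  then show ?thesis unfolding prim_hull_def by blast
qed

lemma istopology_jacobson:
  "istopology (\<lambda>V. \<exists>I\<in>closed_ideals. V = (Prim :: 'a::cstar_algebra set set) - prim_hull I)"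
  unfolding istopology_def
proof (intro conjI allI impI)
  fix V W :: "'a set set"
  assume "\<exists>I\<in>closed_ideals. V = Prim - prim_hull I" "\<exists>I\<in>closed_ideals. W = Prim - prim_hull I"
  then obtain I J where IJ: "I \<in> closed_ideals" "J \<in> closed_ideals"
    "V = Prim - prim_hull I" "W = Prim - prim_hull J" by blast
  show "\<exists>I\<in>closed_ideals. V \<inter> W = Prim - prim_hull I"
  proof
    show "V \<inter> W = Prim - prim_hull (I \<inter> J)" using IJ prim_hull_Int by blast
    show "I \<inter> J \<in> closed_ideals" using IJ closed_ideals_Inter[of "{I, J}"] by simp
  qed
next
  fix \<V> :: "'a set set set"
  assume V: "\<forall>V\<in>\<V>. \<exists>I\<in>closed_ideals. V = Prim - prim_hull I"
  define \<I> where "\<I> = {I \<in> closed_ideals. Prim - prim_hull I \<in> \<V>}"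
  define L where "L = \<Inter>{J \<in> closed_ideals. \<Union>\<I> \<subseteq> J}"
  have L: "L \<in> closed_ideals" unfolding L_def by (rule closed_ideals_Inter) blast
  have L_sub: "L \<subseteq> P \<longleftrightarrow> (\<forall>I\<in>\<I>. I \<subseteq> P)" if P: "P \<in> Prim" for P
  proof
    assume LP: "L \<subseteq> P"
    have "\<Union>\<I> \<subseteq> L" unfolding L_def by (rule Inter_greatest) simp
    then show "\<forall>I\<in>\<I>. I \<subseteq> P" using LP by blast
  next
    assume "\<forall>I\<in>\<I>. I \<subseteq> P"
    then have "P \<in> {J \<in> closed_ideals. \<Union>\<I> \<subseteq> J}"
      using subsetD[OF Prim_closed_ideals P] by (simp add: Sup_le_iff)
    then show "L \<subseteq> P" unfolding L_def by (rule Inter_lower)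
  qed
  have "\<Union>\<V> = (\<Union>I\<in>\<I>. Prim - prim_hull I)"
  proof
    show "\<Union>\<V> \<subseteq> (\<Union>I\<in>\<I>. Prim - prim_hull I)"
    proof (rule Union_least)
      fix V assume "V \<in> \<V>"
      moreover from this V obtain I where "I \<in> closed_ideals" "V = Prim - prim_hull I" by auto
      ultimately have "I \<in> \<I>" "V = Prim - prim_hull I" by (simp_all add: \<I>_def)
      then show "V \<subseteq> (\<Union>I\<in>\<I>. Prim - prim_hull I)" by auto
    qed
    show "(\<Union>I\<in>\<I>. Prim - prim_hull I) \<subseteq> \<Union>\<V>"
      by (rule UN_least) (simp add: \<I>_def Union_upper)
  qed
  also have "\<dots> = Prim - prim_hull L"
  proof -
    have "P \<in> prim_hull L \<longleftrightarrow> (\<forall>I\<in>\<I>. P \<in> prim_hull I)" if "P \<in> Prim" for P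
      using L_sub[OF that] that by (simp add: prim_hull_def)
    then show ?thesis by auto
  qed
  finally have "\<Union>\<V> = Prim - prim_hull L" .
  then show "\<exists>I\<in>closed_ideals. \<Union>\<V> = Prim - prim_hull I" using L by blast
qed

lemma openin_jacobson:
  "openin jacobson_topology V \<longleftrightarrow> (\<exists>I\<in>closed_ideals. V = Prim - prim_hull I)"
  unfolding jacobson_topology_def topology_inverse'[OF istopology_jacobson] ..

lemma topspace_jacobson: "topspace jacobson_topology = (Prim :: 'a::cstar_algebra set set)"
proof
  have "prim_hull UNIV = ({} :: 'a set set)" using Prim_proper by (auto simp: prim_hull_def)
  then have "openin jacobson_topology (Prim :: 'a set set)"
    unfolding openin_jacobson using UNIV_closed_ideal by (intro bexI[of _ UNIV]) simp_all
  then show "Prim \<subseteq> topspace (jacobson_topology :: 'a set topology)" by (rule openin_subset)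
  show "topspace jacobson_topology \<subseteq> (Prim :: 'a set set)"
    using openin_topspace[of "jacobson_topology :: 'a set topology"]
    unfolding openin_jacobson by (elim bexE) simp
qed

lemma closedin_jacobson:
  fixes C :: "'a::cstar_algebra set set"
  shows "closedin jacobson_topology C \<longleftrightarrow> (\<exists>I\<in>closed_ideals. C = prim_hull I)"
proof -
  have "prim_hull I \<subseteq> Prim" for I :: "'a set" by (auto simp: prim_hull_def)
  then have "C \<subseteq> Prim \<and> Prim - C = Prim - prim_hull I \<longleftrightarrow> C = prim_hull I" for I
    by auto
  then show ?thesis unfolding closedin_def topspace_jacobson openin_jacobson by blast
qed

lemma fell_basic_Int: "fell_basic X K F \<inter> fell_basic X K' F' = fell_basic X (K \<union> K') (F \<union> F')"
  by (auto simp: fell_basic_def)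

lemma istopology_fell:
  "istopology (arbitrary union_of
     (\<lambda>B. \<exists>K F. compactin X K \<and> finite F \<and> (\<forall>A\<in>F. openin X A \<and> A \<noteq> {}) \<and>
            B = fell_basic X K F))"
proof (rule istopology_base, elim exE conjE)
  fix S T K F K' F'
  assume "compactin X K" "finite F" "\<forall>A\<in>F. openin X A \<and> A \<noteq> {}" "S = fell_basic X K F"
    "compactin X K'" "finite F'" "\<forall>A\<in>F'. openin X A \<and> A \<noteq> {}" "T = fell_basic X K' F'"
  then show "\<exists>K F. compactin X K \<and> finite F \<and> (\<forall>A\<in>F. openin X A \<and> A \<noteq> {}) \<and>
      S \<inter> T = fell_basic X K F"
    by (intro exI[of _ "K \<union> K'"] exI[of _ "F \<union> F'"]) (auto simp: fell_basic_Int compactin_Un)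
qed

lemma openin_fell:
  "openin (fell_topology X) U \<longleftrightarrow> (arbitrary union_of
     (\<lambda>B. \<exists>K F. compactin X K \<and> finite F \<and> (\<forall>A\<in>F. openin X A \<and> A \<noteq> {}) \<and>
            B = fell_basic X K F)) U"
  unfolding fell_topology_def topology_inverse'[OF istopology_fell] ..

lemma topspace_fell: "topspace (fell_topology X) = {Y. closedin X Y}"
proof
  have "openin (fell_topology X) (fell_basic X {} {})"
    unfolding openin_fell
    by (rule arbitrary_union_of_inc) (intro exI[of _ "{}"], simp)
  then have "fell_basic X {} {} \<subseteq> topspace (fell_topology X)" by (rule openin_subset)
  then show "{Y. closedin X Y} \<subseteq> topspace (fell_topology X)"
    by (simp add: fell_basic_def)
  obtain \<B> where \<B>: "\<Union>\<B> = topspace (fell_topology X)"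
    "\<And>B. B \<in> \<B> \<Longrightarrow> \<exists>K F. B = fell_basic X K F"
    using openin_topspace[of "fell_topology X"]
    unfolding openin_fell union_of_def subset_iff mem_Collect_eq by metis
  have "B \<subseteq> {Y. closedin X Y}" if "B \<in> \<B>" for B
    using \<B>(2)[OF that] by (auto simp: fell_basic_def)
  then show "topspace (fell_topology X) \<subseteq> {Y. closedin X Y}"
    unfolding \<B>(1)[symmetric] by (rule Union_least)
qed

lemma topspace_fell_ideal:
  "topspace fell_ideal_topology = (closed_ideals :: 'a::cstar_algebra set set)"
proof -
  have "closedin jacobson_topology (prim_hull I)" if "I \<in> closed_ideals" for I :: "'a set"
    unfolding closedin_jacobson using that by (intro bexI[of _ I]) simp_all
  then show ?thesis
    unfolding fell_ideal_topology_def topspace_pullback_topology topspace_fell by auto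
qed


section \<open>The metric topology and the character space\<close>

definition ideal_dist ::
  "(nat \<Rightarrow> 'a::cstar_algebra set) \<Rightarrow> 'a set \<Rightarrow> 'a set \<Rightarrow> real" where
  "ideal_dist \<U> I J =
     (if \<forall>n. I \<inter> \<U> n = J \<inter> \<U> n then 0
      else (1/2) ^ (LEAST m. I \<inter> \<U> m \<noteq> J \<inter> \<U> m))"

definition ideal_metric_topology ::
  "(nat \<Rightarrow> 'a::cstar_algebra set) \<Rightarrow> 'a set topology" where
  "ideal_metric_topology \<U> = Metric_space.mtopology closed_ideals (ideal_dist \<U>)"

definition characters :: "('a::cstar_algebra \<Rightarrow> complex) set" where
  "characters = {\<phi>. Vector_Spaces.linear scaleC (*) \<phi> \<and>
     (\<forall>x y. \<phi> (x * y) = \<phi> x * \<phi> y) \<and> (\<exists>x. \<phi> x \<noteq> 0)}"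

text \<open>The weak-* topology is the topology of pointwise convergence.\<close>

definition weak_star_topology :: "('a::cstar_algebra \<Rightarrow> complex) topology" where
  "weak_star_topology = subtopology (product_topology (\<lambda>_. euclidean) UNIV) characters"

end

theory Submission
  imports Defs "HOL-Computational_Algebra.Fundamental_Theorem_Algebra"
begin

text \<open>The metric sees an ideal \<open>I\<close> through its finite-dimensional parts \<open>I \<inter> \<U> n\<close>. Two facts make this
  enough. First, these parts determine \<open>I\<close> (\<open>closed_ideal_subsetI\<close>): the distance of \<open>y \<in> \<U> n\<close>
  from \<open>I\<close> is attained in \<open>I \<inter> \<U> n\<close>. Second, each part is determined by its projections, and finitely
  many projections of \<open>\<U> n\<close> suffice to distinguish all the parts (\<open>finite_test_projections\<close>),
  since close projections lie in the same closed ideals. Hence the metric topology on \<open>Prim\<close> is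
  generated by the sets \<open>{Q. q \<in> Q}\<close> and their complements, where \<open>q\<close> is a projection in a stage
  \<open>\<U> n\<close>. All projections come from one elementary source: a self-adjoint element of norm 1 in a
  finite-dimensional algebra has powers that accumulate at a non-zero projection
  (\<open>projection_limit_of_powers\<close>).

  The sets \<open>{Q. q \<in> Q}\<close> are closed in the Jacobson topology, and the point of the first part of the
  theorem is that their complements are compact (\<open>compactin_projection_nonmembers\<close>), hence closed in
  the Hausdorff case. Compactness needs enough primitive ideals: a closed ideal that does not contain
  \<open>q\<close> must be contained in a primitive ideal that does not contain \<open>q\<close>
  (\<open>primitive_ideal_avoiding_projection\<close>). Such a primitive ideal is found by descending from \<open>q\<close>
  through projections \<open>e n\<close> that are minimal in \<open>\<U> n\<close> and outside the given ideal. The compressions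
  \<open>e n a e n\<close> are asymptotically \<open>state a\<close> times \<open>e n\<close>, which defines a pure state. Its GNS space is the
  algebra modulo the left kernel, which is complete as it stands, and irreducibility follows by
  letting \<open>e n b\<^sup>*\<close> act on the vector of \<open>b\<close>. As to the Fell topology, in a Hausdorff space
  the hull of a primitive ideal \<open>P\<close> is \<open>{P}\<close>, and the Fell topology restricted to singletons is the
  topology of the points.

  If the algebra is commutative, then the state constructed from a primitive ideal in the same way is
  multiplicative, and primeness shows that its kernel is that ideal. So the kernels of characters are
  exactly the primitive ideals; a projection \<open>q\<close> is in the kernel of \<open>\<phi>\<close> iff \<open>\<phi> q\<close> is 0 and not 1,
  and this matches the sets \<open>{Q. q \<in> Q}\<close> with weak-* clopen sets.\<close>


section \<open>Norm estimates and limits in C*-algebras\<close>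

notation scaleC (infixr "*\<^sub>C" 75)

lemma scaleC_one [simp]: "1 *\<^sub>C x = (x :: 'a::cstar_algebra)"
  using scaleR_scaleC[of 1 x] by simp

lemma star_zero [simp]: "star (0 :: 'a::cstar_algebra) = 0"
  using star_diff[of 0 0] by simp

lemma star_minus: "star (- x) = - star (x :: 'a::cstar_algebra)"
  using star_diff[of 0 x] by simp

lemma bounded_bilinear_scaleC: "bounded_bilinear (scaleC :: complex \<Rightarrow> 'a \<Rightarrow> 'a::cstar_algebra)"
proof
  show "(r *\<^sub>R c) *\<^sub>C x = r *\<^sub>R (c *\<^sub>C x)" for r c and x :: 'a
    by (simp add: scaleR_scaleC scaleC_scaleC scaleR_conv_of_real)
  show "c *\<^sub>C (r *\<^sub>R x) = r *\<^sub>R (c *\<^sub>C x)" for r c and x :: 'a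
    by (simp add: scaleR_scaleC scaleC_scaleC mult.commute)
  show "\<exists>K. \<forall>c (x :: 'a). norm (c *\<^sub>C x) \<le> norm c * norm x * K"
    by (intro exI[of _ 1]) (simp add: norm_scaleC)
qed (simp_all add: scaleC_add_left scaleC_add_right)

lemmas tendsto_scaleC [tendsto_intros] = bounded_bilinear.tendsto[OF bounded_bilinear_scaleC]

lemma bounded_linear_star: "bounded_linear (star :: 'a \<Rightarrow> 'a::cstar_algebra)"
  by (rule bounded_linear_intro[of _ 1]) (simp_all add: star_add star_scaleR norm_star)

lemmas tendsto_star [tendsto_intros] = bounded_linear.tendsto[OF bounded_linear_star]

text \<open>The algebra has no unit in its signature, so the powers start at exponent 1.\<close>

primrec spow :: "'a::semigroup_mult \<Rightarrow> nat \<Rightarrow> 'a" where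
  "spow x 0 = x"
| "spow x (Suc n) = x * spow x n"

lemma spow_mult: "spow x m * spow x n = spow x (Suc (m + n))"
  by (induction m) (simp_all add: mult.assoc)

lemma norm_spow_le: "norm (spow x n) \<le> norm (x :: 'a::real_normed_algebra) ^ Suc n"
proof (induction n)
  case (Suc n)
  have "norm (spow x (Suc n)) \<le> norm x * norm (spow x n)"
    by (simp add: norm_mult_ineq)
  also have "\<dots> \<le> norm x * norm x ^ Suc n"
    using Suc by (intro mult_left_mono) auto
  finally show ?case by simp
qed simp

lemma star_spow: "star (h :: 'a::cstar_algebra) = h \<Longrightarrow> star (spow h n) = spow h n"
proof (induction n)
  case (Suc n)
  have "spow h n * h = h * spow h n" using spow_mult[of h n 0] by simp
  then show ?case using Suc by (simp add: star_mult)
qed simp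

lemma norm_selfadjoint_square:
  "star (h :: 'a::cstar_algebra) = h \<Longrightarrow> norm (h * h) = (norm h)\<^sup>2"
  using cstar_identity[of h] by simp

text \<open>By the C*-identity, squaring a self-adjoint element squares its norm; as the norms of the
  powers of a contraction decrease, they all equal 1 if that of the element does.\<close>

lemma norm_spow_selfadjoint:
  assumes h: "star (h :: 'a::cstar_algebra) = h" and n1: "norm h = 1"
  shows "norm (spow h n) = 1"
proof (induction n rule: less_induct)
  case (less n)
  have le: "norm (spow h n) \<le> 1" using norm_spow_le[of h n] n1 by simp
  show ?case
  proof (cases "n = 0")
    case False
    have sq: "norm (spow h (Suc (k + k))) = 1" if "k < n" for k
      using norm_selfadjoint_square[OF star_spow[OF h, of k]] less[OF that] spow_mult[of h k k]
      by simp
    show ?thesis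
    proof (cases "even n")
      case True
      then obtain k where k: "n = k + k" by (metis mult_2 evenE)
      have "k < n" using k False by simp
      have "1 = norm (h * spow h n)" using sq[OF \<open>k < n\<close>] k by simp
      also have "\<dots> \<le> norm (spow h n)" using norm_mult_ineq[of h "spow h n"] n1 by simp
      finally show ?thesis using le by simp
    next
      case odd: False
      then obtain k where k: "n = Suc (k + k)" by (metis mult_2 oddE Suc_eq_plus1)
      then show ?thesis using sq[of k] by simp
    qed
  qed (simp add: n1)
qed


section \<open>Projections, ideals and subalgebras\<close>

definition projection :: "'a::cstar_algebra \<Rightarrow> bool" where
  "projection q \<longleftrightarrow> q * q = q \<and> star q = q"

lemma projection_norm: assumes "projection q" shows "q = 0 \<or> norm q = 1" "norm q \<le> 1"
proof -
  have "norm q = (norm q)\<^sup>2" using assms cstar_identity[of q] by (simp add: projection_def)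
  then show "q = 0 \<or> norm q = 1" by (auto simp: power2_eq_square)
  then show "norm q \<le> 1" by auto
qed

lemma norm_compress_le:
  assumes "norm p \<le> 1" "norm q \<le> 1"
  shows "norm (p * x * q) \<le> norm (x :: 'a::real_normed_algebra)"
proof -
  have "norm (p * x * q) \<le> norm p * norm x * norm q"
    by (meson norm_mult_ineq norm_ge_zero mult_right_mono order_trans)
  also have "\<dots> \<le> 1 * norm x * 1" using assms by (intro mult_mono) auto
  finally show ?thesis by simp
qed

lemma closed_idealsD:
  assumes "I \<in> closed_ideals"
  shows "0 \<in> I" "closed I"
    and "\<And>x y. x \<in> I \<Longrightarrow> y \<in> I \<Longrightarrow> x + y \<in> I"
    and "\<And>x y. x \<in> I \<Longrightarrow> y \<in> I \<Longrightarrow> x - y \<in> I"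
    and "\<And>x c. x \<in> I \<Longrightarrow> c *\<^sub>C x \<in> I"
    and "\<And>x y. y \<in> I \<Longrightarrow> x * y \<in> I"
    and "\<And>x y. x \<in> I \<Longrightarrow> x * y \<in> I"
proof -
  have V: "complex_vs.subspace I" using assms by (simp add: closed_ideals_def)
  show "0 \<in> I" by (rule complex_vs.subspace_0[OF V])
  show "x + y \<in> I" if "x \<in> I" "y \<in> I" for x y
    using that by (rule complex_vs.subspace_add[OF V])
  show "x - y \<in> I" if "x \<in> I" "y \<in> I" for x y
    using that by (rule complex_vs.subspace_diff[OF V])
  show "c *\<^sub>C x \<in> I" if "x \<in> I" for x c
    using that by (rule complex_vs.subspace_scale[OF V])
qed (use assms in \<open>simp_all add: closed_ideals_def\<close>)

lemma cstar_subalgebraD: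
  assumes "cstar_subalgebra B"
  shows "complex_vs.subspace B" "closed B" "0 \<in> B"
    and "\<And>x y. x \<in> B \<Longrightarrow> y \<in> B \<Longrightarrow> x + y \<in> B"
    and "\<And>x y. x \<in> B \<Longrightarrow> y \<in> B \<Longrightarrow> x - y \<in> B"
    and "\<And>x c. x \<in> B \<Longrightarrow> c *\<^sub>C x \<in> B"
    and "\<And>x y. x \<in> B \<Longrightarrow> y \<in> B \<Longrightarrow> x * y \<in> B"
    and "\<And>x. x \<in> B \<Longrightarrow> star x \<in> B"
proof -
  show V: "complex_vs.subspace B" using assms by (simp add: cstar_subalgebra_def)
  show "0 \<in> B" by (rule complex_vs.subspace_0[OF V])
  show "x + y \<in> B" if "x \<in> B" "y \<in> B" for x y
    using that by (rule complex_vs.subspace_add[OF V])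
  show "x - y \<in> B" if "x \<in> B" "y \<in> B" for x y
    using that by (rule complex_vs.subspace_diff[OF V])
  show "c *\<^sub>C x \<in> B" if "x \<in> B" for x c
    using that by (rule complex_vs.subspace_scale[OF V])
qed (use assms in \<open>simp_all add: cstar_subalgebra_def\<close>)

text \<open>Modulo the ideal, the projection becomes an idempotent of norm less than 1, that is, zero.
  In the algebra itself: the powers of \<open>y = q - q z q\<close> tend to 0 and each of them differs
  from \<open>q\<close> by an element of the ideal.\<close>

lemma projection_near_ideal:
  assumes q: "projection q" and I: "I \<in> closed_ideals" and z: "z \<in> I" "norm (q - z) < 1"
  shows "q \<in> I"
proof -
  note J = closed_idealsD[OF I]
  have qq: "q * q = q" using q by (simp add: projection_def)
  define w where "w = q * z * q"
  define y where "y = q - w"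
  have w: "w \<in> I" "q * w = w" "w * q = w"
    using J(6,7) z(1) by (simp_all add: w_def qq mult.assoc) (simp add: qq flip: mult.assoc)
  have "y = q * (q - z) * q" by (simp add: y_def w_def algebra_simps qq)
  then have y1: "norm y < 1"
    using norm_compress_le[of q q "q - z"] projection_norm(2)[OF q] z by simp
  have mem: "q - spow y n \<in> I" for n
  proof (induction n)
    case 0
    then show ?case using w by (simp add: y_def)
  next
    case (Suc n)
    define v where "v = q - spow y n"
    have "q - spow y (Suc n) = q * v + w - w * v"
      by (simp add: y_def v_def algebra_simps qq w)
    moreover have "q * v + w - w * v \<in> I"
      using J(3,4,6,7) w(1) Suc unfolding v_def by blast
    ultimately show ?case by simp
  qed
  have "(\<lambda>n. norm y ^ Suc n) \<longlonglongrightarrow> 0"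
    using y1 LIMSEQ_power_zero[of "norm y"] by (subst filterlim_sequentially_Suc) simp
  then have "(\<lambda>n. spow y n) \<longlonglongrightarrow> 0"
    by (rule Lim_null_comparison[rotated]) (simp add: norm_spow_le del: power_Suc)
  then have "(\<lambda>n. q - spow y n) \<longlonglongrightarrow> q"
    using tendsto_diff[OF tendsto_const[of q]] by fastforce
  then show ?thesis
    using J(2) mem by (metis closed_sequentially)
qed


section \<open>Finite-dimensional subspaces\<close>

text \<open>Local compactness of finite-dimensional spaces, by induction on a spanning set: a new
  vector \<open>b\<close> has positive distance from the span of the others, which bounds its coefficients.\<close>

lemma bounded_seq_span_convergent:
  fixes f :: "nat \<Rightarrow> 'a::cstar_algebra"
  assumes "finite S" "\<And>n. f n \<in> complex_vs.span S" "\<And>n. norm (f n) \<le> M"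
  shows "\<exists>l\<in>complex_vs.span S. \<exists>r. strict_mono r \<and> (f \<circ> r) \<longlonglongrightarrow> l"
  using assms
proof (induction S arbitrary: f M)
  case empty
  then have "f = (\<lambda>_. 0)" by auto
  then show ?case by (auto simp: o_def intro!: exI[of _ id] strict_mono_id)
next
  case (insert b S)
  let ?V = "complex_vs.span S"
  show ?case
  proof (cases "b \<in> ?V")
    case True
    then show ?thesis using insert.IH[of f M] insert.prems complex_vs.span_redundant by metis
  next
    case False
    have "closed ?V"
      unfolding closed_sequential_limits
    proof (intro allI impI)
      fix x l assume x: "(\<forall>n. x n \<in> ?V) \<and> x \<longlonglongrightarrow> l"
      then obtain K where "\<And>n. norm (x n) \<le> K"
        by (metis convergentI convergent_imp_Bseq BseqE)
      then obtain l' r where "l' \<in> ?V" "strict_mono r" "(x \<circ> r) \<longlonglongrightarrow> l'"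
        using insert.IH[of x K] x by blast
      then show "l \<in> ?V" using x LIMSEQ_subseq_LIMSEQ LIMSEQ_unique by metis
    qed
    moreover have "?V \<noteq> {}" using complex_vs.span_zero by blast
    ultimately have d: "infdist b ?V > 0"
      using False in_closed_iff_infdist_zero infdist_nonneg by (metis less_eq_real_def)
    have "\<forall>n. \<exists>k. f n - k *\<^sub>C b \<in> ?V"
      using insert.prems(1) complex_vs.span_breakdown_eq by metis
    then obtain c where c: "\<And>n. f n - c n *\<^sub>C b \<in> ?V" by metis
    have cle: "cmod (c n) \<le> M / infdist b ?V" for n
    proof (cases "c n = 0")
      case True
      then show ?thesis
        using d order_trans[OF norm_ge_zero insert.prems(2)] by (simp add: divide_nonneg_pos)
    next
      case False
      define s where "s = - (inverse (c n) *\<^sub>C (f n - c n *\<^sub>C b))"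
      have "s \<in> ?V" unfolding s_def using c complex_vs.span_scale complex_vs.span_neg by blast
      have "b - s = inverse (c n) *\<^sub>C f n"
        using False by (simp add: s_def complex_vs.scale_right_diff_distrib)
      then have "infdist b ?V \<le> norm (f n) / cmod (c n)"
        using infdist_le[OF \<open>s \<in> ?V\<close>, of b]
        by (simp add: dist_norm norm_scaleC norm_inverse divide_inverse mult.commute)
      then have "cmod (c n) * infdist b ?V \<le> M"
        using False insert.prems(2)[of n] by (simp add: field_simps)
      then show ?thesis using d by (simp add: field_simps)
    qed
    then have "bounded (range c)" by (intro boundedI) auto
    then obtain k r where r: "strict_mono r" "(c \<circ> r) \<longlonglongrightarrow> k"
      using bounded_imp_convergent_subsequence by blast
    let ?g = "\<lambda>n. f (r n) - c (r n) *\<^sub>C b"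
    have "norm (?g n) \<le> M + M / infdist b ?V * norm b" for n
    proof -
      have "norm (?g n) \<le> norm (f (r n)) + cmod (c (r n)) * norm b"
        using norm_triangle_ineq4 by (metis norm_scaleC)
      also have "\<dots> \<le> M + M / infdist b ?V * norm b"
        using insert.prems(2) cle by (intro add_mono mult_right_mono) auto
      finally show ?thesis .
    qed
    then obtain l t where l: "l \<in> ?V" "strict_mono t" "(?g \<circ> t) \<longlonglongrightarrow> l"
      using insert.IH[of ?g] c by blast
    have "(\<lambda>n. ?g (t n) + c (r (t n)) *\<^sub>C b) \<longlonglongrightarrow> l + k *\<^sub>C b"
      using l(3) LIMSEQ_subseq_LIMSEQ[OF r(2) l(2)] by (intro tendsto_intros) (auto simp: o_def)
    then have "(f \<circ> (r \<circ> t)) \<longlonglongrightarrow> l + k *\<^sub>C b" by (simp add: o_def)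
    moreover have "l + k *\<^sub>C b \<in> complex_vs.span (insert b S)"
      using l(1) complex_vs.span_breakdown_eq[of "l + k *\<^sub>C b" b S]
      by (metis add_diff_cancel_right')
    moreover have "strict_mono (r \<circ> t)" using r l strict_mono_o by blast
    ultimately show ?thesis by blast
  qed
qed

lemma finite_dimensional_bounded_seq:
  fixes f :: "nat \<Rightarrow> 'a::cstar_algebra"
  assumes "finite_dimensional B" "\<And>n. f n \<in> B" "\<And>n. norm (f n) \<le> M"
  obtains l r where "l \<in> B" "strict_mono r" "(f \<circ> r) \<longlonglongrightarrow> l"
  using assms bounded_seq_span_convergent unfolding finite_dimensional_def by metis

lemma dim_psubset:
  assumes fd: "finite_dimensional (B :: 'a::cstar_algebra set)"
    and V: "complex_vs.subspace V" "V \<subset> W" and W: "W \<subseteq> B"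
  shows "complex_vs.dim V < complex_vs.dim W"
proof -
  obtain S where S: "finite S" "B = complex_vs.span S"
    using fd unfolding finite_dimensional_def by blast
  obtain w where w: "w \<in> W" "w \<notin> V" using V by blast
  obtain C where C: "C \<subseteq> V" "complex_vs.independent C" "V \<subseteq> complex_vs.span C"
    "card C = complex_vs.dim V" using complex_vs.basis_exists by metis
  have "w \<notin> complex_vs.span C"
    using C V w complex_vs.span_minimal by blast
  then have wC: "complex_vs.independent (insert w C)"
    using C complex_vs.independent_insertI by blast
  have "insert w C \<subseteq> W" using w C V by blast
  then obtain D where D: "insert w C \<subseteq> D" "D \<subseteq> W" "complex_vs.independent D"
    "W \<subseteq> complex_vs.span D" using wC complex_vs.maximal_independent_subset_extend by metis
  have "finite D" using complex_vs.independent_span_bound[OF S(1) D(3)] D(2) W S by blast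
  have "w \<notin> C" using \<open>w \<notin> complex_vs.span C\<close> complex_vs.span_base[of w C] by auto
  have "finite C" using \<open>finite D\<close> D(1) by (meson finite_subset insert_subset)
  then have "Suc (card C) = card (insert w C)" using \<open>w \<notin> C\<close> by simp
  also have "\<dots> \<le> card D" using \<open>finite D\<close> D(1) by (rule card_mono)
  finally show ?thesis using complex_vs.basis_card_eq_dim[OF D(2,4,3)] C(4) by simp
qed

section \<open>Spectral projections as limits of powers\<close>

text \<open>The closure of the powers of \<open>h\<close> is a compact semigroup, so it contains an idempotent.
  Concretely: if \<open>h\<^sup>r\<close> converges to \<open>g\<close> along a sequence of exponents \<open>r\<close>, and \<open>r' - r\<close> runs
  through large differences of such exponents, then a limit \<open>f\<close> of \<open>h\<close> to the power \<open>r' - r\<close>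
  satisfies \<open>f g = g\<close>; if moreover \<open>r' - r\<close> exceeds \<open>r\<close>, then \<open>f\<close> is a multiple of \<open>g\<close>, and so
  \<open>f f = f\<close>. For a self-adjoint \<open>h\<close> of norm 1 in a finite-dimensional algebra \<open>f\<close> is the
  spectral projection of \<open>h\<close> at the eigenvalues \<open>1\<close> and \<open>-1\<close>.\<close>

lemma projection_limit_of_powers:
  assumes fd: "finite_dimensional B" and h: "star h = h" "norm h = 1"
    and B: "\<And>n. spow h n \<in> B"
  obtains f s where "projection f" "f \<noteq> 0" "\<And>k. k \<le> s k" "(\<lambda>k. spow h (s k)) \<longlonglongrightarrow> f"
proof -
  have nrm: "norm (spow h n) = 1" for n using norm_spow_selfadjoint[OF h] .
  obtain g r where r: "strict_mono r" "((\<lambda>n. spow h n) \<circ> r) \<longlonglongrightarrow> g"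
    using finite_dimensional_bounded_seq[OF fd, of "spow h" 1] B nrm by (metis order_refl)
  have "(\<lambda>k. norm (spow h (r k))) \<longlonglongrightarrow> norm g"
    using r(2) by (intro tendsto_intros) (simp add: o_def)
  then have "norm g = 1" by (simp add: nrm LIMSEQ_const_iff)
  then have g0: "g \<noteq> 0" by auto
  \<comment> \<open>\<open>spow h n\<close> has exponent \<open>n + 1\<close>, hence the shifts by 1 and 2; \<open>r (t k) \<ge> t k\<close> is what
    keeps \<open>b k\<close> from being truncated\<close>
  define t where "t k = 2 * r k + k + 2" for k
  define b where "b k = r (t k) - 2 * r k - 2" for k
  have rt: "r (t k) = 2 * r k + b k + 2" for k
    using seq_suble[OF r(1), of "t k"] by (simp add: b_def t_def)
  obtain v u where u: "strict_mono u" "((\<lambda>k. spow h (b k)) \<circ> u) \<longlonglongrightarrow> v"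
    using finite_dimensional_bounded_seq[OF fd, of "\<lambda>k. spow h (b k)" 1] B nrm by (metis order_refl)
  define s where "s k = Suc (r (u k) + b (u k))" for k
  define f where "f = g * v"
  have ru: "(\<lambda>k. spow h (r (u k))) \<longlonglongrightarrow> g"
    using LIMSEQ_subseq_LIMSEQ[OF r(2) u(1)] by (simp add: o_def)
  have "(\<lambda>k. spow h (r (u k)) * spow h (b (u k))) \<longlonglongrightarrow> f"
    unfolding f_def using ru u(2) by (intro tendsto_mult) (simp_all add: o_def)
  then have sf: "(\<lambda>k. spow h (s k)) \<longlonglongrightarrow> f" by (simp add: spow_mult s_def)
  have "k \<le> s k" for k
    using seq_suble[OF u(1), of k] seq_suble[OF r(1), of "u k"] by (simp add: s_def)
  moreover have fg: "f * g = g"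
  proof -
    have "strict_mono t"
      using r(1) by (auto simp: strict_mono_def t_def intro!: add_less_mono)
    then have "((\<lambda>n. spow h n) \<circ> r \<circ> (t \<circ> u)) \<longlonglongrightarrow> g"
      by (intro LIMSEQ_subseq_LIMSEQ r(2) strict_mono_o u(1))
    moreover have "r (t (u k)) = Suc (s k + r (u k))" for k
      by (simp add: s_def rt)
    then have "spow h (r (t (u k))) = spow h (s k) * spow h (r (u k))" for k
      by (simp only: spow_mult)
    ultimately have "(\<lambda>k. spow h (s k) * spow h (r (u k))) \<longlonglongrightarrow> g"
      by (simp add: o_def)
    moreover have "(\<lambda>k. spow h (s k) * spow h (r (u k))) \<longlonglongrightarrow> f * g"
      using sf ru by (rule tendsto_mult)
    ultimately show ?thesis using LIMSEQ_unique by blast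
  qed
  moreover have "f * f = f" using fg by (simp add: f_def mult.assoc[symmetric])
  moreover have "star f = f"
    using tendsto_star[OF sf] star_spow[OF h(1)] sf LIMSEQ_unique by fastforce
  ultimately show ?thesis
    using that[of f s] g0 sf unfolding projection_def by (metis mult_zero_left)
qed

text \<open>The previous lemma for the normalised \<open>h = w\<^sup>* w\<close>. The limit is kept in the conclusion because
  closed conditions on the powers of \<open>h\<close>, such as membership in an ideal, pass to \<open>f\<close>.\<close>

lemma projection_from_square:
  assumes B: "cstar_subalgebra B" "finite_dimensional B" and w: "star w * w \<in> B" "w \<noteq> 0"
  obtains f s h where "projection f" "f \<noteq> 0" "f \<in> B"
    "h = of_real (1 / (norm w)\<^sup>2) *\<^sub>C (star w * w)"
    "\<And>k. k \<le> s k" "(\<lambda>k. spow h (s k)) \<longlonglongrightarrow> f"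
proof -
  define h where "h = of_real (1 / (norm w)\<^sup>2) *\<^sub>C (star w * w)"
  have "star h = h" by (simp add: h_def star_scaleC star_mult star_star)
  moreover have "norm h = 1"
    using w(2) by (simp add: h_def norm_scaleC cstar_identity norm_divide norm_power)
  moreover have hB: "spow h n \<in> B" for n
    using cstar_subalgebraD[OF B(1)] w(1) by (induction n) (simp_all add: h_def)
  ultimately obtain f s where f: "projection f" "f \<noteq> 0" "\<And>k. k \<le> s k"
      "(\<lambda>k. spow h (s k)) \<longlonglongrightarrow> f"
    using projection_limit_of_powers[OF B(2), of h] by blast
  moreover have "f \<in> B"
    using closed_sequentially[OF cstar_subalgebraD(2)[OF B(1)] hB f(4)] .
  ultimately show ?thesis using that[of f h s] by (simp add: h_def)
qed

lemma spow_annihilate: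
  assumes lim: "(\<lambda>k. spow h (s k)) \<longlonglongrightarrow> f"
  shows "h * y = 0 \<Longrightarrow> f * y = 0" "y * h = 0 \<Longrightarrow> y * (f :: 'a::cstar_algebra) = 0"
proof -
  assume "h * y = 0"
  then have "spow h n * y = 0" for n by (induction n) (simp_all add: mult.assoc)
  then have "(\<lambda>k. 0) \<longlonglongrightarrow> f * y" using tendsto_mult_right[OF lim, of y] by simp
  then show "f * y = 0" by (simp add: LIMSEQ_const_iff)
next
  assume "y * h = 0"
  then have "y * spow h n = 0" for n by (induction n) (simp_all add: mult.assoc[symmetric])
  then have "(\<lambda>k. 0) \<longlonglongrightarrow> y * f" using tendsto_mult_left[OF lim, of y] by simp
  then show "y * f = 0" by (simp add: LIMSEQ_const_iff)
qed


section \<open>Ideals of an AF algebra are determined by their finite-dimensional parts\<close>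

text \<open>A projection \<open>p\<close> in \<open>B \<inter> I\<close> with a smallest left annihilator does it: if \<open>x p \<noteq> x\<close>, then
  a spectral projection of \<open>w\<^sup>* w\<close>, where \<open>w = x - x p\<close>, is orthogonal to \<open>p\<close>, and its sum
  with \<open>p\<close> has a smaller annihilator.\<close>

lemma ideal_right_unit:
  assumes B: "cstar_subalgebra B" "finite_dimensional B" and I: "I \<in> closed_ideals"
  obtains p where "projection p" "p \<in> B \<inter> I" "\<And>x. x \<in> B \<inter> I \<Longrightarrow> x * p = x"
proof -
  note b = cstar_subalgebraD[OF B(1)] and i = closed_idealsD[OF I]
  define Z where "Z p = {x \<in> B \<inter> I. x * p = 0}" for p
  have Z: "complex_vs.subspace (Z p)" for p
    using b i by (intro complex_vs.subspaceI) (auto simp: Z_def distrib_right mult_scaleC_left)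
  have "projection 0 \<and> 0 \<in> B \<inter> I" using b i by (simp add: projection_def)
  then obtain p where p: "projection p" "p \<in> B \<inter> I"
    and least: "\<And>f. projection f \<Longrightarrow> f \<in> B \<inter> I \<Longrightarrow> complex_vs.dim (Z p) \<le> complex_vs.dim (Z f)"
    using ex_has_least_nat[of "\<lambda>p. projection p \<and> p \<in> B \<inter> I" 0 "\<lambda>p. complex_vs.dim (Z p)"]
    by blast
  have pp: "p * p = p" "star p = p" using p by (simp_all add: projection_def)
  have "x * p = x" if x: "x \<in> B \<inter> I" for x
  proof (rule ccontr)
    assume "x * p \<noteq> x"
    define w where "w = x - x * p"
    have "w \<noteq> 0" "w \<in> I" "star w * w \<in> B"
      using \<open>x * p \<noteq> x\<close> x p b i by (simp_all add: w_def)
    then obtain f s h where f: "projection f" "f \<noteq> 0" "f \<in> B"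
      and h: "h = of_real (1 / (norm w)\<^sup>2) *\<^sub>C (star w * w)"
      and lim: "(\<lambda>k. spow h (s k)) \<longlonglongrightarrow> f"
      using projection_from_square[OF B, of w] by metis
    have "spow h n \<in> I" for n
      using i(5,6) \<open>w \<in> I\<close> by (induction n) (simp_all add: h)
    then have fI: "f \<in> I" using closed_sequentially[OF i(2) _ lim] by blast
    have "w * p = 0" by (simp add: w_def algebra_simps pp)
    then have "h * p = 0" by (simp add: h mult_scaleC_left mult.assoc)
    then have fp: "f * p = 0" using spow_annihilate(1)[OF lim] by blast
    have ff: "f * f = f" "star f = f" using f by (simp_all add: projection_def)
    have pf: "p * f = 0" using arg_cong[OF fp, of star] by (simp add: star_mult pp ff)
    have "projection (p + f)"
      by (simp add: projection_def algebra_simps star_add pp ff fp pf)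
    moreover have "p + f \<in> B \<inter> I" using p f fI b i by simp
    moreover have "Z (p + f) \<subset> Z p"
    proof
      show "Z (p + f) \<subseteq> Z p"
      proof
        fix y assume y: "y \<in> Z (p + f)"
        then have "y * (p + f) * p = 0" by (simp add: Z_def)
        then have "y * p = 0" by (simp add: mult.assoc distrib_right pp fp)
        then show "y \<in> Z p" using y by (simp add: Z_def)
      qed
      have "f \<in> Z p" "f \<notin> Z (p + f)" using f fI fp by (simp_all add: Z_def distrib_left ff)
      then show "Z (p + f) \<noteq> Z p" by blast
    qed
    then have "complex_vs.dim (Z (p + f)) < complex_vs.dim (Z p)"
      using dim_psubset[OF B(2) Z] by (simp add: Z_def)
    ultimately show False using least[of "p + f"] by simp
  qed
  then show ?thesis using that p by blast
qed

text \<open>The point \<open>y p\<close> of \<open>B \<inter> I\<close> realises the distance of \<open>y\<close> from \<open>I\<close>; in other words, the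
  injection of \<open>B / (B \<inter> I)\<close> into the quotient by \<open>I\<close> is isometric. Otherwise \<open>h\<close>, the normalised
  \<open>w\<^sup>* w\<close> for \<open>w = y - y p\<close>, is congruent to some \<open>d\<close> with \<open>\<parallel>d\<parallel> < 1\<close>; the powers of \<open>d\<close>
  vanish in the limit, and so a spectral projection \<open>f\<close> of \<open>h\<close> is in \<open>I\<close>. This gives \<open>f p = f\<close>,
  although \<open>h p = 0\<close>.\<close>

lemma dist_ideal_right_unit:
  assumes B: "cstar_subalgebra B" "finite_dimensional B" and I: "I \<in> closed_ideals"
    and p: "projection p" "p \<in> B \<inter> I" "\<And>x. x \<in> B \<inter> I \<Longrightarrow> x * p = x"
    and y: "y \<in> B" and x: "x \<in> I"
  shows "norm (y - y * p) \<le> norm (y - x)"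
proof (rule ccontr)
  note b = cstar_subalgebraD[OF B(1)] and i = closed_idealsD[OF I]
  assume "\<not> norm (y - y * p) \<le> norm (y - x)"
  define w where "w = y - y * p"
  have less: "norm (y - x) < norm w" using \<open>\<not> _\<close> by (simp add: w_def)
  then have w0: "w \<noteq> 0" using norm_ge_zero[of "y - x"] by (metis not_less norm_zero)
  have "star w * w \<in> B" using y p b by (simp add: w_def)
  then obtain f s h where f: "projection f" "f \<noteq> 0" "f \<in> B"
    and h: "h = of_real (1 / (norm w)\<^sup>2) *\<^sub>C (star w * w)"
    and s: "\<And>k. k \<le> s k" and lim: "(\<lambda>k. spow h (s k)) \<longlonglongrightarrow> f"
    using projection_from_square[OF B _ w0] by metis
  define d where "d = of_real (1 / (norm w)\<^sup>2) *\<^sub>C (star w * (y - x))"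
  have d1: "norm d < 1"
  proof -
    have "norm (star w * (y - x)) \<le> norm w * norm (y - x)"
      using norm_mult_ineq[of "star w" "y - x"] by (simp add: norm_star)
    also have "\<dots> < (norm w)\<^sup>2" using less w0 by (simp add: power2_eq_square)
    finally show ?thesis using w0 by (simp add: d_def norm_scaleC norm_divide norm_power)
  qed
  have hd: "h - d \<in> I"
  proof -
    have "h - d = of_real (1 / (norm w)\<^sup>2) *\<^sub>C (star w * (x - y * p))"
      by (simp add: h d_def w_def algebra_simps flip: complex_vs.scale_right_diff_distrib)
    moreover have "x - y * p \<in> I" using x p i(4,6) by simp
    ultimately show ?thesis using i by simp
  qed
  have mem: "spow h n - spow d n \<in> I" for n
  proof (induction n)
    case (Suc n)
    have "spow h (Suc n) - spow d (Suc n) = (h - d) * spow h n + d * (spow h n - spow d n)"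
      by (simp add: algebra_simps)
    then show ?case using Suc hd i by simp
  qed (simp add: hd)
  have "(\<lambda>n. norm d ^ Suc n) \<longlonglongrightarrow> 0"
    using d1 LIMSEQ_power_zero[of "norm d"] by (subst filterlim_sequentially_Suc) simp
  then have "(\<lambda>n. spow d n) \<longlonglongrightarrow> 0"
    by (rule Lim_null_comparison[rotated]) (simp add: norm_spow_le del: power_Suc)
  moreover have "filterlim s at_top sequentially"
    using s by (intro filterlim_at_top_mono[OF filterlim_ident]) auto
  ultimately have "(\<lambda>k. spow d (s k)) \<longlonglongrightarrow> 0" by (rule filterlim_compose)
  from tendsto_diff[OF lim this] have "(\<lambda>k. spow h (s k) - spow d (s k)) \<longlonglongrightarrow> f" by simp
  then have "f \<in> I" by (rule closed_sequentially[OF i(2) mem])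
  then have "f * p = f" using f p by blast
  moreover have "w * p = 0" using p(1) by (simp add: w_def algebra_simps projection_def)
  then have "h * p = 0" by (simp add: h mult_scaleC_left mult.assoc)
  then have "f * p = 0" using spow_annihilate(1)[OF lim] by blast
  ultimately show False using f by simp
qed

lemma AF_sequenceD:
  assumes "AF_sequence \<U>"
  shows "cstar_subalgebra (\<U> n)" "finite_dimensional (\<U> n)" "m \<le> n \<Longrightarrow> \<U> m \<subseteq> \<U> n"
    "\<epsilon> > 0 \<Longrightarrow> \<exists>n. \<exists>y\<in>\<U> n. norm (a - y) < \<epsilon>"
proof -
  show "cstar_subalgebra (\<U> n)" "finite_dimensional (\<U> n)" "m \<le> n \<Longrightarrow> \<U> m \<subseteq> \<U> n"
    using assms lift_Suc_mono_le[of \<U> m n] by (auto simp: AF_sequence_def)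
  assume "\<epsilon> > 0"
  moreover have "a \<in> closure (\<Union>n. \<U> n)" using assms by (simp add: AF_sequence_def)
  ultimately show "\<exists>n. \<exists>y\<in>\<U> n. norm (a - y) < \<epsilon>"
    unfolding closure_approachable by (force simp: dist_norm norm_minus_commute)
qed

lemma AF_sequence_shift:
  assumes U: "AF_sequence \<U>"
  shows "AF_sequence (\<lambda>n. \<U> (m + n))"
  unfolding AF_sequence_def
proof (intro conjI allI)
  show "cstar_subalgebra (\<U> (m + n))" "finite_dimensional (\<U> (m + n))"
    "\<U> (m + n) \<subseteq> \<U> (m + Suc n)" for n
    using AF_sequenceD[OF U] by simp_all
  have "\<U> n \<subseteq> \<U> (m + n)" for n by (rule AF_sequenceD(3)[OF U]) simp
  then have "closure (\<Union>n. \<U> n) \<subseteq> closure (\<Union>n. \<U> (m + n))" by (intro closure_mono UN_mono) auto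
  then show "closure (\<Union>n. \<U> (m + n)) = UNIV" using U by (auto simp: AF_sequence_def)
qed

text \<open>An approximation \<open>y\<close> of \<open>a\<close> in a stage can be replaced with \<open>y p\<close>, at most doubling the
  error, where \<open>p\<close> is the right unit of the part of the ideal in that stage.\<close>

lemma closed_ideal_approx:
  assumes U: "AF_sequence \<U>" and I: "I \<in> closed_ideals" and a: "a \<in> I" and eps: "\<epsilon> > 0"
  shows "\<exists>n. \<exists>b\<in>I \<inter> \<U> n. norm (a - b) < \<epsilon>"
proof -
  obtain n y where y: "y \<in> \<U> n" "norm (a - y) < \<epsilon> / 2"
    using AF_sequenceD(4)[OF U, of "\<epsilon> / 2" a] eps by auto
  note B = AF_sequenceD(1,2)[OF U, of n]
  obtain p where p: "projection p" "p \<in> \<U> n \<inter> I" "\<And>x. x \<in> \<U> n \<inter> I \<Longrightarrow> x * p = x"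
    using ideal_right_unit[OF B I] by blast
  have "norm (a - y * p) \<le> norm (a - y) + norm (y - y * p)"
    using norm_triangle_ineq[of "a - y" "y - y * p"] by simp
  also have "\<dots> \<le> norm (a - y) + norm (y - a)"
    using dist_ideal_right_unit[OF B I p y(1) a] by simp
  finally have "norm (a - y * p) < \<epsilon>" using y by (simp add: norm_minus_commute)
  moreover have "y * p \<in> I \<inter> \<U> n"
    using y p closed_idealsD[OF I] cstar_subalgebraD[OF B(1)] by simp
  ultimately show ?thesis by blast
qed

lemma closed_ideal_subsetI:
  assumes U: "AF_sequence \<U>" and I: "I \<in> closed_ideals" and J: "J \<in> closed_ideals"
    and sub: "\<And>n. I \<inter> \<U> n \<subseteq> J"
  shows "I \<subseteq> J"
proof
  fix a assume "a \<in> I"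
  have "a \<in> closure J"
    unfolding closure_approachable
    using closed_ideal_approx[OF U I \<open>a \<in> I\<close>] sub
    by (metis dist_norm norm_minus_commute subsetD)
  then show "a \<in> J" using closed_idealsD(2)[OF J] by simp
qed


section \<open>Minimal projections\<close>

text \<open>Evaluation of a polynomial at the operator of left multiplication by \<open>x\<close>, applied to \<open>e\<close>.\<close>

definition poly_orbit :: "'a::cstar_algebra \<Rightarrow> 'a \<Rightarrow> complex poly \<Rightarrow> 'a" where
  "poly_orbit x e p = fold_coeffs (\<lambda>a v. a *\<^sub>C e + x * v) p 0"

lemma poly_orbit_0 [simp]: "poly_orbit x e 0 = 0"
  by (simp add: poly_orbit_def)

lemma poly_orbit_pCons [simp]: "poly_orbit x e (pCons a p) = a *\<^sub>C e + x * poly_orbit x e p"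
  by (cases "p = 0 \<and> a = 0") (auto simp: poly_orbit_def)

lemma poly_orbit_add: "poly_orbit x e (p + q) = poly_orbit x e p + poly_orbit x e q"
  by (induction p q rule: poly_induct2) (simp_all add: algebra_simps scaleC_add_left)

lemma poly_orbit_smult: "poly_orbit x e (smult c p) = c *\<^sub>C poly_orbit x e p"
  by (induction p) (simp_all add: scaleC_add_right scaleC_scaleC mult_scaleC_right)

lemma poly_orbit_sum: "poly_orbit x e (sum f A) = (\<Sum>i\<in>A. poly_orbit x e (f i))"
  by (induction A rule: infinite_finite_induct) (simp_all add: poly_orbit_add)

lemma poly_orbit_monom: "poly_orbit x e (monom c i) = c *\<^sub>C (((*) x ^^ i) e)"
  by (induction i) (simp_all add: monom_0 monom_Suc mult_scaleC_right)

text \<open>An annihilating polynomial of least degree exists because the orbit of \<open>e\<close> is linearly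
  dependent; splitting off a root leaves an eigenvector.\<close>

lemma left_mult_eigenvector:
  assumes fd: "finite_dimensional B" and V: "V \<subseteq> B" "\<And>u. u \<in> V \<Longrightarrow> x * u \<in> V"
    and sub: "complex_vs.subspace V" and e: "e \<in> V" "e \<noteq> 0"
  obtains u \<mu> where "u \<in> V" "u \<noteq> 0" "x * u = \<mu> *\<^sub>C u"
proof -
  let ?ev = "poly_orbit x e" and ?v = "\<lambda>i. ((*) x ^^ i) e"
  have inV: "?ev p \<in> V" for p
    using V(2) e complex_vs.subspace_0[OF sub] complex_vs.subspace_add[OF sub]
      complex_vs.subspace_scale[OF sub]
    by (induction p) simp_all
  have "\<exists>q. q \<noteq> 0 \<and> ?ev q = 0"
  proof (cases "inj ?v")
    case False
    then obtain i j where ij: "?v i = ?v j" "i \<noteq> j" unfolding inj_def by blast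
    have "coeff (monom 1 i + monom (-1) j) i = (1 :: complex)" using ij by simp
    then have "monom 1 i + monom (-1) j \<noteq> (0 :: complex poly)" by fastforce
    moreover have "?ev (monom 1 i + monom (-1) j) = 0"
      using ij complex_vs.scale_left_distrib[of 1 "-1" "?v j"]
      by (simp add: poly_orbit_add poly_orbit_monom)
    ultimately show ?thesis by blast
  next
    case True
    obtain S where S: "finite S" "B = complex_vs.span S"
      using fd unfolding finite_dimensional_def by blast
    have "?v i \<in> B" for i using inV[of "monom 1 i"] V(1) by (auto simp: poly_orbit_monom)
    then have "range ?v \<subseteq> complex_vs.span S" using S by blast
    moreover have "infinite (range ?v)" using True by (simp add: range_inj_infinite)
    ultimately have "complex_vs.dependent (range ?v)"
      using complex_vs.independent_span_bound[OF S(1)] by blast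
    then obtain t c v where t: "finite t" "t \<subseteq> range ?v" "(\<Sum>v\<in>t. c v *\<^sub>C v) = 0"
        "v \<in> t" "c v \<noteq> 0"
      unfolding complex_vs.dependent_explicit by blast
    define n where "n = inv ?v"
    have n: "?v (n y) = y" if "y \<in> t" for y
      unfolding n_def using t(2) that by (intro f_inv_into_f[of y ?v UNIV]) auto
    define q where "q = (\<Sum>y\<in>t. monom (c y) (n y))"
    have "?ev q = 0"
      using t(3) n by (simp add: q_def poly_orbit_sum poly_orbit_monom cong: sum.cong)
    moreover have "coeff q (n v) = (\<Sum>y\<in>t. if y = v then c y else 0)"
      unfolding q_def coeff_sum
      by (rule sum.cong) (use n t(4) in \<open>auto simp: coeff_monom\<close>, metis n)
    then have "coeff q (n v) = c v" using t by simp
    then have "q \<noteq> 0" using t(5) by auto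
    ultimately show ?thesis by blast
  qed
  then obtain q where q: "q \<noteq> 0" "?ev q = 0"
    and least: "\<And>r. r \<noteq> 0 \<Longrightarrow> ?ev r = 0 \<Longrightarrow> degree q \<le> degree r"
    using ex_has_least_nat[of "\<lambda>q. q \<noteq> 0 \<and> ?ev q = 0" _ degree] by blast
  have "degree q \<noteq> 0"
  proof
    assume "degree q = 0"
    then obtain c where "q = [:c:]" by (rule degree_eq_zeroE)
    then show False using q e by simp
  qed
  then obtain \<mu> where "poly q \<mu> = 0"
    using fundamental_theorem_of_algebra constant_degree by metis
  then obtain r where r: "q = [:- \<mu>, 1:] * r" by (metis poly_eq_0_iff_dvd dvdE)
  then have r0: "r \<noteq> 0" using q by auto
  have "degree q = Suc (degree r)" unfolding r using r0 by (subst degree_mult_eq) auto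
  then have "?ev r \<noteq> 0" using least[OF r0] by auto
  moreover have "?ev q = x * ?ev r - \<mu> *\<^sub>C ?ev r"
    by (simp add: r poly_orbit_add poly_orbit_smult mult_pCons_left flip: smult_minus_left)
  then have "x * ?ev r = \<mu> *\<^sub>C ?ev r" using q by simp
  ultimately show ?thesis using that inV by blast
qed

text \<open>Take \<open>e\<close> with the corner \<open>e B e\<close> as small as possible. An eigenvector \<open>u\<close> of left
  multiplication by \<open>y = e x e\<close>, with eigenvalue \<open>\<mu>\<close>, yields a spectral projection \<open>f \<le> e\<close>
  of \<open>u u\<^sup>*\<close> with \<open>(y - \<mu> e) f = 0\<close>. As one of \<open>f\<close> and \<open>e - f\<close> is outside the ideal,
  minimality forces \<open>f = e\<close>, hence \<open>y = \<mu> e\<close>.\<close>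

lemma minimal_projection_below:
  assumes B: "cstar_subalgebra B" "finite_dimensional B" and I: "I \<in> closed_ideals"
    and q: "projection q" "q \<in> B" "q \<notin> I"
  obtains e where "projection e" "e \<in> B" "e \<notin> I" "q * e = e" "e * q = e"
    "\<And>x. x \<in> B \<Longrightarrow> \<exists>c. e * x * e = c *\<^sub>C e"
proof -
  note b = cstar_subalgebraD[OF B(1)] and i = closed_idealsD[OF I]
  define C where "C e = {x \<in> B. e * x = x \<and> x * e = x}" for e
  have C: "complex_vs.subspace (C e)" for e
    using b by (intro complex_vs.subspaceI)
      (auto simp: C_def distrib_right distrib_left mult_scaleC_left mult_scaleC_right)
  define P where "P e \<longleftrightarrow> projection e \<and> e \<in> B \<and> e \<notin> I \<and> q * e = e \<and> e * q = e" for e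
  have "P q" using q by (simp add: P_def projection_def)
  then obtain e where e: "P e"
    and least: "\<And>f. P f \<Longrightarrow> complex_vs.dim (C e) \<le> complex_vs.dim (C f)"
    using ex_has_least_nat[of P q "\<lambda>e. complex_vs.dim (C e)"] by blast
  have ee: "e * e = e" "star e = e" "e \<in> B" using e by (simp_all add: P_def projection_def)
  have eeC: "e * (e * z) = e * z" for z by (simp add: ee flip: mult.assoc)
  have smaller: False if f: "projection f" "f \<in> C e" "f \<noteq> e" "f \<notin> I" for f
  proof -
    have f': "f \<in> B" "e * f = f" "f * e = f" "f * f = f"
      using f by (simp_all add: C_def projection_def)
    have "q * f = f" "f * q = f"
      using e f' by (metis P_def mult.assoc)+
    then have "P f" using f f' by (simp add: P_def)
    moreover have "C f \<subset> C e"
    proof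
      show "C f \<subseteq> C e"
        using f' by (auto simp: C_def) (metis mult.assoc)+
      have "e \<in> C e" "e \<notin> C f" using ee f' f by (auto simp: C_def)
      then show "C f \<noteq> C e" by blast
    qed
    then have "complex_vs.dim (C f) < complex_vs.dim (C e)"
      using dim_psubset[OF B(2) C] by (simp add: C_def)
    ultimately show False using least[of f] by simp
  qed
  have "\<exists>c. e * x * e = c *\<^sub>C e" if x: "x \<in> B" for x
  proof -
    define y where "y = e * x * e"
    have yC: "y \<in> C e" using x ee b by (simp add: y_def C_def mult.assoc eeC)
    have "e \<noteq> 0" using e i by (auto simp: P_def)
    moreover have "y * u \<in> C e" if "u \<in> C e" for u
      using that yC b by (auto simp: C_def mult.assoc) (metis mult.assoc)
    moreover have "e \<in> C e" "C e \<subseteq> B" using ee by (auto simp: C_def)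
    ultimately obtain u \<mu> where u: "u \<in> C e" "u \<noteq> 0" "y * u = \<mu> *\<^sub>C u"
      using left_mult_eigenvector[OF B(2) _ _ C] by metis
    have uB: "u \<in> B" "e * u = u" using u by (simp_all add: C_def)
    have ue: "star u * e = star u" using arg_cong[OF uB(2), of star] by (simp add: star_mult ee)
    have "star (star u) * star u \<in> B" "star u \<noteq> 0"
      using uB u(2) b norm_star[of u] by (auto simp: star_star)
    then obtain f s h where f: "projection f" "f \<noteq> 0" "f \<in> B"
      and h: "h = of_real (1 / (norm (star u))\<^sup>2) *\<^sub>C (star (star u) * star u)"
      and lim: "(\<lambda>k. spow h (s k)) \<longlonglongrightarrow> f"
      using projection_from_square[OF B, of "star u"] by metis
    have ff: "f * f = f" "star f = f" using f by (simp_all add: projection_def)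
    have fC: "f \<in> C e"
    proof -
      have "e * h = h" "h * e = h"
        by (simp_all add: h star_star mult_scaleC_left mult_scaleC_right mult.assoc ue)
          (simp add: uB flip: mult.assoc)
      then have "e * spow h n = spow h n" "spow h n * e = spow h n" for n
        by (induction n) (simp_all add: mult.assoc, metis mult.assoc)
      then have "(\<lambda>k. spow h (s k)) \<longlonglongrightarrow> e * f" "(\<lambda>k. spow h (s k)) \<longlonglongrightarrow> f * e"
        using tendsto_mult_left[OF lim, of e] tendsto_mult_right[OF lim, of e] by simp_all
      then show ?thesis using lim f LIMSEQ_unique by (auto simp: C_def)
    qed
    have "(y - \<mu> *\<^sub>C e) * u = 0" using u uB by (simp add: algebra_simps mult_scaleC_left)
    then have "(y - \<mu> *\<^sub>C e) * h = 0"
      by (simp add: h star_star mult_scaleC_right flip: mult.assoc)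
    then have yf: "(y - \<mu> *\<^sub>C e) * f = 0" using spow_annihilate(2)[OF lim] by blast
    have f': "e * f = f" "f * e = f" using fC by (simp_all add: C_def)
    have "f = e"
    proof (rule ccontr)
      assume "f \<noteq> e"
      then have "f \<in> I" using smaller f fC by blast
      moreover have "projection (e - f)"
        by (simp add: projection_def star_diff algebra_simps ee ff f')
      moreover have "e - f \<in> C e" using ee f f' b by (simp add: C_def algebra_simps)
      moreover have "e - f \<notin> I"
        using \<open>f \<in> I\<close> i(3)[of "e - f" f] e by (auto simp: P_def)
      ultimately show False using smaller[of "e - f"] f by simp
    qed
    then have "y = \<mu> *\<^sub>C e"
      using yf yC ee by (simp add: algebra_simps mult_scaleC_left C_def)
    then show ?thesis unfolding y_def by blast
  qed
  then show ?thesis using that[of e] e by (simp add: P_def)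
qed

text \<open>This replaces the theorem that elements of the form \<open>x\<^sup>* x\<close> are positive.
  If \<open>r\<close> were negative, then \<open>a = \<alpha> e + x e\<close> would satisfy \<open>a\<^sup>* a = 0\<close> for \<open>\<alpha>\<close> chosen as below,
  that is \<open>x e = - \<alpha> e\<close>, which gives \<open>r = |\<alpha>|\<^sup>2\<close>.\<close>

lemma minimal_projection_positive:
  assumes e: "projection e" "e \<noteq> 0" and c: "e * x * e = c *\<^sub>C e"
    and r: "e * (star x * x) * e = r *\<^sub>C e"
  shows "Im r = 0" "Re r \<ge> 0"
proof -
  have ee: "e * e = e" "star e = e" using e by (simp_all add: projection_def)
  have inj: "s = t" if "s *\<^sub>C e = t *\<^sub>C e" for s t
    using that e complex_vs.scale_right_imp_eq by blast
  have "cnj r *\<^sub>C e = r *\<^sub>C e"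
    using arg_cong[OF r, of star] r by (simp add: star_mult star_scaleC star_star ee mult.assoc)
  then have "cnj r = r" by (rule inj)
  then show im: "Im r = 0" by (simp add: complex_eq_iff)
  show "Re r \<ge> 0"
  proof (rule ccontr)
    assume neg: "\<not> Re r \<ge> 0"
    \<comment> \<open>\<open>\<alpha>\<close> solves \<open>|\<alpha> + c|\<^sup>2 = |c|\<^sup>2 - r\<close>, which makes the coefficient of \<open>a\<^sup>* a\<close> vanish\<close>
    define D where "D = sqrt ((cmod c)\<^sup>2 - Re r)"
    have "0 \<le> (cmod c)\<^sup>2 - Re r" using neg zero_le_power2[of "cmod c"] by linarith
    then have D: "D\<^sup>2 = (cmod c)\<^sup>2 - Re r" unfolding D_def by simp
    define \<alpha> where "\<alpha> = of_real D - c"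
    have cc: "e * star x * e = cnj c *\<^sub>C e"
      using arg_cong[OF c, of star] by (simp add: star_mult star_scaleC ee mult.assoc)
    define a where "a = \<alpha> *\<^sub>C e + x * e"
    have "star a * a = (cnj \<alpha> * \<alpha>) *\<^sub>C (e * e) + cnj \<alpha> *\<^sub>C (e * x * e) + \<alpha> *\<^sub>C (e * star x * e)
        + e * (star x * x) * e"
      by (simp add: a_def star_add star_scaleC star_mult ee algebra_simps mult_scaleC_left
          mult_scaleC_right scaleC_add_right scaleC_scaleC)
    also have "\<dots> = (cnj \<alpha> * \<alpha> + cnj \<alpha> * c + \<alpha> * cnj c + r) *\<^sub>C e"
      by (simp only: c cc r ee scaleC_scaleC scaleC_add_left)
    also have "cnj \<alpha> * \<alpha> + cnj \<alpha> * c + \<alpha> * cnj c + r = of_real (D\<^sup>2) - c * cnj c + r"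
      by (simp add: \<alpha>_def algebra_simps power2_eq_square)
    also have "\<dots> = 0"
      unfolding D of_real_diff complex_norm_square using im by (simp add: complex_eq_iff)
    finally have "star a * a = 0" by simp
    then have "a = 0" using cstar_identity[of a] by simp
    then have xe: "x * e = (- \<alpha>) *\<^sub>C e"
      by (simp add: a_def eq_neg_iff_add_eq_0 add.commute)
    have "r *\<^sub>C e = star (x * e) * (x * e)"
      using r by (simp add: star_mult ee mult.assoc)
    also have "\<dots> = (cnj \<alpha> * \<alpha>) *\<^sub>C e"
      by (simp add: xe star_minus star_scaleC ee mult_scaleC_left mult_scaleC_right scaleC_scaleC)
    finally have "r = cnj \<alpha> * \<alpha>" by (rule inj)
    then have "Re r = (Re \<alpha>)\<^sup>2 + (Im \<alpha>)\<^sup>2" by (simp add: power2_eq_square)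
    then show False using neg by simp
  qed
qed

section \<open>The pure state of a decreasing sequence of minimal projections\<close>

text \<open>A decreasing sequence of projections, each minimal in its stage of the AF algebra, determines
  a pure state: the compressions \<open>e n a e n\<close> are asymptotically scalar multiples of \<open>e n\<close>, and the
  scalar is the value of the state at \<open>a\<close>. Purity is then a direct computation, without
  compactness or extreme points.\<close>

locale minimal_projections =
  fixes \<U> :: "nat \<Rightarrow> 'a::cstar_algebra set" and e :: "nat \<Rightarrow> 'a"
  assumes AF: "AF_sequence \<U>"
    and proj: "projection (e n)"
    and nonzero: "e n \<noteq> 0"
    and decreasing: "e n * e (Suc n) = e (Suc n)" "e (Suc n) * e n = e (Suc n)"
    and minimal: "x \<in> \<U> n \<Longrightarrow> \<exists>c. e n * x * e n = c *\<^sub>C e n"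

lemma minimal_projections_exist:
  assumes U: "AF_sequence \<U>" and I: "I \<in> closed_ideals"
    and q: "projection q" "q \<in> \<U> 0" "q \<notin> I"
  obtains e where "minimal_projections \<U> e" "\<And>n. e n \<notin> I" "\<And>n. q * e n = e n"
proof -
  define P where "P n e \<longleftrightarrow> projection e \<and> e \<in> \<U> n \<and> e \<notin> I \<and> q * e = e \<and>
    (\<forall>x\<in>\<U> n. \<exists>c. e * x * e = c *\<^sub>C e)" for n e
  have "\<exists>e. P 0 e"
    using minimal_projection_below[OF AF_sequenceD(1,2)[OF U] I q] unfolding P_def by metis
  moreover have "\<exists>e'. P (Suc n) e' \<and> (e * e' = e' \<and> e' * e = e')" if e: "P n e" for n e
  proof -
    have "e \<in> \<U> (Suc n)" using e AF_sequenceD(3)[OF U, of n "Suc n"] by (auto simp: P_def)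
    then obtain e' where "projection e'" "e' \<in> \<U> (Suc n)" "e' \<notin> I" "e * e' = e'" "e' * e = e'"
      "\<forall>x\<in>\<U> (Suc n). \<exists>c. e' * x * e' = c *\<^sub>C e'"
      using minimal_projection_below[OF AF_sequenceD(1,2)[OF U] I, of e "Suc n"] e
      unfolding P_def by metis
    moreover from this have "q * e' = e'" using e by (metis P_def mult.assoc)
    ultimately show ?thesis unfolding P_def by blast
  qed
  ultimately obtain e where e: "\<And>n. P n (e n)"
    "\<And>n. e n * e (Suc n) = e (Suc n) \<and> e (Suc n) * e n = e (Suc n)"
    using dependent_nat_choice[of P "\<lambda>n e e'. e * e' = e' \<and> e' * e = e'"] by metis
  have "e n \<noteq> 0" for n using e(1)[of n] closed_idealsD(1)[OF I] by (auto simp: P_def)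
  then have "minimal_projections \<U> e"
    using U e unfolding minimal_projections_def P_def by blast
  then show ?thesis using that e by (simp add: P_def)
qed

context minimal_projections
begin

lemma ee: "e n * e n = e n" and star_e: "star (e n) = e n"
  using proj[of n] by (simp_all add: projection_def)

lemma norm_e: "norm (e n) = 1"
  using projection_norm(1)[OF proj[of n]] nonzero[of n] by simp

lemma e_below: "m \<le> n \<Longrightarrow> e m * e n = e n" "m \<le> n \<Longrightarrow> e n * e m = e n"
proof -
  have "e m * e n = e n \<and> e n * e m = e n" if "m \<le> n"
    using that
  proof (induction n rule: dec_induct)
    case (step n)
    have "e m * e (Suc n) = (e m * e n) * e (Suc n)"
      by (simp add: decreasing mult.assoc)
    moreover have "e (Suc n) * e m = e (Suc n) * (e n * e m)"
      by (simp add: decreasing flip: mult.assoc)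
    ultimately show ?case using step by (simp add: decreasing)
  qed (simp add: ee)
  then show "m \<le> n \<Longrightarrow> e m * e n = e n" "m \<le> n \<Longrightarrow> e n * e m = e n" by auto
qed

lemma compress_le: "norm (e n * x * e n) \<le> norm x"
  by (rule norm_compress_le) (simp_all add: norm_e)

lemma compression_in_stage:
  assumes "e m * x * e m = c *\<^sub>C e m" and mn: "m \<le> n"
  shows "e n * x * e n = c *\<^sub>C e n"
proof -
  have "e n * x * e n = e n * (e m * x * e m) * e n"
    using e_below[OF mn] by (metis mult.assoc)
  then show ?thesis
    by (simp add: assms mult_scaleC_left mult_scaleC_right e_below[OF mn] ee)
qed

definition state :: "'a \<Rightarrow> complex" where
  "state a = (THE c. (\<lambda>n. e n * a * e n - c *\<^sub>C e n) \<longlonglongrightarrow> 0)"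

lemma compression_limit_unique:
  assumes "(\<lambda>n. e n * a * e n - c *\<^sub>C e n) \<longlonglongrightarrow> 0" "(\<lambda>n. e n * a * e n - d *\<^sub>C e n) \<longlonglongrightarrow> 0"
  shows "c = d"
proof -
  have "(\<lambda>n. (e n * a * e n - d *\<^sub>C e n) - (e n * a * e n - c *\<^sub>C e n)) \<longlonglongrightarrow> 0 - 0"
    by (rule tendsto_diff[OF assms(2,1)])
  then have "(\<lambda>n. (c - d) *\<^sub>C e n) \<longlonglongrightarrow> 0"
    by (simp add: complex_vs.scale_left_diff_distrib)
  from tendsto_norm[OF this] show ?thesis
    by (simp add: norm_scaleC norm_e LIMSEQ_const_iff)
qed

text \<open>On the dense union of the stages the compressions are eventually scalar. In general the
  scalars of an approximating sequence form a Cauchy sequence, because compression is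
  contractive.\<close>

lemma compression_limit_exists: "\<exists>c. (\<lambda>n. e n * a * e n - c *\<^sub>C e n) \<longlonglongrightarrow> 0"
proof -
  have "\<exists>x c N. norm (a - x) < (1/2) ^ k \<and> (\<forall>n\<ge>N. e n * x * e n = c *\<^sub>C e n)" for k :: nat
  proof -
    obtain m x where x: "x \<in> \<U> m" "norm (a - x) < (1/2) ^ k"
      using AF_sequenceD(4)[OF AF, of "(1/2) ^ k" a] by auto
    then obtain c where "e m * x * e m = c *\<^sub>C e m" using minimal by blast
    then show ?thesis using x compression_in_stage by blast
  qed
  then obtain x c N where x: "\<And>k::nat. norm (a - x k) < (1/2) ^ k"
    "\<And>k n. n \<ge> N k \<Longrightarrow> e n * x k * e n = c k *\<^sub>C e n" by metis
  have cd: "cmod (c j - c k) \<le> (1/2) ^ j + (1/2) ^ k" for j k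
  proof -
    let ?n = "max (N j) (N k)"
    have "cmod (c j - c k) = norm ((c j - c k) *\<^sub>C e ?n)" by (simp add: norm_scaleC norm_e)
    also have "(c j - c k) *\<^sub>C e ?n = e ?n * (x j - x k) * e ?n"
      by (simp add: left_diff_distrib right_diff_distrib x(2) complex_vs.scale_left_diff_distrib)
    also have "norm \<dots> \<le> norm (x j - x k)" by (rule compress_le)
    also have "\<dots> \<le> norm (a - x j) + norm (a - x k)"
      using norm_triangle_ineq4[of "a - x k" "a - x j"] by simp
    also have "\<dots> \<le> (1/2) ^ j + (1/2) ^ k" using x(1) by (intro add_mono less_imp_le)
    finally show ?thesis .
  qed
  have half: "(\<lambda>k. (1/2) ^ k :: real) \<longlonglongrightarrow> 0" by (rule LIMSEQ_power_zero) simp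
  have "Cauchy c"
  proof (rule metric_CauchyI)
    fix \<epsilon> :: real assume "\<epsilon> > 0"
    then have "\<forall>\<^sub>F k in sequentially. (1/2) ^ k < \<epsilon> / 2"
      by (intro order_tendstoD(2)[OF half]) simp
    then obtain M where M: "\<And>k. k \<ge> M \<Longrightarrow> (1/2) ^ k < \<epsilon> / 2"
      unfolding eventually_sequentially by blast
    have "dist (c j) (c k) < \<epsilon>" if "j \<ge> M" "k \<ge> M" for j k
      using cd[of j k] M[OF that(1)] M[OF that(2)] by (simp add: dist_norm)
    then show "\<exists>M. \<forall>m\<ge>M. \<forall>n\<ge>M. dist (c m) (c n) < \<epsilon>" by blast
  qed
  then obtain l where l: "c \<longlonglongrightarrow> l" using convergent_eq_Cauchy by blast
  have "(\<lambda>n. e n * a * e n - l *\<^sub>C e n) \<longlonglongrightarrow> 0"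
  proof (rule LIMSEQ_I)
    fix \<epsilon> :: real assume eps: "\<epsilon> > 0"
    have "\<forall>\<^sub>F k in sequentially. (1/2) ^ k < \<epsilon> / 2"
      using eps by (intro order_tendstoD(2)[OF half]) simp
    moreover have "\<forall>\<^sub>F k in sequentially. dist (c k) l < \<epsilon> / 2"
      using l eps tendstoD half_gt_zero by blast
    ultimately have "\<forall>\<^sub>F k in sequentially. (1/2) ^ k < \<epsilon> / 2 \<and> dist (c k) l < \<epsilon> / 2"
      by (rule eventually_conj)
    then obtain k where k: "(1/2) ^ k < \<epsilon> / 2" "dist (c k) l < \<epsilon> / 2"
      using eventually_happens trivial_limit_sequentially by blast
    have "norm (e n * a * e n - l *\<^sub>C e n - 0) < \<epsilon>" if n: "n \<ge> N k" for n
    proof -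
      have "e n * a * e n - l *\<^sub>C e n = e n * (a - x k) * e n + (c k - l) *\<^sub>C e n"
        by (simp add: left_diff_distrib right_diff_distrib x(2)[OF n]
            complex_vs.scale_left_diff_distrib)
      also have "norm \<dots> \<le> norm (a - x k) + cmod (c k - l)"
        by (intro norm_triangle_mono compress_le) (simp add: norm_scaleC norm_e)
      finally show ?thesis using k x(1)[of k] by (simp add: dist_norm)
    qed
    then show "\<exists>no. \<forall>n\<ge>no. norm (e n * a * e n - l *\<^sub>C e n - 0) < \<epsilon>" by blast
  qed
  then show ?thesis by blast
qed

lemma state_unique: "(\<lambda>n. e n * a * e n - c *\<^sub>C e n) \<longlonglongrightarrow> 0 \<Longrightarrow> state a = c"
  unfolding state_def using compression_limit_unique by (intro the_equality)

lemma state_lim: "(\<lambda>n. e n * a * e n - state a *\<^sub>C e n) \<longlonglongrightarrow> 0"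
  using compression_limit_exists state_unique by metis

lemma state_eventuallyI:
  assumes "\<And>n. n \<ge> m \<Longrightarrow> e n * a * e n = c *\<^sub>C e n"
  shows "state a = c"
proof (rule state_unique, rule tendsto_eventually)
  show "\<forall>\<^sub>F n in sequentially. e n * a * e n - c *\<^sub>C e n = 0"
    unfolding eventually_sequentially using assms by auto
qed

lemma state_cong:
  assumes "\<And>n. n \<ge> m \<Longrightarrow> e n * a * e n = e n * b * e n"
  shows "state a = state b"
proof (rule state_unique)
  have "\<forall>\<^sub>F n in sequentially. e n * b * e n - state b *\<^sub>C e n = e n * a * e n - state b *\<^sub>C e n"
    unfolding eventually_sequentially by (intro exI[of _ m]) (simp add: assms)
  then show "(\<lambda>n. e n * a * e n - state b *\<^sub>C e n) \<longlonglongrightarrow> 0"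
    using state_lim[of b] by (rule Lim_transform_eventually[rotated])
qed

lemma state_in_stage: "x \<in> \<U> m \<Longrightarrow> m \<le> n \<Longrightarrow> e n * x * e n = state x *\<^sub>C e n"
  using minimal compression_in_stage state_eventuallyI by metis

lemma state_add: "state (a + b) = state a + state b"
proof (rule state_unique)
  have "(\<lambda>n. (e n * a * e n - state a *\<^sub>C e n) + (e n * b * e n - state b *\<^sub>C e n)) \<longlonglongrightarrow> 0 + 0"
    by (intro tendsto_add state_lim)
  then show "(\<lambda>n. e n * (a + b) * e n - (state a + state b) *\<^sub>C e n) \<longlonglongrightarrow> 0"
    by (simp add: algebra_simps scaleC_add_left)
qed

lemma state_scaleC: "state (c *\<^sub>C a) = c * state a"
proof (rule state_unique)
  have "(\<lambda>n. c *\<^sub>C (e n * a * e n - state a *\<^sub>C e n)) \<longlonglongrightarrow> c *\<^sub>C 0"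
    by (intro tendsto_scaleC tendsto_const state_lim)
  then show "(\<lambda>n. e n * c *\<^sub>C a * e n - (c * state a) *\<^sub>C e n) \<longlonglongrightarrow> 0"
    by (simp add: complex_vs.scale_right_diff_distrib mult_scaleC_left mult_scaleC_right
        scaleC_scaleC)
qed

lemma state_star: "state (star a) = cnj (state a)"
proof (rule state_unique)
  have "(\<lambda>n. star (e n * a * e n - state a *\<^sub>C e n)) \<longlonglongrightarrow> star 0"
    by (intro tendsto_star state_lim)
  then show "(\<lambda>n. e n * star a * e n - cnj (state a) *\<^sub>C e n) \<longlonglongrightarrow> 0"
    by (simp add: star_diff star_mult star_scaleC star_e mult.assoc)
qed

lemma state_0: "state 0 = 0" and state_diff: "state (a - b) = state a - state b"
proof -
  show "state 0 = 0" using state_add[of 0 0] by simp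
  show "state (a - b) = state a - state b" using state_add[of "a - b" b] by simp
qed

lemma state_norm_lim: "(\<lambda>n. norm (e n * a * e n)) \<longlonglongrightarrow> cmod (state a)"
proof -
  have le: "norm (norm (e n * a * e n) - cmod (state a)) \<le> norm (e n * a * e n - state a *\<^sub>C e n)" for n
    using norm_triangle_ineq3[of "e n * a * e n" "state a *\<^sub>C e n"]
    by (simp add: norm_scaleC norm_e)
  have "(\<lambda>n. norm (e n * a * e n) - cmod (state a)) \<longlonglongrightarrow> 0"
    by (rule Lim_null_comparison[OF always_eventually[OF allI[OF le]]
          tendsto_norm_zero[OF state_lim]])
  then show ?thesis by (simp add: LIM_zero_iff)
qed

lemma state_bound: "cmod (state a) \<le> norm a"
  by (rule LIMSEQ_le_const2[OF state_norm_lim]) (simp add: compress_le)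

lemma bounded_linear_state: "bounded_linear state"
proof (rule bounded_linear_intro[of _ 1])
  show "state (r *\<^sub>R x) = r *\<^sub>R state x" for r x
    by (simp add: scaleR_scaleC state_scaleC scaleR_conv_of_real)
qed (simp_all add: state_add state_bound)

lemma state_mult_e: "state (a * e m) = state a"
  by (rule state_cong[of m]) (simp add: mult.assoc e_below)

lemma state_e: "state (e m) = 1"
  by (rule state_eventuallyI[of m]) (simp add: e_below ee)

lemma state_square: "state (star a * a) = of_real (Re (state (star a * a)))"
  using state_star[of "star a * a"] by (simp add: star_mult star_star complex_eq_iff)

lemma state_positive: "Re (state (star a * a)) \<ge> 0"
proof -
  have *: "Re (state (star x * x)) \<ge> 0" if x: "x \<in> \<U> m" for x m
  proof -
    obtain c where "e m * x * e m = c *\<^sub>C e m" using minimal[OF x] by blast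
    moreover have "star x * x \<in> \<U> m"
      using cstar_subalgebraD(7,8)[OF AF_sequenceD(1)[OF AF]] x by simp
    then have "e m * (star x * x) * e m = state (star x * x) *\<^sub>C e m"
      using state_in_stage by blast
    ultimately show ?thesis using minimal_projection_positive(2)[OF proj nonzero] by blast
  qed
  have "a \<in> closure (\<Union>n. \<U> n)" using AF by (simp add: AF_sequence_def)
  then obtain x where x: "\<And>k. x k \<in> (\<Union>n. \<U> n)" "x \<longlonglongrightarrow> a"
    unfolding closure_sequential by blast
  have lim: "(\<lambda>k. Re (state (star (x k) * x k))) \<longlonglongrightarrow> Re (state (star a * a))"
    by (intro tendsto_Re bounded_linear.tendsto[OF bounded_linear_state] tendsto_mult
        tendsto_star x(2))
  have "Re (state (star (x k) * x k)) \<ge> 0" for k using * x(1)[of k] by blast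
  then show ?thesis by (intro LIMSEQ_le_const[OF lim]) simp
qed

definition state_norm :: "'a \<Rightarrow> real" where
  "state_norm a = sqrt (Re (state (star a * a)))"

text \<open>As \<open>a e n\<close> is congruent to \<open>a\<close> modulo the left kernel of the state, this formula shows that
  the seminorm of the state is the quotient norm modulo the left kernel. Therefore the quotient is
  already complete.\<close>

lemma state_norm_limit: "(\<lambda>n. norm (a * e n)) \<longlonglongrightarrow> state_norm a"
proof -
  have "sqrt (norm (e n * (star a * a) * e n)) = norm (a * e n)" for n
    using cstar_identity[of "a * e n"] by (simp add: star_mult star_e mult.assoc)
  moreover have "cmod (state (star a * a)) = Re (state (star a * a))"
    using state_positive[of a] by (subst state_square) simp
  ultimately show ?thesis
    unfolding state_norm_def
    using tendsto_real_sqrt[OF state_norm_lim[of "star a * a"]] by simp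
qed

lemma state_norm_le: "state_norm a \<le> norm a"
proof (rule LIMSEQ_le_const2[OF state_norm_limit], intro exI allI impI)
  show "norm (a * e n) \<le> norm a" for n using norm_mult_ineq[of a "e n"] by (simp add: norm_e)
qed

lemma state_norm_triangle: "state_norm (a + b) \<le> state_norm a + state_norm b"
proof (rule LIMSEQ_le[OF state_norm_limit tendsto_add[OF state_norm_limit state_norm_limit]],
    intro exI allI impI)
  show "norm ((a + b) * e n) \<le> norm (a * e n) + norm (b * e n)" for n
    by (simp add: distrib_right norm_triangle_ineq)
qed

lemma state_norm_mult: "state_norm (a * b) \<le> norm a * state_norm b"
proof (rule LIMSEQ_le[OF state_norm_limit tendsto_mult_left[OF state_norm_limit]],
    intro exI allI impI)
  show "norm (a * b * e n) \<le> norm a * norm (b * e n)" for n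
    by (metis mult.assoc norm_mult_ineq)
qed

lemma state_norm_zero: "state_norm b = 0 \<Longrightarrow> state (star a * b) = 0"
proof -
  assume "state_norm b = 0"
  then have "state_norm (star a * b) = 0"
    using state_norm_mult[of "star a" b] state_positive[of "star a * b"]
    by (simp add: state_norm_def)
  then have lim: "(\<lambda>n. norm (star a * b * e n)) \<longlonglongrightarrow> 0" using state_norm_limit by metis
  have "cmod (state (star a * b)) \<le> 0"
  proof (rule LIMSEQ_le[OF state_norm_lim lim], intro exI allI impI)
    show "norm (e n * (star a * b) * e n) \<le> norm (star a * b * e n)" for n
      using norm_mult_ineq[of "e n" "star a * b * e n"] by (simp add: norm_e mult.assoc)
  qed
  then show ?thesis by simp
qed

text \<open>Otherwise \<open>e n\<close> would eventually be close to the element \<open>state(a)\<^sup>-\<^sup>1 e n a e n\<close> of the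
  ideal.\<close>

lemma state_vanishes_on_ideal:
  assumes I: "I \<in> closed_ideals" and e: "\<And>n. e n \<notin> I" and a: "a \<in> I"
  shows "state a = 0"
proof (rule ccontr)
  assume s: "state a \<noteq> 0"
  have "(\<lambda>n. norm (e n * a * e n - state a *\<^sub>C e n)) \<longlonglongrightarrow> 0"
    by (intro tendsto_norm_zero state_lim)
  then have "\<forall>\<^sub>F n in sequentially. norm (e n * a * e n - state a *\<^sub>C e n) < cmod (state a)"
    using s by (intro order_tendstoD(2)) auto
  then obtain n where n: "norm (e n * a * e n - state a *\<^sub>C e n) < cmod (state a)"
    using eventually_happens trivial_limit_sequentially by blast
  define z where "z = inverse (state a) *\<^sub>C (e n * a * e n)"
  have "e n - z = inverse (state a) *\<^sub>C (state a *\<^sub>C e n - e n * a * e n)"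
    using s by (simp add: z_def complex_vs.scale_right_diff_distrib scaleC_scaleC)
  then have "norm (e n - z) = norm (e n * a * e n - state a *\<^sub>C e n) / cmod (state a)"
    by (simp add: norm_scaleC norm_inverse norm_minus_commute divide_inverse mult.commute)
  then have "norm (e n - z) < 1" using n s by (simp add: divide_less_eq)
  moreover have "z \<in> I" using a closed_idealsD[OF I] by (simp add: z_def)
  ultimately show False using projection_near_ideal[OF proj I] e by blast
qed


section \<open>The irreducible representation of the state\<close>

text \<open>The class of \<open>b\<close> modulo the left kernel of the state is represented by the functional
  \<open>a \<mapsto> state (a\<^sup>* b)\<close>.\<close>

definition gns_vec :: "'a \<Rightarrow> 'a \<Rightarrow> complex" where
  "gns_vec b = (\<lambda>a. state (star a * b))"

text \<open>The identities \<open>state (c\<^sup>* b) = gns_vec b c\<close> and \<open>gns_vec (a b) c = gns_vec b (a\<^sup>* c)\<close> express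
  the inner product and the action in terms of the functionals. The value of \<open>gns_ip\<close> does not
  depend on the chosen representative, because the state is hermitian.\<close>

definition gns_ip :: "('a \<Rightarrow> complex) \<Rightarrow> ('a \<Rightarrow> complex) \<Rightarrow> complex" where
  "gns_ip f g = f (SOME c. gns_vec c = g)"

definition gns_rep :: "'a \<Rightarrow> ('a \<Rightarrow> complex) \<Rightarrow> 'a \<Rightarrow> complex" where
  "gns_rep a f = (\<lambda>c. f (star a * c))"

lemma gns_vec_add: "gns_vec (b + c) = gns_vec b + gns_vec c"
  and gns_vec_diff: "gns_vec (b - c) = gns_vec b - gns_vec c"
  and gns_vec_scale: "gns_vec (k *\<^sub>C b) = fun_scale k (gns_vec b)"
  and gns_vec_0: "gns_vec 0 = 0"
  by (auto simp: gns_vec_def distrib_left right_diff_distrib state_add state_diff state_0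
      mult_scaleC_right state_scaleC fun_scale_def)

lemma gns_rep_vec: "gns_rep a (gns_vec b) = gns_vec (a * b)"
  by (simp add: gns_rep_def gns_vec_def star_mult star_star mult.assoc)

lemma gns_ip_vec: "gns_ip (gns_vec b) (gns_vec c) = state (star c * b)"
proof -
  define d where "d = (SOME d. gns_vec d = gns_vec c)"
  have d: "gns_vec d = gns_vec c" unfolding d_def by (rule someI[of _ c]) simp
  have swap: "gns_vec x y = cnj (gns_vec y x)" for x y
    by (simp add: gns_vec_def star_mult star_star flip: state_star)
  have "gns_ip (gns_vec b) (gns_vec c) = gns_vec b d" by (simp only: gns_ip_def d_def)
  also have "\<dots> = gns_vec b c" using d by (simp add: swap[of b])
  finally show ?thesis by (simp add: gns_vec_def)
qed

lemma gns_vec_mult_e: "gns_vec (b * e n) = gns_vec b" "gns_vec (e m) = gns_vec (e n)"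
proof -
  show "gns_vec (b * e n) = gns_vec b" by (simp add: gns_vec_def state_mult_e flip: mult.assoc)
  show "gns_vec (e m) = gns_vec (e n)" by (simp add: gns_vec_def state_mult_e)
qed

lemma gns_vec_e_nonzero: "gns_vec (e n) \<noteq> 0"
proof
  assume "gns_vec (e n) = 0"
  then have "gns_vec (e n) (e n) = 0" by simp
  then show False by (simp add: gns_vec_def star_e ee state_e)
qed

lemma gns_inner_product_space: "complex_inner_product_space fun_scale (range gns_vec) gns_ip"
proof -
  interpret F: vector_space "fun_scale :: complex \<Rightarrow> ('a \<Rightarrow> complex) \<Rightarrow> _"
    by (rule vector_space_fun_scale)
  show ?thesis
  proof
    show "F.subspace (range gns_vec)"
      by (rule F.subspaceI) (auto simp flip: gns_vec_add gns_vec_scale gns_vec_0)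
    show "gns_ip (x + y) z = gns_ip x z + gns_ip y z"
      if "x \<in> range gns_vec" "y \<in> range gns_vec" "z \<in> range gns_vec" for x y z
      using that by (auto simp: gns_ip_vec distrib_left state_add simp flip: gns_vec_add)
    show "gns_ip (fun_scale c x) y = c * gns_ip x y" if "x \<in> range gns_vec" "y \<in> range gns_vec" for c x y
      using that by (auto simp: gns_ip_vec mult_scaleC_right state_scaleC simp flip: gns_vec_scale)
    show "gns_ip x y = cnj (gns_ip y x)" if "x \<in> range gns_vec" "y \<in> range gns_vec" for x y
      using that by (auto simp: gns_ip_vec star_mult star_star simp flip: state_star)
    show "Re (gns_ip x x) > 0" if x: "x \<in> range gns_vec" "x \<noteq> 0" for x
    proof -
      obtain b where b: "x = gns_vec b" using x by blast
      have "state_norm b \<noteq> 0" using x b state_norm_zero by (auto simp: gns_vec_def fun_eq_iff)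
      then show ?thesis
        using state_positive[of b] by (auto simp: b gns_ip_vec state_norm_def less_le)
    qed
  qed
qed

sublocale gns: complex_inner_product_space fun_scale "range gns_vec" gns_ip
  by (rule gns_inner_product_space)

lemma gns_hnorm: "gns.hnorm (gns_vec b) = state_norm b"
  by (simp add: gns.hnorm_def gns_ip_vec state_norm_def)

lemma gns_hnorm_diff: "gns.hnorm (gns_vec b - gns_vec c) = state_norm (b - c)"
  by (simp add: gns_hnorm flip: gns_vec_diff)

text \<open>The successive differences of a fast Cauchy sequence of vectors have representatives
  \<open>b e n\<close> of almost the same norm, whose series converges in the algebra.\<close>

lemma gns_hilbert_space: "complex_hilbert_space fun_scale (range gns_vec) gns_ip"
proof
  fix \<sigma> :: "nat \<Rightarrow> 'a \<Rightarrow> complex"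
  assume s: "\<And>n. \<sigma> n \<in> range gns_vec"
    and cauchy: "\<forall>\<epsilon>>0. \<exists>N. \<forall>m\<ge>N. \<forall>n\<ge>N. gns.hnorm (\<sigma> m - \<sigma> n) < \<epsilon>"
  have "\<forall>n. \<exists>b. \<sigma> n = gns_vec b" using s by (auto simp: image_iff)
  then obtain b where b: "\<And>n. \<sigma> n = gns_vec (b n)" by metis
  have "\<forall>k::nat. \<exists>N. \<forall>m\<ge>N. \<forall>n\<ge>N. state_norm (b m - b n) < (1/2) ^ k"
    using cauchy by (simp add: b gns_hnorm_diff)
  then obtain N where N: "\<And>k m n. m \<ge> N k \<Longrightarrow> n \<ge> N k \<Longrightarrow> state_norm (b m - b n) < (1/2) ^ k"
    by metis
  \<comment> \<open>summing makes both \<open>r k\<close> and \<open>r (Suc k)\<close> at least \<open>N k\<close>\<close>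
  define r where "r k = (\<Sum>i\<le>k. N i)" for k
  have r: "r k \<ge> N k" "r (Suc k) \<ge> N k" for k
    by (auto simp: r_def intro: member_le_sum trans_le_add1)
  have "\<exists>d. gns_vec d = gns_vec (b (r (Suc k)) - b (r k)) \<and> norm d < (1/2) ^ k" for k
  proof -
    have "\<forall>\<^sub>F n in sequentially. norm ((b (r (Suc k)) - b (r k)) * e n) < (1/2) ^ k"
      using order_tendstoD(2)[OF state_norm_limit N[OF r(2,1)]] .
    then obtain n where "norm ((b (r (Suc k)) - b (r k)) * e n) < (1/2) ^ k"
      using eventually_happens trivial_limit_sequentially by blast
    then show ?thesis using gns_vec_mult_e(1) by blast
  qed
  then obtain d where d: "\<And>k. gns_vec (d k) = gns_vec (b (r (Suc k)) - b (r k))"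
    "\<And>k. norm (d k) < (1/2) ^ k" by metis
  have "summable d"
  proof (rule summable_comparison_test'[of "\<lambda>k. (1/2) ^ k :: real" 0])
    show "norm (d k) \<le> (1/2) ^ k" for k using d(2)[of k] by simp
  qed (simp add: summable_geometric)
  define c where "c = b (r 0) + suminf d"
  have vr: "gns_vec (b (r k)) = gns_vec (b (r 0) + sum d {..<k})" for k
  proof (induction k)
    case (Suc k)
    have "gns_vec (b (r (Suc k))) = gns_vec (b (r k)) + gns_vec (b (r (Suc k)) - b (r k))"
      by (simp flip: gns_vec_add)
    also have "\<dots> = gns_vec (b (r 0) + sum d {..<k}) + gns_vec (d k)" by (simp add: Suc d(1))
    finally show ?case by (simp add: add.assoc flip: gns_vec_add)
  qed simp
  have "(\<lambda>k. norm (b (r 0) + sum d {..<k} - c)) \<longlonglongrightarrow> norm (b (r 0) + suminf d - c)"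
    by (intro tendsto_intros summable_LIMSEQ \<open>summable d\<close>)
  then have lim: "(\<lambda>k. norm (b (r 0) + sum d {..<k} - c)) \<longlonglongrightarrow> 0" by (simp add: c_def)
  have sub: "state_norm (b (r k) - c) \<le> norm (b (r 0) + sum d {..<k} - c)" for k
  proof -
    have "state_norm (b (r k) - c) = state_norm (b (r 0) + sum d {..<k} - c)"
      using vr[of k] by (metis gns_hnorm_diff)
    then show ?thesis using state_norm_le by simp
  qed
  have half: "(\<lambda>k. (1/2) ^ k :: real) \<longlonglongrightarrow> 0" by (rule LIMSEQ_power_zero) simp
  have "(\<lambda>n. state_norm (b n - c)) \<longlonglongrightarrow> 0"
  proof (rule LIMSEQ_I)
    fix \<epsilon> :: real assume eps: "\<epsilon> > 0"
    have "\<forall>\<^sub>F k in sequentially. (1/2) ^ k < \<epsilon> / 2 \<and> norm (b (r 0) + sum d {..<k} - c) < \<epsilon> / 2"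
      using eps by (intro eventually_conj order_tendstoD(2)[OF half] order_tendstoD(2)[OF lim]) auto
    then obtain k where k: "(1/2) ^ k < \<epsilon> / 2" "norm (b (r 0) + sum d {..<k} - c) < \<epsilon> / 2"
      using eventually_happens trivial_limit_sequentially by blast
    have "norm (state_norm (b n - c) - 0) < \<epsilon>" if n: "n \<ge> N k" for n
    proof -
      have "state_norm (b n - c) \<le> state_norm (b n - b (r k)) + state_norm (b (r k) - c)"
        using state_norm_triangle[of "b n - b (r k)" "b (r k) - c"] by simp
      also have "\<dots> < \<epsilon>" using N[OF n r(1)] sub[of k] k by linarith
      finally show ?thesis using state_positive by (simp add: state_norm_def)
    qed
    then show "\<exists>M. \<forall>n\<ge>M. norm (state_norm (b n - c) - 0) < \<epsilon>" by blast
  qed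
  then show "\<exists>x\<in>range gns_vec. (\<lambda>n. gns.hnorm (\<sigma> n - x)) \<longlonglongrightarrow> 0"
    by (intro bexI[of _ "gns_vec c"]) (simp_all add: b gns_hnorm_diff)
qed

lemma gns_star_representation: "star_representation fun_scale (range gns_vec) gns_ip gns_rep"
proof -
  interpret complex_hilbert_space fun_scale "range gns_vec" gns_ip by (rule gns_hilbert_space)
  show ?thesis
  proof
    fix a b :: 'a and c :: complex and x y :: "'a \<Rightarrow> complex"
    show "gns_rep a x \<in> range gns_vec" if "x \<in> range gns_vec"
      using that by (auto simp: gns_rep_vec)
    show "gns_rep a (x + y) = gns_rep a x + gns_rep a y" by (simp add: gns_rep_def plus_fun_def)
    show "gns_rep a (fun_scale c x) = fun_scale c (gns_rep a x)"
      by (simp add: gns_rep_def fun_scale_def)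
    show "\<exists>B. \<forall>x\<in>range gns_vec. gns.hnorm (gns_rep a x) \<le> B * gns.hnorm x"
      by (intro exI[of _ "norm a"]) (auto simp: gns_rep_vec gns_hnorm state_norm_mult)
    show "gns_rep (a + b) x = gns_rep a x + gns_rep b x" if "x \<in> range gns_vec"
      using that by (auto simp: gns_rep_vec distrib_right gns_vec_add)
    show "gns_rep (c *\<^sub>C a) x = fun_scale c (gns_rep a x)" if "x \<in> range gns_vec"
      using that by (auto simp: gns_rep_vec mult_scaleC_left gns_vec_scale)
    show "gns_rep (a * b) x = gns_rep a (gns_rep b x)" if "x \<in> range gns_vec"
      using that by (auto simp: gns_rep_vec mult.assoc)
    show "gns_ip (gns_rep (star a) x) y = gns_ip x (gns_rep a y)"
      if "x \<in> range gns_vec" "y \<in> range gns_vec"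
      using that by (auto simp: gns_rep_vec gns_ip_vec star_mult mult.assoc)
  qed
qed

text \<open>For a non-zero \<open>gns_vec b\<close> in a closed invariant subspace, \<open>e n b\<^sup>* b e n\<close> approaches a non-zero multiple
  of \<open>e n\<close>. So the cyclic vector \<open>gns_vec (e n)\<close>, which does not depend on \<open>n\<close>, is in the
  subspace.\<close>

lemma gns_irreducible: "irreducible_representation fun_scale (range gns_vec) gns_ip gns_rep"
proof -
  interpret R: star_representation fun_scale "range gns_vec" gns_ip gns_rep
    by (rule gns_star_representation)
  have cyclic: "gns_rep a (gns_vec (e 0)) = gns_vec a" for a
    by (simp add: gns_rep_vec gns_vec_mult_e)
  show ?thesis
  proof
    have "gns_rep (e 0) (gns_vec (e 0)) \<noteq> 0" using gns_vec_e_nonzero by (simp add: cyclic)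
    then show "\<exists>a. \<exists>x\<in>range gns_vec. gns_rep a x \<noteq> 0" by blast
    fix K assume K: "gns.subspace K" "K \<subseteq> range gns_vec" "gns.hclosed K"
      and inv: "\<And>a x. x \<in> K \<Longrightarrow> gns_rep a x \<in> K"
    show "K = {0} \<or> K = range gns_vec"
    proof (cases "K = {0}")
      case False
      then obtain b where b: "gns_vec b \<in> K" "gns_vec b \<noteq> 0"
        using K(2) gns.subspace_0[OF K(1)] by blast
      define r where "r = state (star b * b)"
      have r0: "r \<noteq> 0" using gns.ip_pos[of "gns_vec b"] b by (auto simp: gns_ip_vec r_def)
      have mem: "gns_vec (e n * (star b * b)) \<in> K" for n
        using inv[OF b(1), of "e n * star b"] by (simp add: gns_rep_vec mult.assoc)
      have le: "norm (gns.hnorm (gns_vec (e n * (star b * b)) - gns_vec (r *\<^sub>C e 0)))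
          \<le> norm (e n * (star b * b) * e n - r *\<^sub>C e n)" for n
      proof -
        have "gns_vec (e n * (star b * b)) - gns_vec (r *\<^sub>C e 0)
            = gns_vec (e n * (star b * b) * e n - r *\<^sub>C e n)"
          using gns_vec_mult_e(2)[of 0 n] by (simp add: gns_vec_diff gns_vec_scale gns_vec_mult_e(1))
        then show ?thesis
          using state_norm_le by (simp add: gns_hnorm state_norm_def state_positive)
      qed
      have lim: "(\<lambda>n. norm (e n * (star b * b) * e n - r *\<^sub>C e n)) \<longlonglongrightarrow> 0"
        unfolding r_def by (intro tendsto_norm_zero state_lim)
      have "(\<lambda>n. gns.hnorm (gns_vec (e n * (star b * b)) - gns_vec (r *\<^sub>C e 0))) \<longlonglongrightarrow> 0"
        by (rule Lim_null_comparison[OF always_eventually[OF allI[OF le]] lim])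
      with mem have "gns_vec (r *\<^sub>C e 0) \<in> K"
        by (intro K(3)[unfolded gns.hclosed_def, rule_format,
              of "gns_vec (r *\<^sub>C e 0)" "\<lambda>n. gns_vec (e n * (star b * b))"]) auto
      then have "fun_scale (inverse r) (gns_vec (r *\<^sub>C e 0)) \<in> K" by (rule gns.subspace_scale[OF K(1)])
      then have "gns_vec (e 0) \<in> K" using r0 by (simp add: scaleC_scaleC flip: gns_vec_scale)
      then have "gns_vec a \<in> K" for a using inv[of "gns_vec (e 0)" a] by (simp add: cyclic)
      then show ?thesis using K(2) by blast
    qed simp
  qed
qed

end

text \<open>There are enough primitive ideals to separate a closed ideal from the projections outside it.
  The minimal projections \<open>e n \<le> q\<close> are chosen outside \<open>I\<close>, so that the state vanishes on \<open>I\<close>; and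
  \<open>q\<close> fixes the cyclic vector.\<close>

theorem primitive_ideal_avoiding_projection:
  assumes U: "AF_sequence \<U>" and I: "I \<in> closed_ideals"
    and q: "projection q" "q \<in> \<U> m" "q \<notin> I"
  obtains Q where "Q \<in> Prim" "I \<subseteq> Q" "q \<notin> Q"
proof -
  define V where "V n = \<U> (m + n)" for n
  have "AF_sequence V" unfolding V_def by (rule AF_sequence_shift[OF U])
  moreover have "q \<in> V 0" using q by (simp add: V_def)
  ultimately obtain e where e: "minimal_projections V e" "\<And>n. e n \<notin> I" "\<And>n. q * e n = e n"
    using minimal_projections_exist[OF _ I q(1) _ q(3)] by blast
  interpret minimal_projections V e by (rule e)
  interpret X: irreducible_representation fun_scale "range gns_vec" gns_ip gns_rep
    by (rule gns_irreducible)
  let ?Q = "rep_kernel (range gns_vec) gns_rep"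
  have "gns_vec (x * b) = 0" if "x \<in> I" for x b
  proof -
    have "star a * (x * b) \<in> I" for a using that closed_idealsD(6,7)[OF I] by simp
    then show ?thesis using state_vanishes_on_ideal[OF I e(2)] by (auto simp: gns_vec_def)
  qed
  then have "I \<subseteq> ?Q" by (auto simp: rep_kernel_def gns_rep_vec)
  moreover have "gns_rep q (gns_vec (e 0)) \<noteq> 0" by (simp add: gns_rep_vec e(3) gns_vec_e_nonzero)
  then have "q \<notin> ?Q" by (auto simp: rep_kernel_def)
  ultimately show ?thesis using that X.rep_kernel_in_Prim by blast
qed

section \<open>The metric topology on the primitive ideals\<close>

text \<open>The projections of \<open>B\<close> form a compact set, so finitely many of them have all the others
  within distance less than 1. Close projections are in the same closed ideals, and \<open>I \<inter> B\<close> is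
  determined by the projections in it, as one of them is a right unit.\<close>

lemma finite_test_projections:
  fixes B :: "'a::cstar_algebra set"
  assumes B: "cstar_subalgebra B" "finite_dimensional B"
  shows "\<exists>F. finite F \<and> (\<forall>q\<in>F. projection q \<and> q \<in> B) \<and>
    (\<forall>I\<in>closed_ideals. \<forall>J\<in>closed_ideals. (\<forall>q\<in>F. q \<in> I \<longleftrightarrow> q \<in> J) \<longrightarrow> I \<inter> B = J \<inter> B)"
proof -
  define S where "S = {q \<in> B. projection q}"
  have "seq_compact S"
    unfolding seq_compact_def
  proof (intro allI impI)
    fix f :: "nat \<Rightarrow> 'a" assume f: "\<forall>n. f n \<in> S"
    have "f n \<in> B" "norm (f n) \<le> 1" for n using f projection_norm(2) by (auto simp: S_def)
    then obtain l r where l: "l \<in> B" "strict_mono r" "(f \<circ> r) \<longlonglongrightarrow> l"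
      by (metis finite_dimensional_bounded_seq[OF B(2)])
    have pr: "projection ((f \<circ> r) n)" for n using f by (simp add: S_def)
    have "(\<lambda>n. (f \<circ> r) n * (f \<circ> r) n) \<longlonglongrightarrow> l * l" by (intro tendsto_mult l(3))
    then have "(f \<circ> r) \<longlonglongrightarrow> l * l" using pr by (simp add: projection_def o_def)
    from LIMSEQ_unique[OF this l(3)] have "l * l = l" .
    moreover have "(\<lambda>n. star ((f \<circ> r) n)) \<longlonglongrightarrow> star l" by (intro tendsto_star l(3))
    then have "(f \<circ> r) \<longlonglongrightarrow> star l" using pr by (simp add: projection_def o_def)
    from LIMSEQ_unique[OF this l(3)] have "star l = l" .
    ultimately have "l \<in> S" using l(1) by (simp add: S_def projection_def)
    then show "\<exists>l\<in>S. \<exists>r. strict_mono r \<and> (f \<circ> r) \<longlonglongrightarrow> l" using l by blast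
  qed
  then obtain F where F: "finite F" "F \<subseteq> S" "S \<subseteq> (\<Union>q\<in>F. ball q 1)"
    using seq_compact_imp_totally_bounded[of S] zero_less_one by metis
  have mem: "q \<in> J" if I: "I \<in> closed_ideals" and J: "J \<in> closed_ideals"
    and IJ: "\<forall>q\<in>F. q \<in> I \<longleftrightarrow> q \<in> J" and q: "q \<in> S" "q \<in> I" for I J q
  proof -
    obtain q' where q': "q' \<in> F" "norm (q' - q) < 1" using F(3) q(1) by (auto simp: dist_norm)
    have "projection q'" using F(2) q'(1) by (auto simp: S_def)
    then have "q' \<in> J" using projection_near_ideal[OF _ I q(2) q'(2)] IJ q' by blast
    moreover have "projection q" using q(1) by (simp add: S_def)
    moreover have "norm (q - q') < 1" using q'(2) by (simp add: norm_minus_commute)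
    ultimately show ?thesis using projection_near_ideal[OF _ J] by blast
  qed
  have sub: "I \<inter> B \<subseteq> J" if I: "I \<in> closed_ideals" and J: "J \<in> closed_ideals"
    and IJ: "\<forall>q\<in>F. q \<in> I \<longleftrightarrow> q \<in> J" for I J
  proof
    fix x assume x: "x \<in> I \<inter> B"
    obtain p where p: "projection p" "p \<in> B \<inter> I" "\<And>x. x \<in> B \<inter> I \<Longrightarrow> x * p = x"
      using ideal_right_unit[OF B I] by blast
    have "p \<in> J" using mem[OF I J IJ, of p] p by (simp add: S_def)
    then have "x * p \<in> J" using closed_idealsD(6)[OF J] by simp
    then show "x \<in> J" using p(3)[of x] x by simp
  qed
  show ?thesis
  proof (intro exI[of _ F] conjI ballI impI F(1))
    show "projection q" "q \<in> B" if "q \<in> F" for q using that F(2) by (auto simp: S_def)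
    show "I \<inter> B = J \<inter> B"
      if "I \<in> closed_ideals" "J \<in> closed_ideals" "\<forall>q\<in>F. q \<in> I \<longleftrightarrow> q \<in> J" for I J
      using sub[of I J] sub[of J I] that by blast
  qed
qed

lemma ideal_dist_less:
  assumes U: "AF_sequence \<U>"
  shows "ideal_dist \<U> I J < (1/2) ^ n \<longleftrightarrow> I \<inter> \<U> n = J \<inter> \<U> n"
proof (cases "\<forall>n. I \<inter> \<U> n = J \<inter> \<U> n")
  case False
  define m where "m = (LEAST m. I \<inter> \<U> m \<noteq> J \<inter> \<U> m)"
  have "\<exists>m. I \<inter> \<U> m \<noteq> J \<inter> \<U> m" using False by simp
  then have m: "I \<inter> \<U> m \<noteq> J \<inter> \<U> m" unfolding m_def by (rule LeastI_ex)
  have d: "ideal_dist \<U> I J = (1/2) ^ m" unfolding ideal_dist_def m_def using False by (simp only: if_False)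
  have "I \<inter> \<U> n = J \<inter> \<U> n \<longleftrightarrow> n < m"
  proof
    assume "n < m"
    from not_less_Least[OF this[unfolded m_def]] show "I \<inter> \<U> n = J \<inter> \<U> n" by simp
  next
    assume n: "I \<inter> \<U> n = J \<inter> \<U> n"
    show "n < m"
    proof (rule ccontr)
      assume "\<not> n < m"
      then have "\<U> m \<subseteq> \<U> n" using AF_sequenceD(3)[OF U, of m n] by simp
      then show False using m n by blast
    qed
  qed
  then show ?thesis by (simp add: d power_strict_decreasing_iff)
qed (simp add: ideal_dist_def)

lemma ideal_metric_space:
  assumes U: "AF_sequence \<U>"
  shows "Metric_space closed_ideals (ideal_dist \<U>)"
proof
  fix I J K :: "'a set"
  show "0 \<le> ideal_dist \<U> I J" by (simp add: ideal_dist_def)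
  show "ideal_dist \<U> I J = ideal_dist \<U> J I"
    unfolding ideal_dist_def by (simp only: eq_commute[of "I \<inter> _"])
  assume IJ: "I \<in> closed_ideals" "J \<in> closed_ideals"
  show "ideal_dist \<U> I J = 0 \<longleftrightarrow> I = J"
  proof
    assume "ideal_dist \<U> I J = 0"
    then have "I \<inter> \<U> n = J \<inter> \<U> n" for n using ideal_dist_less[OF U, of I J n] by simp
    then have "I \<inter> \<U> n \<subseteq> J" "J \<inter> \<U> n \<subseteq> I" for n by blast+
    then show "I = J" using closed_ideal_subsetI[OF U] IJ by (intro equalityI) auto
  qed (simp add: ideal_dist_def)
  assume "K \<in> closed_ideals"
  have nonneg: "0 \<le> ideal_dist \<U> I J" for I J :: "'a set" by (simp add: ideal_dist_def)
  show "ideal_dist \<U> I K \<le> ideal_dist \<U> I J + ideal_dist \<U> J K"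
  proof (cases "\<forall>n. I \<inter> \<U> n = K \<inter> \<U> n")
    case True
    then have "ideal_dist \<U> I K = 0" by (simp add: ideal_dist_def)
    then show ?thesis using nonneg[of I J] nonneg[of J K] by simp
  next
    case False
    define m where "m = (LEAST m. I \<inter> \<U> m \<noteq> K \<inter> \<U> m)"
    have "\<exists>m. I \<inter> \<U> m \<noteq> K \<inter> \<U> m" using False by simp
    then have "I \<inter> \<U> m \<noteq> K \<inter> \<U> m" unfolding m_def by (rule LeastI_ex)
    then have "I \<inter> \<U> m \<noteq> J \<inter> \<U> m \<or> J \<inter> \<U> m \<noteq> K \<inter> \<U> m" by blast
    then have "(1/2) ^ m \<le> ideal_dist \<U> I J \<or> (1/2) ^ m \<le> ideal_dist \<U> J K"
      using ideal_dist_less[OF U] by (simp add: not_less[symmetric])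
    moreover have "ideal_dist \<U> I K = (1/2) ^ m"
      unfolding ideal_dist_def m_def using False by (simp only: if_False)
    ultimately show ?thesis using nonneg[of I J] nonneg[of J K] by linarith
  qed
qed

lemma openin_prim_metric:
  assumes U: "AF_sequence \<U>"
  shows "openin (subtopology (ideal_metric_topology \<U>) Prim) W \<longleftrightarrow>
    W \<subseteq> Prim \<and> (\<forall>P\<in>W. \<exists>n. \<forall>Q\<in>Prim. Q \<inter> \<U> n = P \<inter> \<U> n \<longrightarrow> Q \<in> W)"
proof -
  interpret M: Metric_space closed_ideals "ideal_dist \<U>" by (rule ideal_metric_space[OF U])
  interpret S: Submetric closed_ideals "ideal_dist \<U>" Prim
    by unfold_locales (rule Prim_closed_ideals)
  have ball: "S.sub.mball P ((1/2) ^ n) = {Q \<in> Prim. Q \<inter> \<U> n = P \<inter> \<U> n}" if "P \<in> Prim" for P n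
    using that ideal_dist_less[OF U, of P _ n] by (auto simp: S.sub.mball_def)
  have "(\<exists>r>0. S.sub.mball P r \<subseteq> W) \<longleftrightarrow> (\<exists>n. S.sub.mball P ((1/2) ^ n) \<subseteq> W)" for P
  proof
    assume "\<exists>r>0. S.sub.mball P r \<subseteq> W"
    then obtain r where r: "r > 0" "S.sub.mball P r \<subseteq> W" by blast
    obtain n where "(1/2) ^ n < r" using real_arch_pow_inv[OF r(1), of "1/2"] by auto
    then have "S.sub.mball P ((1/2) ^ n) \<subseteq> S.sub.mball P r" by (intro S.sub.mball_subset_concentric) simp
    then show "\<exists>n. S.sub.mball P ((1/2) ^ n) \<subseteq> W" using r(2) by blast
  next
    assume "\<exists>n. S.sub.mball P ((1/2) ^ n) \<subseteq> W"
    then obtain n where "S.sub.mball P ((1/2) ^ n) \<subseteq> W" by blast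
    then show "\<exists>r>0. S.sub.mball P r \<subseteq> W" by (intro exI[of _ "(1/2) ^ n"]) simp
  qed
  moreover have "S.sub.mball P ((1/2) ^ n) \<subseteq> W \<longleftrightarrow> (\<forall>Q\<in>Prim. Q \<inter> \<U> n = P \<inter> \<U> n \<longrightarrow> Q \<in> W)"
    if "P \<in> Prim" for P n
    unfolding ball[OF that] by blast
  ultimately have *: "(\<exists>r>0. S.sub.mball P r \<subseteq> W) \<longleftrightarrow>
      (\<exists>n. \<forall>Q\<in>Prim. Q \<inter> \<U> n = P \<inter> \<U> n \<longrightarrow> Q \<in> W)" if "P \<in> Prim" for P
    using that by simp
  show ?thesis
    unfolding ideal_metric_topology_def S.mtopology_submetric[symmetric] S.sub.openin_mtopology
      Ball_def
    by (intro conj_cong refl iff_allI imp_cong *[unfolded Ball_def]) (rule subsetD)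
qed

lemma topspace_prim_metric:
  assumes U: "AF_sequence \<U>"
  shows "topspace (subtopology (ideal_metric_topology \<U>) Prim) = Prim"
proof
  show "topspace (subtopology (ideal_metric_topology \<U>) Prim) \<subseteq> Prim" by simp
  have "openin (subtopology (ideal_metric_topology \<U>) Prim) Prim"
    by (simp add: openin_prim_metric[OF U])
  then show "Prim \<subseteq> topspace (subtopology (ideal_metric_topology \<U>) Prim)" by (rule openin_subset)
qed

lemma openin_agreement_set:
  assumes "finite F" "\<And>q. q \<in> F \<Longrightarrow> openin X {x \<in> topspace X. R x q}"
    "\<And>q. q \<in> F \<Longrightarrow> openin X {x \<in> topspace X. \<not> R x q}"
  shows "openin X {x \<in> topspace X. \<forall>q\<in>F. R x q \<longleftrightarrow> R y q}"
  using assms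
proof (induction F)
  case (insert q F)
  have "openin X {x \<in> topspace X. R x q \<longleftrightarrow> R y q}" using insert.prems by (cases "R y q") auto
  moreover have "openin X {x \<in> topspace X. \<forall>q\<in>F. R x q \<longleftrightarrow> R y q}"
    using insert.IH insert.prems by blast
  ultimately have "openin X ({x \<in> topspace X. R x q \<longleftrightarrow> R y q} \<inter>
      {x \<in> topspace X. \<forall>q\<in>F. R x q \<longleftrightarrow> R y q})" by (rule openin_Int)
  moreover have "{x \<in> topspace X. R x q \<longleftrightarrow> R y q} \<inter> {x \<in> topspace X. \<forall>q\<in>F. R x q \<longleftrightarrow> R y q}
      = {x \<in> topspace X. \<forall>q\<in>insert q F. R x q \<longleftrightarrow> R y q}" by auto
  ultimately show ?case by simp
qed simp


section \<open>Clopen sets of the Jacobson topology\<close>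

definition ideal_hull :: "'a::cstar_algebra set \<Rightarrow> 'a set" where
  "ideal_hull S = \<Inter>{I \<in> closed_ideals. S \<subseteq> I}"

lemma ideal_hull_closed_ideal: "ideal_hull S \<in> closed_ideals"
  unfolding ideal_hull_def by (rule closed_ideals_Inter) blast

lemma ideal_hull_subset_iff: "I \<in> closed_ideals \<Longrightarrow> ideal_hull S \<subseteq> I \<longleftrightarrow> S \<subseteq> I"
  unfolding ideal_hull_def by blast

lemma closure_closed_ideal:
  fixes G :: "'a::cstar_algebra set"
  assumes G: "0 \<in> G" "\<And>x y. x \<in> G \<Longrightarrow> y \<in> G \<Longrightarrow> x + y \<in> G" "\<And>x c. x \<in> G \<Longrightarrow> c *\<^sub>C x \<in> G"
    "\<And>x y. x \<in> G \<Longrightarrow> y * x \<in> G \<and> x * y \<in> G"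
  shows "closure G \<in> closed_ideals"
proof -
  have lim: "l \<in> closure G" if "g \<longlonglongrightarrow> l" "\<And>n. g n \<in> G" for g :: "nat \<Rightarrow> 'a" and l
    using that unfolding closure_sequential by auto
  have "x + y \<in> closure G" if xy: "x \<in> closure G" "y \<in> closure G" for x y
  proof -
    obtain f where f: "\<And>n. f n \<in> G" "f \<longlonglongrightarrow> x"
      using xy(1) unfolding closure_sequential by blast
    obtain g where g: "\<And>n. g n \<in> G" "g \<longlonglongrightarrow> y"
      using xy(2) unfolding closure_sequential by blast
    have "(\<lambda>n. f n + g n) \<longlonglongrightarrow> x + y" by (intro tendsto_add f g)
    then show ?thesis by (rule lim) (simp add: f(1) g(1) G(2))
  qed
  moreover have "c *\<^sub>C x \<in> closure G \<and> y * x \<in> closure G \<and> x * y \<in> closure G"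
    if x: "x \<in> closure G" for c x y
  proof -
    obtain f where f: "\<And>n. f n \<in> G" "f \<longlonglongrightarrow> x" using x unfolding closure_sequential by blast
    have "(\<lambda>n. c *\<^sub>C f n) \<longlonglongrightarrow> c *\<^sub>C x" "(\<lambda>n. y * f n) \<longlonglongrightarrow> y * x" "(\<lambda>n. f n * y) \<longlonglongrightarrow> x * y"
      by (intro tendsto_scaleC tendsto_mult tendsto_const f)+
    then show ?thesis using f(1) G(3,4) by (simp add: lim)
  qed
  moreover have "0 \<in> closure G" using G(1) closure_subset by blast
  ultimately show ?thesis unfolding closed_ideals_def complex_vs.subspace_def by simp
qed

lemma closedin_projection_members:
  "closedin jacobson_topology {Q \<in> Prim. (q :: 'a::cstar_algebra) \<in> Q}"
proof -
  have "{Q \<in> Prim. q \<in> Q} = prim_hull (ideal_hull {q})"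
    using ideal_hull_subset_iff[of _ "{q}"] Prim_closed_ideals by (auto simp: prim_hull_def)
  then show ?thesis unfolding closedin_jacobson using ideal_hull_closed_ideal by blast
qed

text \<open>Suppose the complements of the hulls of the ideals in a family cover the set. Then the
  projection is in all primitive ideals above the family, hence in the closed ideal generated by
  the family, hence in the ideal generated by a finite subfamily, because a projection at
  distance less than 1 from a closed ideal belongs to it.\<close>

lemma compactin_projection_nonmembers:
  fixes \<U> :: "nat \<Rightarrow> 'a::cstar_algebra set"
  assumes U: "AF_sequence \<U>" and q: "projection q" "q \<in> \<U> m"
  shows "compactin jacobson_topology {Q \<in> Prim. q \<notin> Q}"
  unfolding compactin_def
proof (intro conjI allI impI)
  show "{Q \<in> Prim. q \<notin> Q} \<subseteq> topspace jacobson_topology" by (auto simp: topspace_jacobson)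
  fix \<V> :: "'a set set set"
  assume V: "Ball \<V> (openin jacobson_topology) \<and> {Q \<in> Prim. q \<notin> Q} \<subseteq> \<Union>\<V>"
  then have "\<forall>V\<in>\<V>. \<exists>I\<in>closed_ideals. V = Prim - prim_hull I" by (simp add: openin_jacobson)
  then obtain i where i: "\<And>V. V \<in> \<V> \<Longrightarrow> i V \<in> closed_ideals" "\<And>V. V \<in> \<V> \<Longrightarrow> V = Prim - prim_hull (i V)"
    by metis
  define L where "L F = ideal_hull (\<Union>V\<in>F. i V)" for F
  have L: "L F \<in> closed_ideals" "\<And>I. I \<in> closed_ideals \<Longrightarrow> L F \<subseteq> I \<longleftrightarrow> (\<forall>V\<in>F. i V \<subseteq> I)" for F
    by (simp_all add: L_def ideal_hull_closed_ideal ideal_hull_subset_iff UN_subset_iff)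
  define G where "G = \<Union>{L F |F. finite F \<and> F \<subseteq> \<V>}"
  have mono: "L F \<subseteq> L F'" if "F \<subseteq> F'" for F F'
  proof -
    have "L F' \<subseteq> L F'" by simp
    then show ?thesis using L that by blast
  qed
  have G_iff: "x \<in> G \<longleftrightarrow> (\<exists>F. finite F \<and> F \<subseteq> \<V> \<and> x \<in> L F)" for x by (auto simp: G_def)
  have "closure G \<in> closed_ideals"
  proof (rule closure_closed_ideal)
    show "0 \<in> G" using closed_idealsD(1)[OF L(1)[of "{}"]] by (auto simp: G_iff)
    show "c *\<^sub>C x \<in> G" "y * x \<in> G \<and> x * y \<in> G" if "x \<in> G" for c x y
      using that closed_idealsD(5,6,7)[OF L(1)] unfolding G_iff by metis+
    show "x + y \<in> G" if xy: "x \<in> G" "y \<in> G" for x y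
    proof -
      obtain F F' where F: "finite F" "F \<subseteq> \<V>" "x \<in> L F" "finite F'" "F' \<subseteq> \<V>" "y \<in> L F'"
        using xy unfolding G_iff by blast
      then have "x \<in> L (F \<union> F')" "y \<in> L (F \<union> F')"
        using mono[of F "F \<union> F'"] mono[of F' "F \<union> F'"] by auto
      then have "x + y \<in> L (F \<union> F')" by (rule closed_idealsD(3)[OF L(1)])
      then show ?thesis unfolding G_iff using F by (intro exI[of _ "F \<union> F'"]) simp
    qed
  qed
  have "q \<in> closure G"
  proof (rule ccontr)
    assume "q \<notin> closure G"
    then obtain Q where Q: "Q \<in> Prim" "closure G \<subseteq> Q" "q \<notin> Q"
      using primitive_ideal_avoiding_projection[OF U \<open>closure G \<in> closed_ideals\<close> q] by blast
    then obtain V where "V \<in> \<V>" "Q \<in> V" using V by blast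
    then have "\<not> i V \<subseteq> Q" using i(2)[of V] Q(1) by (auto simp: prim_hull_def)
    moreover have "i V \<subseteq> L {V}" using L(2)[OF L(1), of "{V}" "{V}"] by simp
    moreover have "L {V} \<subseteq> G" using \<open>V \<in> \<V>\<close> by (auto simp: G_iff intro!: exI[of _ "{V}"])
    moreover have "G \<subseteq> Q" using Q(2) closure_subset by blast
    ultimately show False by blast
  qed
  then obtain z where "z \<in> G" "norm (q - z) < 1"
    unfolding closure_approachable dist_norm by (metis norm_minus_commute zero_less_one)
  then obtain F where F: "finite F" "F \<subseteq> \<V>" "q \<in> L F"
    using projection_near_ideal[OF q(1) L(1)] unfolding G_iff by blast
  have "{Q \<in> Prim. q \<notin> Q} \<subseteq> \<Union>F"
  proof
    fix Q assume Q: "Q \<in> {Q \<in> Prim. q \<notin> Q}"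
    then have "\<not> L F \<subseteq> Q" using F(3) by blast
    then obtain V where V: "V \<in> F" "\<not> i V \<subseteq> Q" using L(2) Q Prim_closed_ideals by blast
    then have "Q \<in> V" using i(2)[of V] F(2) Q by (auto simp: prim_hull_def)
    then show "Q \<in> \<Union>F" using V by blast
  qed
  then show "\<exists>F. finite F \<and> F \<subseteq> \<V> \<and> {Q \<in> Prim. q \<notin> Q} \<subseteq> \<Union>F" using F by blast
qed

text \<open>By the choice of the test projections, a ball of the metric contains an agreement set, a finite
  intersection of sets \<open>{Q. q \<in> Q}\<close> and their complements. The set \<open>{Q. q \<in> Q}\<close> is Jacobson closed,
  and its complement is compact, hence closed in a Hausdorff space. Conversely, if \<open>I\<close> is not
  contained in \<open>P\<close>, then this is already visible in a finite-dimensional stage.\<close>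

theorem Hausdorff_metric_eq_jacobson:
  fixes \<U> :: "nat \<Rightarrow> 'a::cstar_algebra set"
  assumes U: "AF_sequence \<U>" and H: "Hausdorff_space (jacobson_topology :: 'a set topology)"
  shows "subtopology (ideal_metric_topology \<U>) Prim = jacobson_topology"
  unfolding topology_eq
proof (intro allI iffI)
  fix W :: "'a set set"
  assume W: "openin (subtopology (ideal_metric_topology \<U>) Prim) W"
  show "openin jacobson_topology W"
  proof (subst openin_subopen, intro ballI)
    fix P assume P: "P \<in> W"
    have "W \<subseteq> Prim" and "\<exists>n. \<forall>Q\<in>Prim. Q \<inter> \<U> n = P \<inter> \<U> n \<longrightarrow> Q \<in> W"
      using W P by (simp_all add: openin_prim_metric[OF U])
    then obtain n where n: "\<And>Q. Q \<in> Prim \<Longrightarrow> Q \<inter> \<U> n = P \<inter> \<U> n \<Longrightarrow> Q \<in> W" by auto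
    have "P \<in> Prim" using P \<open>W \<subseteq> Prim\<close> by (rule subsetD[rotated])
    obtain F where F: "finite F" "\<forall>q\<in>F. projection q \<and> q \<in> \<U> n"
      "\<forall>I\<in>closed_ideals. \<forall>J\<in>closed_ideals. (\<forall>q\<in>F. q \<in> I \<longleftrightarrow> q \<in> J) \<longrightarrow>
        I \<inter> \<U> n = J \<inter> \<U> n"
      using finite_test_projections[OF AF_sequenceD(1,2)[OF U, of n]] by auto
    let ?T = "{Q \<in> topspace jacobson_topology. \<forall>q\<in>F. q \<in> Q \<longleftrightarrow> q \<in> P}"
    have "openin jacobson_topology ?T"
    proof (rule openin_agreement_set[OF F(1)])
      fix q assume q: "q \<in> F"
      have eq: "Prim - {Q \<in> Prim. q \<in> Q} = {Q \<in> Prim. q \<notin> Q}"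
        "Prim - {Q \<in> Prim. q \<notin> Q} = {Q \<in> Prim. q \<in> Q}" by auto
      show "openin jacobson_topology {Q \<in> topspace jacobson_topology. q \<notin> Q}"
        using openin_diff[OF openin_topspace closedin_projection_members[of q]]
        unfolding topspace_jacobson eq .
      have "closedin jacobson_topology {Q \<in> Prim. q \<notin> Q}"
        using compactin_imp_closedin[OF H compactin_projection_nonmembers[OF U]] F(2) q by blast
      from openin_diff[OF openin_topspace this]
      show "openin jacobson_topology {Q \<in> topspace jacobson_topology. q \<in> Q}"
        unfolding topspace_jacobson eq .
    qed
    moreover have "P \<in> ?T" using \<open>P \<in> Prim\<close> by (simp add: topspace_jacobson)
    moreover have "?T \<subseteq> W"
    proof
      fix Q assume Q: "Q \<in> ?T"
      then have "Q \<in> Prim" by (simp add: topspace_jacobson)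
      moreover have "Q \<inter> \<U> n = P \<inter> \<U> n"
        by (rule F(3)[THEN bspec, THEN bspec, THEN mp,
              OF subsetD[OF Prim_closed_ideals \<open>Q \<in> Prim\<close>]
                subsetD[OF Prim_closed_ideals \<open>P \<in> Prim\<close>]]) (use Q in simp)
      ultimately show "Q \<in> W" by (rule n)
    qed
    ultimately show "\<exists>T. openin jacobson_topology T \<and> P \<in> T \<and> T \<subseteq> W" by blast
  qed
next
  fix W :: "'a set set"
  assume "openin jacobson_topology W"
  then obtain I where I: "I \<in> closed_ideals" "W = Prim - prim_hull I"
    unfolding openin_jacobson by blast
  show "openin (subtopology (ideal_metric_topology \<U>) Prim) W"
    unfolding openin_prim_metric[OF U]
  proof (intro conjI ballI)
    show "W \<subseteq> Prim" using I by blast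
    fix P assume "P \<in> W"
    then have P: "P \<in> Prim" "P \<in> closed_ideals" "\<not> I \<subseteq> P"
      using I Prim_closed_ideals by (auto simp: prim_hull_def)
    then obtain n where n: "\<not> I \<inter> \<U> n \<subseteq> P" using closed_ideal_subsetI[OF U I(1)] by blast
    have "Q \<in> W" if "Q \<in> Prim" "Q \<inter> \<U> n = P \<inter> \<U> n" for Q
      using n that unfolding I(2) prim_hull_def by blast
    then show "\<exists>n. \<forall>Q\<in>Prim. Q \<inter> \<U> n = P \<inter> \<U> n \<longrightarrow> Q \<in> W" by blast
  qed
qed


section \<open>The Fell topology on the primitive ideals\<close>

text \<open>Points are closed in a Hausdorff space, so the embedding of \<open>Prim\<close> into its closed subsets
  is \<open>P \<mapsto> {P}\<close>, and the sets \<open>{P}\<close> that avoid a compact set or meet an open set are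
  parametrised by open sets.\<close>

theorem Hausdorff_fell_eq_jacobson:
  assumes H: "Hausdorff_space (jacobson_topology :: 'a::cstar_algebra set topology)"
  shows "subtopology fell_ideal_topology Prim = (jacobson_topology :: 'a set topology)"
proof -
  let ?J = "jacobson_topology :: 'a set topology"
  have hull: "prim_hull P = {P}" if P: "P \<in> Prim" for P :: "'a set"
  proof -
    have "closedin ?J {P}" using closedin_Hausdorff_singleton[OF H] P by (simp add: topspace_jacobson)
    then obtain I where "{P} = prim_hull I" unfolding closedin_jacobson by blast
    then have "prim_hull P \<subseteq> {P}" by (auto simp: prim_hull_def)
    then show ?thesis using P by (auto simp: prim_hull_def)
  qed
  have sub: "openin (subtopology fell_ideal_topology Prim) W \<longleftrightarrow>
      (\<exists>U. openin (fell_topology ?J) U \<and> W = {P \<in> Prim. {P} \<in> U})" for W :: "'a set set"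
  proof -
    have "prim_hull -` U \<inter> closed_ideals \<inter> Prim = {P \<in> Prim. {P} \<in> U}" for U :: "'a set set set"
      using Prim_closed_ideals by (auto simp: hull)
    then show ?thesis
      unfolding openin_subtopology fell_ideal_topology_def openin_pullback_topology by metis
  qed
  have "openin ?J {P \<in> Prim. {P} \<in> fell_basic ?J K F}"
    if K: "compactin ?J K" and F: "finite F" "\<forall>A\<in>F. openin ?J A \<and> A \<noteq> {}" for K F
  proof -
    have "openin ?J ((topspace ?J - K) \<inter> \<Inter>(insert (topspace ?J) F))"
      using F compactin_imp_closedin[OF H K]
      by (intro openin_Int openin_diff openin_Inter) auto
    moreover have "closedin ?J {P}" if "P \<in> Prim" for P
      using closedin_Hausdorff_singleton[OF H] that by (simp add: topspace_jacobson)
    then have "{P \<in> Prim. {P} \<in> fell_basic ?J K F} = (topspace ?J - K) \<inter> \<Inter>(insert (topspace ?J) F)"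
      by (auto simp: fell_basic_def topspace_jacobson)
    ultimately show ?thesis by simp
  qed
  note basic = this
  show ?thesis
    unfolding topology_eq
  proof (intro allI iffI)
    fix W :: "'a set set"
    assume "openin (subtopology fell_ideal_topology Prim) W"
    then obtain U where U: "openin (fell_topology ?J) U" "W = {P \<in> Prim. {P} \<in> U}"
      unfolding sub by blast
    obtain \<B> where \<B>: "\<Union>\<B> = U" "\<And>B. B \<in> \<B> \<Longrightarrow> \<exists>K F. compactin ?J K \<and> finite F \<and>
        (\<forall>A\<in>F. openin ?J A \<and> A \<noteq> {}) \<and> B = fell_basic ?J K F"
      using U(1) unfolding openin_fell union_of_def subset_iff mem_Collect_eq by metis
    have "W = (\<Union>B\<in>\<B>. {P \<in> Prim. {P} \<in> B})" using U(2) \<B>(1) by blast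
    moreover have "openin ?J {P \<in> Prim. {P} \<in> B}" if "B \<in> \<B>" for B
      using \<B>(2)[OF that] basic by blast
    ultimately show "openin ?J W" by blast
  next
    fix W :: "'a set set"
    assume W: "openin ?J W"
    show "openin (subtopology fell_ideal_topology Prim) W"
    proof (cases "W = {}")
      case False
      have "openin (fell_topology ?J) (fell_basic ?J {} {W})"
        unfolding openin_fell
        by (rule arbitrary_union_of_inc) (use W False in \<open>intro exI[of _ "{}"] exI[of _ "{W}"], simp\<close>)
      moreover have "W = {P \<in> Prim. {P} \<in> fell_basic ?J {} {W}}"
        using openin_subset[OF W] closedin_Hausdorff_singleton[OF H]
        by (auto simp: fell_basic_def topspace_jacobson)
      ultimately show ?thesis unfolding sub by blast
    qed simp
  qed
qed

section \<open>Characters\<close>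

lemma characters_iff:
  "\<phi> \<in> characters \<longleftrightarrow> (\<forall>x y. \<phi> (x + y) = \<phi> x + \<phi> y) \<and> (\<forall>c x. \<phi> (c *\<^sub>C x) = c * \<phi> x) \<and>
     (\<forall>x y. \<phi> (x * y) = \<phi> x * \<phi> y) \<and> (\<exists>x. \<phi> x \<noteq> 0)"
  by (auto simp: characters_def Vector_Spaces.linear_iff complex_vs.vector_space_axioms
      vector_space_over_itself.vector_space_axioms)

lemma characterD:
  assumes "\<phi> \<in> characters"
  shows "\<phi> (x + y) = \<phi> x + \<phi> y" "\<phi> (c *\<^sub>C x) = c * \<phi> x" "\<phi> (x * y) = \<phi> x * \<phi> y"
    "\<exists>x. \<phi> x \<noteq> 0" "\<phi> 0 = 0" "\<phi> (x - y) = \<phi> x - \<phi> y"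
proof -
  have *: "\<phi> (x + y) = \<phi> x + \<phi> y" for x y using assms by (simp add: characters_iff)
  show "\<phi> (x + y) = \<phi> x + \<phi> y" by (rule *)
  show "\<phi> 0 = 0" using *[of 0 0] by simp
  show "\<phi> (x - y) = \<phi> x - \<phi> y" using *[of "x - y" y] by simp
qed (use assms in \<open>simp_all add: characters_iff\<close>)

text \<open>If \<open>|\<phi> a|\<close> were larger than \<open>\<parallel>a\<parallel>\<close>, the geometric series \<open>c\<close> of \<open>b = a / \<phi> a\<close> would satisfy
  \<open>c = b + b c\<close>, that is \<open>\<phi> c = 1 + \<phi> c\<close>.\<close>

lemma character_bound:
  fixes \<phi> :: "'a::cstar_algebra \<Rightarrow> complex"
  assumes \<phi>: "\<phi> \<in> characters"
  shows "cmod (\<phi> a) \<le> norm a"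
proof (rule ccontr)
  assume "\<not> cmod (\<phi> a) \<le> norm a"
  then have less: "norm a < cmod (\<phi> a)" by simp
  then have nz: "\<phi> a \<noteq> 0" using norm_ge_zero[of a] by (metis norm_zero not_less)
  define b where "b = inverse (\<phi> a) *\<^sub>C a"
  have "norm b = norm a / cmod (\<phi> a)"
    by (simp add: b_def norm_scaleC norm_inverse divide_inverse mult.commute)
  then have b1: "norm b < 1" using less nz by (simp add: divide_less_eq)
  have \<phi>b: "\<phi> b = 1" using nz by (simp add: b_def characterD(2)[OF \<phi>])
  have "dist (b + b * x) (b + b * y) \<le> norm b * dist x y" for x y
    using norm_mult_ineq[of b "x - y"] by (simp add: dist_norm right_diff_distrib)
  then have "\<exists>!x\<in>UNIV. b + b * x = x"
    using Banach_fix[of "UNIV :: 'a set" "norm b" "\<lambda>x. b + b * x"] b1 by (simp add: complete_UNIV)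
  then obtain c where c: "b + b * c = c" by blast
  have "\<phi> c = \<phi> b + \<phi> b * \<phi> c"
    using arg_cong[OF c, of \<phi>] by (simp add: characterD(1,3)[OF \<phi>])
  then show False by (simp add: \<phi>b)
qed

lemma bounded_linear_character:
  assumes \<phi>: "\<phi> \<in> characters"
  shows "bounded_linear \<phi>"
proof (rule bounded_linear_intro[of _ 1])
  show "\<phi> (r *\<^sub>R x) = r *\<^sub>R \<phi> x" for r x
    by (simp add: scaleR_scaleC characterD(2)[OF \<phi>] scaleR_conv_of_real)
qed (simp_all add: characterD(1)[OF \<phi>] character_bound[OF \<phi>])

lemma character_kernel_closed_ideal:
  assumes \<phi>: "\<phi> \<in> characters"
  shows "{a. \<phi> a = 0} \<in> closed_ideals"
proof -
  have "closed {a. \<phi> a = 0}"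
    by (intro closed_Collect_eq continuous_on_const
        linear_continuous_on[OF bounded_linear_character[OF \<phi>]])
  moreover have "complex_vs.subspace {a. \<phi> a = 0}"
    by (rule complex_vs.subspaceI) (simp_all add: characterD[OF \<phi>])
  ultimately show ?thesis by (simp add: closed_ideals_def characterD(3)[OF \<phi>])
qed

text \<open>For a self-adjoint \<open>h\<close>, the bound applied to \<open>h + i t e\<close> with \<open>t\<close> real gives
  \<open>(Im (\<phi> h) + t)\<^sup>2 - t\<^sup>2 \<le> \<parallel>h\<parallel>\<^sup>2\<close>, which fails for some \<open>t\<close> unless \<open>\<phi> h\<close> is real.\<close>

lemma character_star:
  fixes \<phi> :: "'a::cstar_algebra \<Rightarrow> complex"
  assumes unital: "unital_algebra TYPE('a)" and \<phi>: "\<phi> \<in> characters"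
  shows "\<phi> (star a) = cnj (\<phi> a)"
proof -
  obtain e :: 'a where e: "\<And>x. e * x = x" "\<And>x. x * e = x"
    using unital unfolding unital_algebra_def by auto
  have "star e = star e * star (star e)" by (simp add: e star_star)
  also have "\<dots> = e" by (metis e(1) star_mult star_star)
  finally have se: "star e = e" .
  have ne: "norm e \<le> 1" using projection_norm(2)[of e] by (simp add: projection_def e se)
  obtain x where x: "\<phi> x \<noteq> 0" using characterD(4)[OF \<phi>] by blast
  have "\<phi> x = \<phi> x * \<phi> e" using characterD(3)[OF \<phi>, of x e] by (simp add: e)
  then have \<phi>e: "\<phi> e = 1" using x by simp
  have real: "Im (\<phi> h) = 0" if h: "star h = h" for h
  proof (rule ccontr)
    assume nz: "Im (\<phi> h) \<noteq> 0"
    define \<beta> where "\<beta> = Im (\<phi> h)"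
    have *: "\<beta>\<^sup>2 + 2 * \<beta> * t \<le> (norm h)\<^sup>2" for t :: real
    proof -
      define k where "k = h + (\<i> * of_real t) *\<^sub>C e"
      have "star k = h - (\<i> * of_real t) *\<^sub>C e"
        by (simp add: k_def star_add star_scaleC h se)
      then have "star k * k = h * h - ((\<i> * of_real t) * (\<i> * of_real t)) *\<^sub>C e"
        unfolding k_def by (simp only: distrib_left left_diff_distrib mult_scaleC_left
            mult_scaleC_right e scaleC_scaleC complex_vs.scale_right_diff_distrib) simp
      also have "(\<i> * of_real t) * (\<i> * of_real t) = - complex_of_real (t\<^sup>2)"
        by (simp add: power2_eq_square complex_eq_iff)
      finally have "star k * k = h * h + of_real (t\<^sup>2) *\<^sub>C e" by simp
      then have "(norm k)\<^sup>2 \<le> (norm h)\<^sup>2 + norm (of_real (t\<^sup>2) *\<^sub>C e)"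
        using norm_triangle_ineq[of "h * h" "of_real (t\<^sup>2) *\<^sub>C e"] cstar_identity[of k]
          norm_selfadjoint_square[OF h] by simp
      also have "norm (of_real (t\<^sup>2) *\<^sub>C e) \<le> t\<^sup>2"
        using mult_left_mono[OF ne, of "t\<^sup>2"] by (simp add: norm_scaleC norm_power)
      finally have "(norm k)\<^sup>2 \<le> (norm h)\<^sup>2 + t\<^sup>2" by simp
      moreover have "\<bar>\<beta> + t\<bar> \<le> norm k"
      proof -
        have "\<phi> k = \<phi> h + \<i> * of_real t" by (simp add: k_def characterD[OF \<phi>] \<phi>e)
        then have "Im (\<phi> k) = \<beta> + t" by (simp add: \<beta>_def)
        then show ?thesis using abs_Im_le_cmod[of "\<phi> k"] character_bound[OF \<phi>, of k] by simp
      qed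
      then have "(\<beta> + t)\<^sup>2 \<le> (norm k)\<^sup>2" using abs_le_square_iff[of "\<beta> + t" "norm k"] by simp
      ultimately show ?thesis by (simp add: power2_sum)
    qed
    \<comment> \<open>at this \<open>t\<close> the linear term alone equals the right-hand side\<close>
    have "\<beta> \<noteq> 0" using nz by (simp add: \<beta>_def)
    then have "2 * \<beta> * ((norm h)\<^sup>2 / (2 * \<beta>)) = (norm h)\<^sup>2" "\<beta>\<^sup>2 > 0" by simp_all
    then show False using *[of "(norm h)\<^sup>2 / (2 * \<beta>)"] by linarith
  qed
  define u where "u = a + star a"
  define v where "v = \<i> *\<^sub>C (a - star a)"
  have "star u = u" "star v = v"
    by (simp_all add: u_def v_def star_add star_diff star_star star_scaleC add.commute
        complex_vs.scale_right_diff_distrib star_minus)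
  then have "Im (\<phi> u) = 0" "Im (\<phi> v) = 0" using real by blast+
  then show ?thesis by (simp add: u_def v_def characterD[OF \<phi>] complex_eq_iff)
qed

lemma character_kernel_Prim:
  fixes \<phi> :: "'a::cstar_algebra \<Rightarrow> complex"
  assumes unital: "unital_algebra TYPE('a)" and \<phi>: "\<phi> \<in> characters"
  shows "{a. \<phi> a = 0} \<in> Prim"
proof -
  \<comment> \<open>the one-dimensional representation\<close>
  interpret P: complex_inner_product_space "(*)" "UNIV :: complex set" "\<lambda>x y. x * cnj y"
  proof
    show "vector_space_over_itself.subspace UNIV" by (rule vector_space_over_itself.subspaceI) simp_all
    show "Re (x * cnj x) > 0" if "x \<noteq> 0" for x :: complex
      using that by (simp add: complex_mult_cnj complex_neq_0)
  qed (auto simp: algebra_simps)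
  have hnorm: "P.hnorm x = cmod x" for x
    by (simp add: P.hnorm_def complex_mult_cnj cmod_def)
  interpret Q: complex_hilbert_space "(*)" "UNIV :: complex set" "\<lambda>x y. x * cnj y"
  proof
    fix \<sigma> :: "nat \<Rightarrow> complex"
    assume "\<forall>\<epsilon>>0. \<exists>N. \<forall>m\<ge>N. \<forall>n\<ge>N. P.hnorm (\<sigma> m - \<sigma> n) < \<epsilon>"
    then have "Cauchy \<sigma>" by (simp add: Cauchy_def hnorm dist_norm)
    then obtain l where "\<sigma> \<longlonglongrightarrow> l" using convergent_eq_Cauchy by blast
    then have "(\<lambda>n. P.hnorm (\<sigma> n - l)) \<longlonglongrightarrow> 0"
      unfolding hnorm by (intro tendsto_norm_zero) (simp add: LIM_zero_iff)
    then show "\<exists>x\<in>UNIV. (\<lambda>n. P.hnorm (\<sigma> n - x)) \<longlonglongrightarrow> 0" by blast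
  qed
  interpret R: irreducible_representation "(*)" "UNIV :: complex set" "\<lambda>x y. x * cnj y"
    "\<lambda>a x. \<phi> a * x"
  proof
    show "\<exists>B. \<forall>x\<in>UNIV. P.hnorm (\<phi> a * x) \<le> B * P.hnorm x" for a
      by (intro exI[of _ "cmod (\<phi> a)"]) (simp add: hnorm norm_mult)
    show "\<exists>a. \<exists>x\<in>UNIV. \<phi> a * x \<noteq> 0" using characterD(4)[OF \<phi>] by (auto intro: exI[of _ 1])
    fix K :: "complex set" assume K: "vector_space_over_itself.subspace K"
    show "K = {0} \<or> K = UNIV"
    proof (cases "K = {0}")
      case False
      then obtain z where z: "z \<in> K" "z \<noteq> 0" using vector_space_over_itself.subspace_0[OF K] by blast
      have "w \<in> K" for w using vector_space_over_itself.subspace_scale[OF K z(1), of "w / z"] z(2) by simp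
      then show ?thesis by blast
    qed simp
  qed (simp_all add: characterD[OF \<phi>] character_star[OF unital \<phi>] algebra_simps)
  have "rep_kernel UNIV (\<lambda>a x. \<phi> a * x) = {a. \<phi> a = 0}"
    by (auto simp: rep_kernel_def dest: spec[of _ 1])
  then show ?thesis using R.rep_kernel_in_Prim by simp
qed


section \<open>Primitive ideals of a commutative AF algebra\<close>

text \<open>In a commutative algebra, compression by a projection is multiplicative.\<close>

lemma (in minimal_projections) commutative_state_mult:
  assumes comm: "\<And>x y :: 'a. x * y = y * x"
  shows "state (a * b) = state a * state b"
proof (rule state_unique)
  define X where "X n = e n * a * e n - state a *\<^sub>C e n" for n
  define Y where "Y n = e n * b * e n - state b *\<^sub>C e n" for n
  have lim: "X \<longlonglongrightarrow> 0" "Y \<longlonglongrightarrow> 0" unfolding X_def Y_def by (rule state_lim)+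
  have "e n * (a * b) * e n = (e n * a * e n) * (e n * b * e n)" for n
  proof -
    have "(e n * a * e n) * (e n * b * e n) = e n * a * (e n * e n) * (b * e n)"
      by (simp only: mult.assoc)
    also have "\<dots> = e n * a * (e n * b) * e n" by (simp only: ee mult.assoc)
    also have "\<dots> = e n * a * b * (e n * e n)" by (simp only: comm[of "e n" b] mult.assoc)
    finally show ?thesis by (simp only: ee mult.assoc)
  qed
  moreover have "e n * a * e n = X n + state a *\<^sub>C e n" "e n * b * e n = Y n + state b *\<^sub>C e n" for n
    by (simp_all add: X_def Y_def)
  moreover have "X n * e n = X n" "e n * Y n = Y n" for n
    by (simp_all add: X_def Y_def algebra_simps mult_scaleC_left mult_scaleC_right ee)
      (simp_all add: ee flip: mult.assoc)
  ultimately have "e n * (a * b) * e n - (state a * state b) *\<^sub>C e n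
      = X n * Y n + state b *\<^sub>C X n + state a *\<^sub>C Y n" for n
    by (simp add: distrib_left distrib_right mult_scaleC_left mult_scaleC_right scaleC_scaleC ee
        scaleC_add_right mult.commute)
  moreover have "(\<lambda>n. X n * Y n + state b *\<^sub>C X n + state a *\<^sub>C Y n)
      \<longlonglongrightarrow> 0 * 0 + state b *\<^sub>C 0 + state a *\<^sub>C 0"
    by (intro tendsto_add tendsto_mult tendsto_scaleC tendsto_const lim)
  ultimately show "(\<lambda>n. e n * (a * b) * e n - (state a * state b) *\<^sub>C e n) \<longlonglongrightarrow> 0" by simp
qed

text \<open>The unit of a stage is in the ideal only if the whole stage is, and a closed ideal that
  contains all stages is the whole algebra.\<close>

lemma ideal_complement_projection:
  assumes U: "AF_sequence \<U>" and I: "I \<in> closed_ideals" "I \<noteq> UNIV"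
  obtains m q where "projection q" "q \<in> \<U> m" "q \<notin> I"
proof (rule ccontr)
  assume none: "\<not> thesis"
  have "\<U> n \<subseteq> I" for n
  proof
    fix x assume x: "x \<in> \<U> n"
    obtain p where p: "projection p" "p \<in> \<U> n \<inter> UNIV" "\<And>x. x \<in> \<U> n \<inter> UNIV \<Longrightarrow> x * p = x"
      using ideal_right_unit[OF AF_sequenceD(1,2)[OF U] UNIV_closed_ideal] by blast
    have "p \<in> I" using none that[of p n] p by auto
    then have "x * p \<in> I" by (rule closed_idealsD(6)[OF I(1)])
    then show "x \<in> I" using p(3)[of x] x by simp
  qed
  then have "UNIV \<subseteq> I" by (intro closed_ideal_subsetI[OF U UNIV_closed_ideal I(1)]) simp
  then show False using I(2) by blast
qed

text \<open>The state of a decreasing sequence of minimal projections \<open>e n \<notin> P\<close> is a character that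
  vanishes on \<open>P\<close>. Conversely, an element \<open>a\<close> of its kernel in a finite-dimensional stage has
  \<open>a e n = 0\<close>, and primeness of \<open>P\<close> gives \<open>a \<in> P\<close>.\<close>

lemma Prim_character_kernel:
  fixes \<U> :: "nat \<Rightarrow> 'a::cstar_algebra set" and P :: "'a set"
  assumes U: "AF_sequence \<U>" and comm: "\<And>x y :: 'a. x * y = y * x" and P: "P \<in> Prim"
  obtains \<phi> where "\<phi> \<in> characters" "{a. \<phi> a = 0} = P"
proof -
  have PI: "P \<in> closed_ideals" using P Prim_closed_ideals by (rule subsetD[rotated])
  obtain m q where q: "projection q" "q \<in> \<U> m" "q \<notin> P"
    using ideal_complement_projection[OF U PI Prim_proper[OF P]] by blast
  define V where "V n = \<U> (m + n)" for n
  have AF: "AF_sequence V" unfolding V_def by (rule AF_sequence_shift[OF U])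
  have "q \<in> V 0" using q by (simp add: V_def)
  then obtain e where e: "minimal_projections V e" "\<And>n. e n \<notin> P"
    using minimal_projections_exist[OF AF PI q(1) _ q(3)] by metis
  interpret minimal_projections V e by (rule e(1))
  have char: "state \<in> characters"
    unfolding characters_iff
    using state_e[of 0] by (auto simp: state_add state_scaleC commutative_state_mult[OF comm]
        intro!: exI[of _ "e 0"])
  have "P \<subseteq> {a. state a = 0}" using state_vanishes_on_ideal[OF PI e(2)] by blast
  moreover have "{a. state a = 0} \<subseteq> P"
  proof (rule closed_ideal_subsetI[OF AF character_kernel_closed_ideal[OF char] PI], rule subsetI)
    fix n a assume a: "a \<in> {a. state a = 0} \<inter> V n"
    then have "e n * a * e n = 0" using state_in_stage[of a n n] by simp
    then have ae: "a * e n = 0" by (metis comm ee mult.assoc)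
    define I where "I = {x. x * e n = 0}"
    define J where "J = {x. x * e n = x}"
    have cont: "continuous_on UNIV (\<lambda>x. x * e n)" by (intro continuous_intros)
    have "I \<in> closed_ideals" unfolding closed_ideals_def
    proof (intro CollectI conjI)
      show "complex_vs.subspace I"
        by (rule complex_vs.subspaceI) (auto simp: I_def distrib_right mult_scaleC_left)
      show "closed I" unfolding I_def by (intro closed_Collect_eq cont continuous_on_const)
      show "\<forall>a\<in>I. \<forall>x. x * a \<in> I \<and> a * x \<in> I"
        by (auto simp: I_def mult.assoc) (metis comm mult.assoc mult_zero_left)
    qed
    moreover have "J \<in> closed_ideals" unfolding closed_ideals_def
    proof (intro CollectI conjI)
      show "complex_vs.subspace J"
        by (rule complex_vs.subspaceI) (auto simp: J_def distrib_right mult_scaleC_left)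
      show "closed J" unfolding J_def by (intro closed_Collect_eq cont continuous_on_id)
      show "\<forall>a\<in>J. \<forall>x. x * a \<in> J \<and> a * x \<in> J"
        by (auto simp: J_def mult.assoc) (metis comm mult.assoc)
    qed
    moreover have "I \<inter> J \<subseteq> P" using closed_idealsD(1)[OF PI] by (auto simp: I_def J_def)
    then have "P \<in> prim_hull (I \<inter> J)" using P by (simp add: prim_hull_def)
    ultimately have "I \<subseteq> P \<or> J \<subseteq> P" using prim_hull_Int[of I J] by (auto simp: prim_hull_def)
    moreover have "e n \<in> J" by (simp add: J_def ee)
    ultimately show "a \<in> P" using e(2)[of n] ae by (auto simp: I_def)
  qed
  ultimately show ?thesis using that[OF char] by blast
qed

text \<open>Once \<open>\<phi>\<close> is not zero on \<open>B\<close>, it is 1 at the unit \<open>p\<close> of \<open>B\<close>, and \<open>b - \<phi> b p\<close> is in its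
  kernel.\<close>

lemma characters_agree_on_stage:
  assumes B: "cstar_subalgebra B" "finite_dimensional B"
    and \<phi>: "\<phi> \<in> characters" and \<psi>: "\<psi> \<in> characters"
    and ker: "{a. \<psi> a = 0} \<inter> B = {a. \<phi> a = 0} \<inter> B"
    and c: "c \<in> B" "\<phi> c \<noteq> 0" and b: "b \<in> B"
  shows "\<psi> b = \<phi> b"
proof -
  obtain p where p: "projection p" "p \<in> B \<inter> UNIV" "\<And>x. x \<in> B \<inter> UNIV \<Longrightarrow> x * p = x"
    using ideal_right_unit[OF B UNIV_closed_ideal] by blast
  have "\<phi> c = \<phi> c * \<phi> p" using p(3)[of c] c(1) by (simp flip: characterD(3)[OF \<phi>])
  then have \<phi>p: "\<phi> p = 1" using c(2) by simp
  then have "p \<notin> {a. \<phi> a = 0} \<inter> B" by simp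
  then have "\<psi> p \<noteq> 0" using p(2) unfolding ker[symmetric] by simp
  moreover have "\<psi> p = \<psi> p * \<psi> p"
    using p(1) by (simp add: projection_def flip: characterD(3)[OF \<psi>])
  ultimately have \<psi>p: "\<psi> p = 1" by simp
  have "b - \<phi> b *\<^sub>C p \<in> {a. \<phi> a = 0} \<inter> B"
    using b p(2) cstar_subalgebraD[OF B(1)] by (simp add: characterD[OF \<phi>] \<phi>p)
  then have "\<psi> (b - \<phi> b *\<^sub>C p) = 0" unfolding ker[symmetric] by simp
  then show ?thesis by (simp add: characterD[OF \<psi>] \<psi>p)
qed

text \<open>Both continuity statements compare finite data at one stage. The kernels agree on \<open>\<U> n\<close> if the
  characters have the same zeros among finitely many projections, which is a weak-* open
  condition. Conversely, characters whose kernels agree on a large stage agree there, and so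
  are close at any given \<open>a\<close> that is close to this stage.\<close>

theorem character_kernel_homeomorphism:
  fixes \<U> :: "nat \<Rightarrow> 'a::cstar_algebra set"
  assumes unital: "unital_algebra TYPE('a)" and U: "AF_sequence \<U>"
    and comm: "commutative_algebra TYPE('a)"
  shows "homeomorphic_map weak_star_topology (subtopology (ideal_metric_topology \<U>) Prim)
    (\<lambda>\<phi>. {a. \<phi> a = 0})"
proof -
  let ?X = "weak_star_topology :: ('a \<Rightarrow> complex) topology"
  let ?Y = "subtopology (ideal_metric_topology \<U>) Prim"
  let ?k = "\<lambda>\<phi> :: 'a \<Rightarrow> complex. {a. \<phi> a = 0}"
  have comm': "x * y = y * x" for x y :: 'a using comm by (simp add: commutative_algebra_def)
  have topX: "topspace ?X = characters" by (simp add: weak_star_topology_def)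
  have topY: "topspace ?Y = Prim" by (rule topspace_prim_metric[OF U])
  note B = AF_sequenceD(1,2)[OF U]
  have near: "\<exists>n. \<forall>\<psi>\<in>characters. ?k \<psi> \<inter> \<U> n = ?k \<phi> \<inter> \<U> n \<longrightarrow> cmod (\<psi> a - \<phi> a) < \<epsilon>"
    if \<phi>: "\<phi> \<in> characters" and eps: "\<epsilon> > 0" for \<phi> a \<epsilon>
  proof -
    obtain l b where b: "b \<in> \<U> l" "norm (a - b) < \<epsilon> / 2"
      using AF_sequenceD(4)[OF U, of "\<epsilon> / 2" a] eps by auto
    obtain x where x: "\<phi> x \<noteq> 0" using characterD(4)[OF \<phi>] by blast
    then obtain m c where c: "c \<in> \<U> m" "norm (x - c) < cmod (\<phi> x)"
      using AF_sequenceD(4)[OF U, of "cmod (\<phi> x)" x] by auto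
    have "\<phi> c \<noteq> 0"
      using character_bound[OF \<phi>, of "x - c"] c(2) by (auto simp: characterD[OF \<phi>])
    let ?n = "max l m"
    have bc: "b \<in> \<U> ?n" "c \<in> \<U> ?n"
      using b(1) c(1) AF_sequenceD(3)[OF U, of l ?n] AF_sequenceD(3)[OF U, of m ?n] by auto
    have "cmod (\<psi> a - \<phi> a) < \<epsilon>"
      if \<psi>: "\<psi> \<in> characters" and ker: "?k \<psi> \<inter> \<U> ?n = ?k \<phi> \<inter> \<U> ?n" for \<psi>
    proof -
      have "\<psi> b = \<phi> b"
        by (rule characters_agree_on_stage[OF B \<phi> \<psi> ker bc(2) \<open>\<phi> c \<noteq> 0\<close> bc(1)])
      then have "\<psi> a - \<phi> a = \<psi> (a - b) - \<phi> (a - b)"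
        by (simp add: characterD[OF \<phi>] characterD[OF \<psi>])
      then have "cmod (\<psi> a - \<phi> a) \<le> cmod (\<psi> (a - b)) + cmod (\<phi> (a - b))"
        using norm_triangle_ineq4 by metis
      also have "\<dots> < \<epsilon>"
        using character_bound[OF \<phi>, of "a - b"] character_bound[OF \<psi>, of "a - b"] b(2) by simp
      finally show ?thesis .
    qed
    then show ?thesis by blast
  qed
  have inj: "\<psi> = \<phi>" if \<phi>: "\<phi> \<in> characters" and \<psi>: "\<psi> \<in> characters" and eq: "?k \<psi> = ?k \<phi>" for \<phi> \<psi>
  proof
    fix a
    have lt: "cmod (\<psi> a - \<phi> a) < \<epsilon>" if "\<epsilon> > 0" for \<epsilon>
      using near[OF \<phi> that, of a] \<psi> eq by auto
    show "\<psi> a = \<phi> a" using lt[of "cmod (\<psi> a - \<phi> a)"] by auto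
  qed
  define g where "g P = (SOME \<phi>. \<phi> \<in> characters \<and> ?k \<phi> = P)" for P
  have g: "g P \<in> characters" "?k (g P) = P" if P: "P \<in> Prim" for P
  proof -
    have "\<exists>\<phi>. \<phi> \<in> characters \<and> ?k \<phi> = P" using Prim_character_kernel[OF U comm' P] by blast
    then have "g P \<in> characters \<and> ?k (g P) = P" unfolding g_def by (rule someI_ex)
    then show "g P \<in> characters" "?k (g P) = P" by simp_all
  qed
  have kP: "?k \<phi> \<in> Prim" if "\<phi> \<in> characters" for \<phi>
    by (rule character_kernel_Prim[OF unital that])
  have eval: "continuous_map ?X euclidean (\<lambda>\<phi>. \<phi> a)" for a
    unfolding weak_star_topology_def
    by (intro continuous_map_from_subtopology continuous_map_product_projection) simp
  have "continuous_map ?X ?Y ?k"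
    unfolding continuous_map_def
  proof (intro conjI allI impI)
    show "?k \<in> topspace ?X \<rightarrow> topspace ?Y" unfolding topX topY using kP by blast
    fix W assume W: "openin ?Y W"
    show "openin ?X {\<phi> \<in> topspace ?X. ?k \<phi> \<in> W}"
    proof (subst openin_subopen, intro ballI)
      fix \<phi> assume "\<phi> \<in> {\<phi> \<in> topspace ?X. ?k \<phi> \<in> W}"
      then have \<phi>: "\<phi> \<in> characters" "?k \<phi> \<in> W" unfolding topX by simp_all
      then have "\<exists>n. \<forall>Q\<in>Prim. Q \<inter> \<U> n = ?k \<phi> \<inter> \<U> n \<longrightarrow> Q \<in> W"
        using W unfolding openin_prim_metric[OF U] by simp
      then obtain n where n: "\<And>Q. Q \<in> Prim \<Longrightarrow> Q \<inter> \<U> n = ?k \<phi> \<inter> \<U> n \<Longrightarrow> Q \<in> W" by auto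
      obtain F where F: "finite F" "\<forall>q\<in>F. projection q \<and> q \<in> \<U> n"
        "\<forall>I\<in>closed_ideals. \<forall>J\<in>closed_ideals. (\<forall>q\<in>F. q \<in> I \<longleftrightarrow> q \<in> J) \<longrightarrow>
          I \<inter> \<U> n = J \<inter> \<U> n"
        using finite_test_projections[OF B, of n] by auto
      let ?T = "{\<psi> \<in> topspace ?X. \<forall>q\<in>F. \<psi> q = 0 \<longleftrightarrow> \<phi> q = 0}"
      have "openin ?X ?T"
      proof (rule openin_agreement_set[OF F(1), of ?X "\<lambda>\<psi> q. \<psi> q = 0"])
        fix q assume q: "q \<in> F"
        have "openin ?X {\<psi> \<in> topspace ?X. \<psi> q \<in> - {0}}"
          by (rule openin_continuous_map_preimage[OF eval]) (simp add: open_Compl)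
        then show "openin ?X {\<psi> \<in> topspace ?X. \<psi> q \<noteq> 0}" by simp
        have "openin ?X {\<psi> \<in> topspace ?X. \<psi> q \<in> - {1}}"
          by (rule openin_continuous_map_preimage[OF eval]) (simp add: open_Compl)
        \<comment> \<open>characters only take the values 0 and 1 at a projection\<close>
        moreover have "\<psi> q \<noteq> 1 \<longleftrightarrow> \<psi> q = 0" if "\<psi> \<in> characters" for \<psi>
        proof -
          have "\<psi> q = \<psi> q * \<psi> q"
            using F(2) q by (simp add: projection_def flip: characterD(3)[OF that])
          then show ?thesis by auto
        qed
        then have "{\<psi> \<in> topspace ?X. \<psi> q \<in> - {1}} = {\<psi> \<in> topspace ?X. \<psi> q = 0}"
          unfolding topX by auto
        ultimately show "openin ?X {\<psi> \<in> topspace ?X. \<psi> q = 0}" by simp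
      qed
      moreover have "\<phi> \<in> ?T" using \<phi> by (simp add: topX)
      moreover have "?T \<subseteq> {\<phi> \<in> topspace ?X. ?k \<phi> \<in> W}"
      proof
        fix \<psi> assume \<psi>: "\<psi> \<in> ?T"
        then have ch: "\<psi> \<in> characters" unfolding topX by simp
        have "?k \<psi> \<inter> \<U> n = ?k \<phi> \<inter> \<U> n"
          by (rule F(3)[THEN bspec, THEN bspec, THEN mp,
                OF character_kernel_closed_ideal[OF ch] character_kernel_closed_ideal[OF \<phi>(1)]])
            (use \<psi> in simp)
        then have "?k \<psi> \<in> W" by (rule n[OF kP[OF ch]])
        then show "\<psi> \<in> {\<phi> \<in> topspace ?X. ?k \<phi> \<in> W}" using \<psi> by simp
      qed
      ultimately show "\<exists>T. openin ?X T \<and> \<phi> \<in> T \<and> T \<subseteq> {\<phi> \<in> topspace ?X. ?k \<phi> \<in> W}" by blast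
    qed
  qed
  moreover have "continuous_map ?Y ?X g"
    unfolding weak_star_topology_def continuous_map_in_subtopology
      continuous_map_componentwise_UNIV
  proof (intro conjI allI)
    show "g \<in> topspace ?Y \<rightarrow> characters" unfolding topY using g(1) by blast
    fix a
    show "continuous_map ?Y euclidean (\<lambda>P. g P a)"
      unfolding continuous_map_def
    proof (intro conjI allI impI)
      fix O' :: "complex set" assume "openin euclidean O'"
      then have O': "open O'" by simp
      show "openin ?Y {P \<in> topspace ?Y. g P a \<in> O'}"
        unfolding openin_prim_metric[OF U] topY
      proof (intro conjI ballI)
        fix P assume P: "P \<in> {P \<in> Prim. g P a \<in> O'}"
        then have PP: "P \<in> Prim" by simp
        obtain \<epsilon> where eps: "\<epsilon> > 0" "\<And>z. dist z (g P a) < \<epsilon> \<Longrightarrow> z \<in> O'"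
          using O' P unfolding open_dist by auto
        obtain n where n: "\<forall>\<psi>\<in>characters. ?k \<psi> \<inter> \<U> n = ?k (g P) \<inter> \<U> n \<longrightarrow>
            cmod (\<psi> a - g P a) < \<epsilon>"
          using near[OF g(1)[OF PP] eps(1), of a] by blast
        have "Q \<in> {P \<in> Prim. g P a \<in> O'}" if Q: "Q \<in> Prim" "Q \<inter> \<U> n = P \<inter> \<U> n" for Q
        proof -
          have "?k (g Q) \<inter> \<U> n = ?k (g P) \<inter> \<U> n" unfolding g(2)[OF Q(1)] g(2)[OF PP] by (rule Q(2))
          then have "cmod (g Q a - g P a) < \<epsilon>" using n g(1)[OF Q(1)] by simp
          then show ?thesis using eps(2)[of "g Q a"] Q(1) by (simp add: dist_norm)
        qed
        then show "\<exists>n. \<forall>Q\<in>Prim. Q \<inter> \<U> n = P \<inter> \<U> n \<longrightarrow> Q \<in> {P \<in> Prim. g P a \<in> O'}" by blast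
      qed auto
    qed simp
  qed
  moreover have "g (?k \<phi>) = \<phi>" if "\<phi> \<in> characters" for \<phi>
    using inj[OF that g(1)[OF kP[OF that]] g(2)[OF kP[OF that]]] .
  ultimately have "homeomorphic_maps ?X ?Y ?k g"
    unfolding homeomorphic_maps_def topX topY using g(2) by simp
  then show ?thesis unfolding homeomorphic_map_maps by blast
qed

theorem corollary3p32:
  fixes \<U> :: "nat \<Rightarrow> 'a::cstar_algebra set"
  assumes "unital_algebra TYPE('a)" and "AF_sequence \<U>"
  shows "(Hausdorff_space (jacobson_topology :: 'a set topology) \<longrightarrow>
            subtopology (ideal_metric_topology \<U>) Prim = jacobson_topology \<and>
            subtopology fell_ideal_topology Prim = (jacobson_topology :: 'a set topology)) \<and>
         (commutative_algebra TYPE('a) \<longrightarrow>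
            homeomorphic_map weak_star_topology (subtopology (ideal_metric_topology \<U>) Prim)
              (\<lambda>\<phi>. {a. \<phi> a = 0}))"
  using Hausdorff_metric_eq_jacobson[OF assms(2)] Hausdorff_fell_eq_jacobson
    character_kernel_homeomorphism[OF assms] by blast

end
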